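(* Let $\mathcal C$ be a strict monoidal category with coequalizers and $A$ a left coflat algebra in $\mathcal C$. Then there is a fully faithful strong monoidal functor $H:{}^!\mathcal T_A^\#\to{}_A^{\,!}\mathcal C_A$.
   Context: Conventions: $\mathcal C$ is a strict monoidal category with unit object $\underline 1$; the tensor product is written by juxtaposition, and the identity morphism of $X$ is written $X$ (so $fA=f\otimes \mathrm{Id}_A$). $(A,m,\eta)$ is an algebra in $\mathcal C$. $\mathcal C_A$, ${}_A\mathcal C$ and ${}_A\mathcal C_A$ denote the categories of right $A$-modules, left $A$-modules and $A$-bimodules in $\mathcal C$. Right (left) actions are denoted $\mu$ ($\nu$). The monoidal category $\mathcal T_A^\#$: objects are pairs $(X,\psi)$ with $X\in\mathcal C$ and $\psi:XA\to AX$ a morphism in $\mathcal C$ such that $\psi\circ Xm=mX\circ A\psi\circ\psi A$ and $\psi\circ X\eta=\eta X$. Morphisms $(X,\psi_X)\to(Y,\psi_Y)$ are morphisms $f:X\to AY$ in $\mathcal C$ with $mY\circ Af\circ\psi_X=mY\circ A\psi_Y\circ fA$; the composition of $f:X\to AY$ and $g:Y\to AZ$ is $g\bullet f=mZ\circ Ag\circ f$, and the identity of $(X,\psi)$ is $\eta X$. The tensor product of objects is $(XY,\psi_XY\circ X\psi_Y)$, and that of morphisms $f:X\to AX'$, $g:Y\to AY'$ is $mX'Y'\circ A\psi_{X'}Y'\circ fg$; the unit object is $(\underline 1,A)$. An object $X\in\mathcal C$ is left coflat if the functor $-\otimes X:\mathcal C\to\mathcal C$ preserves coequalizers. ${}^!\mathcal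 T_A^\#$ is the full (monoidal) subcategory of $\mathcal T_A^\#$ consisting of those $(X,\psi)$ with $X$ left coflat in $\mathcal C$. Bimodules: for $X\in\mathcal C_A$ and $Y\in{}_A\mathcal C$, $q:XY\to X\otimes_AY$ is the coequalizer of $\mu Y,X\nu:XAY\to XY$. $Y\in{}_A\mathcal C$ is robust as a left $A$-module if for all $M\in\mathcal C$ and $X\in\mathcal C_A$, $Mq:MXY\to M(X\otimes_AY)$ is the coequalizer of $M\mu Y$ and $MX\nu$. For $A$ left coflat, ${}_A^{\,!}\mathcal C_A$ is the full subcategory of ${}_A\mathcal C_A$ consisting of bimodules that are left coflat as objects of $\mathcal C$ and robust as left $A$-modules; it is a monoidal category with tensor product $\otimes_A$ and unit object $A$; the associativity constraint $\alpha:X\otimes_A(Y\otimes_AZ)\to(X\otimes_AY)\otimes_AZ$ is determined by $\alpha\circ q\circ Xq=q\circ qZ$, and the unit constraints $\rho_X:X\otimes_AA\to X$ and $\lambda_X:A\otimes_AX\to X$ by $\rho_X\circ q=\mu$ and $\lambda_X\circ q=\nu$. *)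

theory Defs
  imports Main
begin

section \<open>Categories\<close>

text \<open>
  A category is presented by a set of objects and a set of arrows, each arrow carrying its domain
  and codomain. Outside \<open>Obj\<close>, \<open>Arr\<close> and outside composable pairs the fields are unconstrained.
\<close>

record ('o, 'a) cat =
  Obj :: "'o set"
  Arr :: "'a set"
  Dom :: "'a \<Rightarrow> 'o"
  Cod :: "'a \<Rightarrow> 'o"
  Ident :: "'o \<Rightarrow> 'a"
  Comp :: "'a \<Rightarrow> 'a \<Rightarrow> 'a"  (infixr "\<cdot>\<index>" 65)

definition Hom :: "('o, 'a, 'z) cat_scheme \<Rightarrow> 'o \<Rightarrow> 'o \<Rightarrow> 'a set"  ("Hom\<index>")
  where "Hom\<^bsub>C\<^esub> X Y = {f \<in> Arr C. Dom C f = X \<and> Cod C f = Y}"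

locale category =
  fixes C :: "('o, 'a, 'z) cat_scheme" (structure)
  assumes Dom_in_Obj: "f \<in> Arr C \<Longrightarrow> Dom C f \<in> Obj C"
    and Cod_in_Obj: "f \<in> Arr C \<Longrightarrow> Cod C f \<in> Obj C"
    and Ident_in_Hom: "X \<in> Obj C \<Longrightarrow> Ident C X \<in> Hom X X"
    and Comp_in_Hom: "\<lbrakk>f \<in> Hom X Y; g \<in> Hom Y Z\<rbrakk> \<Longrightarrow> g \<cdot> f \<in> Hom X Z"
    and Comp_Ident: "f \<in> Hom X Y \<Longrightarrow> f \<cdot> Ident C X = f"
    and Ident_Comp: "f \<in> Hom X Y \<Longrightarrow> Ident C Y \<cdot> f = f"
    and Comp_assoc: "\<lbrakk>f \<in> Hom W X; g \<in> Hom X Y; h \<in> Hom Y Z\<rbrakk> \<Longrightarrow> (h \<cdot> g) \<cdot> f = h \<cdot> (g \<cdot> f)"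

definition is_iso :: "('o, 'a, 'z) cat_scheme \<Rightarrow> 'a \<Rightarrow> bool"
  where "is_iso C f \<longleftrightarrow> f \<in> Arr C \<and>
    (\<exists>g \<in> Hom\<^bsub>C\<^esub> (Cod C f) (Dom C f).
      g \<cdot>\<^bsub>C\<^esub> f = Ident C (Dom C f) \<and> f \<cdot>\<^bsub>C\<^esub> g = Ident C (Cod C f))"

definition is_coequalizer :: "('o, 'a, 'z) cat_scheme \<Rightarrow> 'a \<Rightarrow> 'a \<Rightarrow> 'a \<Rightarrow> bool"
  where "is_coequalizer C f g q \<longleftrightarrow>
    f \<in> Arr C \<and> g \<in> Arr C \<and> Dom C f = Dom C g \<and> Cod C f = Cod C g \<and>
    q \<in> Arr C \<and> Dom C q = Cod C f \<and> q \<cdot>\<^bsub>C\<^esub> f = q \<cdot>\<^bsub>C\<^esub> g \<and>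
    (\<forall>h \<in> Arr C. Dom C h = Cod C f \<and> h \<cdot>\<^bsub>C\<^esub> f = h \<cdot>\<^bsub>C\<^esub> g \<longrightarrow>
      (\<exists>!k. k \<in> Hom\<^bsub>C\<^esub> (Cod C q) (Cod C h) \<and> k \<cdot>\<^bsub>C\<^esub> q = h))"

definition has_coequalizers :: "('o, 'a, 'z) cat_scheme \<Rightarrow> bool"
  where "has_coequalizers C \<longleftrightarrow>
    (\<forall>X Y. \<forall>f \<in> Hom\<^bsub>C\<^esub> X Y. \<forall>g \<in> Hom\<^bsub>C\<^esub> X Y. \<exists>q. is_coequalizer C f g q)"

text \<open>The morphism \<open>k\<close> with \<open>k \<cdot> q = h\<close>; only used where \<open>h\<close> factors uniquely through \<open>q\<close>.\<close>

definition factor :: "('o, 'a, 'z) cat_scheme \<Rightarrow> 'a \<Rightarrow> 'a \<Rightarrow> 'a"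
  where "factor C q h = (THE k. k \<in> Hom\<^bsub>C\<^esub> (Cod C q) (Cod C h) \<and> k \<cdot>\<^bsub>C\<^esub> q = h)"

definition full_subcategory :: "('o, 'a, 'z) cat_scheme \<Rightarrow> ('o \<Rightarrow> bool) \<Rightarrow> ('o, 'a, 'z) cat_scheme"
  where "full_subcategory C P =
    C\<lparr>Obj := {X \<in> Obj C. P X}, Arr := {f \<in> Arr C. P (Dom C f) \<and> P (Cod C f)}\<rparr>"

section \<open>Functors\<close>

record ('o, 'a, 'p, 'b) functor_data =
  OnObj :: "'o \<Rightarrow> 'p"
  OnArr :: "'a \<Rightarrow> 'b"

locale category_functor = source: category C + target: category D
  for C :: "('o, 'a, 'y) cat_scheme" and D :: "('p, 'b, 'z) cat_scheme"
    and F :: "('o, 'a, 'p, 'b, 'w) functor_data_scheme" +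
  assumes OnObj_in_Obj: "X \<in> Obj C \<Longrightarrow> OnObj F X \<in> Obj D"
    and OnArr_in_Hom: "f \<in> Hom\<^bsub>C\<^esub> X Y \<Longrightarrow> OnArr F f \<in> Hom\<^bsub>D\<^esub> (OnObj F X) (OnObj F Y)"
    and OnArr_Ident: "X \<in> Obj C \<Longrightarrow> OnArr F (Ident C X) = Ident D (OnObj F X)"
    and OnArr_Comp: "\<lbrakk>f \<in> Hom\<^bsub>C\<^esub> X Y; g \<in> Hom\<^bsub>C\<^esub> Y Z\<rbrakk>
      \<Longrightarrow> OnArr F (g \<cdot>\<^bsub>C\<^esub> f) = OnArr F g \<cdot>\<^bsub>D\<^esub> OnArr F f"

definition fully_faithful ::
  "('o, 'a, 'y) cat_scheme \<Rightarrow> ('p, 'b, 'z) cat_scheme \<Rightarrow>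
    ('o, 'a, 'p, 'b, 'w) functor_data_scheme \<Rightarrow> bool"
  where "fully_faithful C D F \<longleftrightarrow> (\<forall>X \<in> Obj C. \<forall>Y \<in> Obj C.
    bij_betw (OnArr F) (Hom\<^bsub>C\<^esub> X Y) (Hom\<^bsub>D\<^esub> (OnObj F X) (OnObj F Y)))"

definition preserves_coequalizers ::
  "('o, 'a, 'y) cat_scheme \<Rightarrow> ('p, 'b, 'z) cat_scheme \<Rightarrow>
    ('o, 'a, 'p, 'b, 'w) functor_data_scheme \<Rightarrow> bool"
  where "preserves_coequalizers C D F \<longleftrightarrow> (\<forall>f g q. is_coequalizer C f g q \<longrightarrow>
    is_coequalizer D (OnArr F f) (OnArr F g) (OnArr F q))"

section \<open>Monoidal categories and monoidal functors\<close>

text \<open>The associativity constraint goes \<open>X \<otimes> (Y \<otimes> Z) \<rightarrow> (X \<otimes> Y) \<otimes> Z\<close>.\<close>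

record ('o, 'a) moncat = "('o, 'a) cat" +
  TensorO :: "'o \<Rightarrow> 'o \<Rightarrow> 'o"  (infixr "\<otimes>\<index>" 80)
  TensorA :: "'a \<Rightarrow> 'a \<Rightarrow> 'a"  (infixr "\<odot>\<index>" 70)
  UnitO :: "'o"  ("\<one>\<index>")
  Assoc :: "'o \<Rightarrow> 'o \<Rightarrow> 'o \<Rightarrow> 'a"
  LUnit :: "'o \<Rightarrow> 'a"
  RUnit :: "'o \<Rightarrow> 'a"

locale monoidal_category = category C
  for C :: "('o, 'a, 'z) moncat_scheme" (structure) +
  assumes UnitO_in_Obj: "\<one> \<in> Obj C"
    and TensorO_in_Obj: "\<lbrakk>X \<in> Obj C; Y \<in> Obj C\<rbrakk> \<Longrightarrow> X \<otimes> Y \<in> Obj C"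
    and TensorA_in_Hom: "\<lbrakk>f \<in> Hom X X'; g \<in> Hom Y Y'\<rbrakk> \<Longrightarrow> f \<odot> g \<in> Hom (X \<otimes> Y) (X' \<otimes> Y')"
    and TensorA_Ident: "\<lbrakk>X \<in> Obj C; Y \<in> Obj C\<rbrakk>
      \<Longrightarrow> Ident C X \<odot> Ident C Y = Ident C (X \<otimes> Y)"
    and TensorA_Comp: "\<lbrakk>f \<in> Hom X X'; f' \<in> Hom X' X''; g \<in> Hom Y Y'; g' \<in> Hom Y' Y''\<rbrakk>
      \<Longrightarrow> (f' \<cdot> f) \<odot> (g' \<cdot> g) = (f' \<odot> g') \<cdot> (f \<odot> g)"
    and Assoc_in_Hom: "\<lbrakk>X \<in> Obj C; Y \<in> Obj C; Z \<in> Obj C\<rbrakk>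
      \<Longrightarrow> Assoc C X Y Z \<in> Hom (X \<otimes> (Y \<otimes> Z)) ((X \<otimes> Y) \<otimes> Z)"
    and Assoc_iso: "\<lbrakk>X \<in> Obj C; Y \<in> Obj C; Z \<in> Obj C\<rbrakk> \<Longrightarrow> is_iso C (Assoc C X Y Z)"
    and Assoc_natural: "\<lbrakk>f \<in> Hom X X'; g \<in> Hom Y Y'; h \<in> Hom Z Z'\<rbrakk>
      \<Longrightarrow> Assoc C X' Y' Z' \<cdot> (f \<odot> (g \<odot> h)) = ((f \<odot> g) \<odot> h) \<cdot> Assoc C X Y Z"
    and LUnit_in_Hom: "X \<in> Obj C \<Longrightarrow> LUnit C X \<in> Hom (\<one> \<otimes> X) X"
    and LUnit_iso: "X \<in> Obj C \<Longrightarrow> is_iso C (LUnit C X)"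
    and LUnit_natural: "f \<in> Hom X X' \<Longrightarrow> LUnit C X' \<cdot> (Ident C \<one> \<odot> f) = f \<cdot> LUnit C X"
    and RUnit_in_Hom: "X \<in> Obj C \<Longrightarrow> RUnit C X \<in> Hom (X \<otimes> \<one>) X"
    and RUnit_iso: "X \<in> Obj C \<Longrightarrow> is_iso C (RUnit C X)"
    and RUnit_natural: "f \<in> Hom X X' \<Longrightarrow> RUnit C X' \<cdot> (f \<odot> Ident C \<one>) = f \<cdot> RUnit C X"
    and pentagon: "\<lbrakk>W \<in> Obj C; X \<in> Obj C; Y \<in> Obj C; Z \<in> Obj C\<rbrakk>
      \<Longrightarrow> Assoc C (W \<otimes> X) Y Z \<cdot> Assoc C W X (Y \<otimes> Z) =
          (Assoc C W X Y \<odot> Ident C Z) \<cdot> Assoc C W (X \<otimes> Y) Z \<cdot> (Ident C W \<odot> Assoc C X Y Z)"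
    and triangle: "\<lbrakk>X \<in> Obj C; Y \<in> Obj C\<rbrakk>
      \<Longrightarrow> (RUnit C X \<odot> Ident C Y) \<cdot> Assoc C X \<one> Y = Ident C X \<odot> LUnit C Y"

locale strict_monoidal_category = monoidal_category +
  assumes strict_assoc: "\<lbrakk>X \<in> Obj C; Y \<in> Obj C; Z \<in> Obj C\<rbrakk>
      \<Longrightarrow> X \<otimes> (Y \<otimes> Z) = (X \<otimes> Y) \<otimes> Z"
    and strict_lunit: "X \<in> Obj C \<Longrightarrow> \<one> \<otimes> X = X"
    and strict_runit: "X \<in> Obj C \<Longrightarrow> X \<otimes> \<one> = X"
    and Assoc_eq_Ident: "\<lbrakk>X \<in> Obj C; Y \<in> Obj C; Z \<in> Obj C\<rbrakk>
      \<Longrightarrow> Assoc C X Y Z = Ident C (X \<otimes> (Y \<otimes> Z))"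
    and LUnit_eq_Ident: "X \<in> Obj C \<Longrightarrow> LUnit C X = Ident C X"
    and RUnit_eq_Ident: "X \<in> Obj C \<Longrightarrow> RUnit C X = Ident C X"

record ('o, 'a, 'p, 'b) monoidal_functor_data = "('o, 'a, 'p, 'b) functor_data" +
  Mult :: "'o \<Rightarrow> 'o \<Rightarrow> 'b"
  Unit :: "'b"

text \<open>\<open>Mult F X Y : F X \<otimes> F Y \<rightarrow> F (X \<otimes> Y)\<close> and \<open>Unit F : \<one> \<rightarrow> F \<one>\<close> are required to be invertible.\<close>

locale strong_monoidal_functor =
  source: monoidal_category C + target: monoidal_category D + category_functor C D F
  for C :: "('o, 'a, 'y) moncat_scheme" and D :: "('p, 'b, 'z) moncat_scheme"
    and F :: "('o, 'a, 'p, 'b, 'w) monoidal_functor_data_scheme" +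
  assumes Mult_in_Hom: "\<lbrakk>X \<in> Obj C; Y \<in> Obj C\<rbrakk>
      \<Longrightarrow> Mult F X Y \<in> Hom\<^bsub>D\<^esub> (OnObj F X \<otimes>\<^bsub>D\<^esub> OnObj F Y) (OnObj F (X \<otimes>\<^bsub>C\<^esub> Y))"
    and Mult_iso: "\<lbrakk>X \<in> Obj C; Y \<in> Obj C\<rbrakk> \<Longrightarrow> is_iso D (Mult F X Y)"
    and Mult_natural: "\<lbrakk>f \<in> Hom\<^bsub>C\<^esub> X X'; g \<in> Hom\<^bsub>C\<^esub> Y Y'\<rbrakk>
      \<Longrightarrow> Mult F X' Y' \<cdot>\<^bsub>D\<^esub> (OnArr F f \<odot>\<^bsub>D\<^esub> OnArr F g) =
          OnArr F (f \<odot>\<^bsub>C\<^esub> g) \<cdot>\<^bsub>D\<^esub> Mult F X Y"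
    and Unit_in_Hom: "Unit F \<in> Hom\<^bsub>D\<^esub> \<one>\<^bsub>D\<^esub> (OnObj F \<one>\<^bsub>C\<^esub>)"
    and Unit_iso: "is_iso D (Unit F)"
    and Mult_Assoc: "\<lbrakk>X \<in> Obj C; Y \<in> Obj C; Z \<in> Obj C\<rbrakk>
      \<Longrightarrow> OnArr F (Assoc C X Y Z) \<cdot>\<^bsub>D\<^esub> Mult F X (Y \<otimes>\<^bsub>C\<^esub> Z) \<cdot>\<^bsub>D\<^esub>
            (Ident D (OnObj F X) \<odot>\<^bsub>D\<^esub> Mult F Y Z) =
          Mult F (X \<otimes>\<^bsub>C\<^esub> Y) Z \<cdot>\<^bsub>D\<^esub> (Mult F X Y \<odot>\<^bsub>D\<^esub> Ident D (OnObj F Z)) \<cdot>\<^bsub>D\<^esub>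
            Assoc D (OnObj F X) (OnObj F Y) (OnObj F Z)"
    and Mult_LUnit: "X \<in> Obj C
      \<Longrightarrow> OnArr F (LUnit C X) \<cdot>\<^bsub>D\<^esub> Mult F \<one>\<^bsub>C\<^esub> X \<cdot>\<^bsub>D\<^esub> (Unit F \<odot>\<^bsub>D\<^esub> Ident D (OnObj F X)) =
          LUnit D (OnObj F X)"
    and Mult_RUnit: "X \<in> Obj C
      \<Longrightarrow> OnArr F (RUnit C X) \<cdot>\<^bsub>D\<^esub> Mult F X \<one>\<^bsub>C\<^esub> \<cdot>\<^bsub>D\<^esub> (Ident D (OnObj F X) \<odot>\<^bsub>D\<^esub> Unit F) =
          RUnit D (OnObj F X)"

definition left_coflat :: "('o, 'a, 'z) moncat_scheme \<Rightarrow> 'o \<Rightarrow> bool"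
  where "left_coflat C X \<longleftrightarrow> preserves_coequalizers C C
    \<lparr>OnObj = (\<lambda>Y. Y \<otimes>\<^bsub>C\<^esub> X), OnArr = (\<lambda>f. f \<odot>\<^bsub>C\<^esub> Ident C X)\<rparr>"

section \<open>Algebras, modules and bimodules\<close>

text \<open>
  Whiskering: \<open>X \<rhd> f\<close> and \<open>f \<lhd> X\<close> are the morphisms written \<open>Xf\<close> and \<open>fX\<close> when an identity
  morphism is denoted by its object.
\<close>

abbreviation (in monoidal_category) whisker_left :: "'o \<Rightarrow> 'a \<Rightarrow> 'a"  (infixr "\<rhd>" 75)
  where "X \<rhd> f \<equiv> Ident C X \<odot> f"

abbreviation (in monoidal_category) whisker_right :: "'a \<Rightarrow> 'o \<Rightarrow> 'a"  (infixl "\<lhd>" 76)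
  where "f \<lhd> X \<equiv> f \<odot> Ident C X"

locale monoidal_algebra = strict_monoidal_category C
  for C :: "('o, 'a, 'z) moncat_scheme" (structure) and A :: 'o and m :: 'a and \<eta> :: 'a +
  assumes A_in_Obj: "A \<in> Obj C"
    and m_in_Hom: "m \<in> Hom (A \<otimes> A) A"
    and \<eta>_in_Hom: "\<eta> \<in> Hom \<one> A"
    and m_assoc: "m \<cdot> (m \<lhd> A) = m \<cdot> (A \<rhd> m)"
    and m_lunit: "m \<cdot> (\<eta> \<lhd> A) = Ident C A"
    and m_runit: "m \<cdot> (A \<rhd> \<eta>) = Ident C A"
begin

definition right_module :: "'o \<Rightarrow> 'a \<Rightarrow> bool"
  where "right_module X \<mu> \<longleftrightarrow> X \<in> Obj C \<and> \<mu> \<in> Hom (X \<otimes> A) X \<and>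
    \<mu> \<cdot> (\<mu> \<lhd> A) = \<mu> \<cdot> (X \<rhd> m) \<and> \<mu> \<cdot> (X \<rhd> \<eta>) = Ident C X"

definition left_module :: "'o \<Rightarrow> 'a \<Rightarrow> bool"
  where "left_module X \<nu> \<longleftrightarrow> X \<in> Obj C \<and> \<nu> \<in> Hom (A \<otimes> X) X \<and>
    \<nu> \<cdot> (A \<rhd> \<nu>) = \<nu> \<cdot> (m \<lhd> X) \<and> \<nu> \<cdot> (\<eta> \<lhd> X) = Ident C X"

definition bimodule :: "'o \<Rightarrow> 'a \<Rightarrow> 'a \<Rightarrow> bool"
  where "bimodule X \<nu> \<mu> \<longleftrightarrow> left_module X \<nu> \<and> right_module X \<mu> \<and>
    \<mu> \<cdot> (\<nu> \<lhd> A) = \<nu> \<cdot> (A \<rhd> \<mu>)"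

text \<open>
  A chosen coequalizer \<open>q : X \<otimes> Y \<rightarrow> X \<otimes>\<^sub>A Y\<close>, for a right module \<open>(X, \<mu>)\<close> and a left module \<open>(Y, \<nu>)\<close>.
\<close>

definition quot :: "'o \<Rightarrow> 'a \<Rightarrow> 'o \<Rightarrow> 'a \<Rightarrow> 'a"
  where "quot X \<mu> Y \<nu> = (SOME q. is_coequalizer C (\<mu> \<lhd> Y) (X \<rhd> \<nu>) q)"

definition robust :: "'o \<Rightarrow> 'a \<Rightarrow> bool"
  where "robust Y \<nu> \<longleftrightarrow> (\<forall>M \<in> Obj C. \<forall>X \<mu>. right_module X \<mu> \<longrightarrow>
    is_coequalizer C (M \<rhd> (\<mu> \<lhd> Y)) (M \<rhd> (X \<rhd> \<nu>)) (M \<rhd> quot X \<mu> Y \<nu>))"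

section \<open>The monoidal category of transfer morphisms\<close>

definition transfer :: "'o \<times> 'a \<Rightarrow> bool"
  where "transfer = (\<lambda>(X, \<psi>). X \<in> Obj C \<and> \<psi> \<in> Hom (X \<otimes> A) (A \<otimes> X) \<and>
    \<psi> \<cdot> (X \<rhd> m) = (m \<lhd> X) \<cdot> (A \<rhd> \<psi>) \<cdot> (\<psi> \<lhd> A) \<and>
    \<psi> \<cdot> (X \<rhd> \<eta>) = \<eta> \<lhd> X)"

definition transfer_mor :: "'o \<times> 'a \<Rightarrow> 'a \<Rightarrow> 'o \<times> 'a \<Rightarrow> bool"
  where "transfer_mor = (\<lambda>(X, \<psi>) f (Y, \<phi>). f \<in> Hom X (A \<otimes> Y) \<and>
    (m \<lhd> Y) \<cdot> (A \<rhd> f) \<cdot> \<psi> = (m \<lhd> Y) \<cdot> (A \<rhd> \<phi>) \<cdot> (f \<lhd> A))"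

definition transfer_tensor :: "'o \<times> 'a \<Rightarrow> 'o \<times> 'a \<Rightarrow> 'o \<times> 'a"
  where "transfer_tensor = (\<lambda>(X, \<psi>) (Y, \<phi>). (X \<otimes> Y, (\<psi> \<lhd> Y) \<cdot> (X \<rhd> \<phi>)))"

definition transfer_ident :: "'o \<times> 'a \<Rightarrow> ('o \<times> 'a) \<times> 'a \<times> ('o \<times> 'a)"
  where "transfer_ident = (\<lambda>(X, \<psi>). ((X, \<psi>), \<eta> \<lhd> X, (X, \<psi>)))"

text \<open>
  An arrow is a triple of its domain, the underlying morphism of \<open>C\<close>, and its codomain.
  The constraints are identities, this monoidal category being strict.
\<close>

definition transfer_cat :: "('o \<times> 'a, ('o \<times> 'a) \<times> 'a \<times> ('o \<times> 'a)) moncat"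
  where "transfer_cat = \<lparr>
    Obj = {P. transfer P},
    Arr = {(P, f, Q). transfer P \<and> transfer Q \<and> transfer_mor P f Q},
    Dom = (\<lambda>(P, f, Q). P),
    Cod = (\<lambda>(P, f, Q). Q),
    Ident = transfer_ident,
    Comp = (\<lambda>(Q', g, (Z, \<zeta>)) (P, f, Q). (P, (m \<lhd> Z) \<cdot> (A \<rhd> g) \<cdot> f, (Z, \<zeta>))),
    TensorO = transfer_tensor,
    TensorA = (\<lambda>(P, f, (X', \<psi>')) (Q, g, (Y', \<phi>')).
      (transfer_tensor P Q,
       (m \<lhd> (X' \<otimes> Y')) \<cdot> (A \<rhd> (\<psi>' \<lhd> Y')) \<cdot> (f \<odot> g),
       transfer_tensor (X', \<psi>') (Y', \<phi>'))),
    UnitO = (\<one>, Ident C A),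
    Assoc = (\<lambda>P Q R. transfer_ident (transfer_tensor P (transfer_tensor Q R))),
    LUnit = transfer_ident,
    RUnit = transfer_ident\<rparr>"

definition coflat_transfer_cat :: "('o \<times> 'a, ('o \<times> 'a) \<times> 'a \<times> ('o \<times> 'a)) moncat"
  where "coflat_transfer_cat = full_subcategory transfer_cat (\<lambda>(X, \<psi>). left_coflat C X)"

section \<open>The monoidal category of coflat robust bimodules\<close>

text \<open>Bimodules are triples \<open>(X, \<nu>, \<mu>)\<close>: object, left action, right action.\<close>

definition bimodule_mor :: "'o \<times> 'a \<times> 'a \<Rightarrow> 'a \<Rightarrow> 'o \<times> 'a \<times> 'a \<Rightarrow> bool"
  where "bimodule_mor = (\<lambda>(X, \<nu>, \<mu>) f (Y, \<nu>', \<mu>'). f \<in> Hom X Y \<and>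
    f \<cdot> \<nu> = \<nu>' \<cdot> (A \<rhd> f) \<and> f \<cdot> \<mu> = \<mu>' \<cdot> (f \<lhd> A))"

definition bimodule_quot :: "'o \<times> 'a \<times> 'a \<Rightarrow> 'o \<times> 'a \<times> 'a \<Rightarrow> 'a"
  where "bimodule_quot = (\<lambda>(X, \<nu>, \<mu>) (Y, \<nu>', \<mu>'). quot X \<mu> Y \<nu>')"

text \<open>
  The actions on \<open>X \<otimes>\<^sub>A Y\<close> are induced by the left action of \<open>X\<close> and the right action of \<open>Y\<close>.
\<close>

definition bimodule_tensor :: "'o \<times> 'a \<times> 'a \<Rightarrow> 'o \<times> 'a \<times> 'a \<Rightarrow> 'o \<times> 'a \<times> 'a"
  where "bimodule_tensor = (\<lambda>(X, \<nu>, \<mu>) (Y, \<nu>', \<mu>').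
    let q = quot X \<mu> Y \<nu>' in
      (Cod C q, factor C (A \<rhd> q) (q \<cdot> (\<nu> \<lhd> Y)), factor C (q \<lhd> A) (q \<cdot> (X \<rhd> \<mu>'))))"

text \<open>
  \<open>Assoc\<close> is the \<open>\<alpha>\<close> with \<open>\<alpha> \<cdot> q \<cdot> (X \<rhd> q) = q \<cdot> (q \<lhd> Z)\<close>. On all bimodules only the underlying
  category is meaningful: the tensor product needs coflatness and robustness to be well defined.
\<close>

definition bimodule_cat ::
  "('o \<times> 'a \<times> 'a, ('o \<times> 'a \<times> 'a) \<times> 'a \<times> ('o \<times> 'a \<times> 'a)) moncat"
  where "bimodule_cat = \<lparr>
    Obj = {(X, \<nu>, \<mu>). bimodule X \<nu> \<mu>},
    Arr = {((X, \<nu>, \<mu>), f, (Y, \<nu>', \<mu>')).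
      bimodule X \<nu> \<mu> \<and> bimodule Y \<nu>' \<mu>' \<and> bimodule_mor (X, \<nu>, \<mu>) f (Y, \<nu>', \<mu>')},
    Dom = (\<lambda>(P, f, Q). P),
    Cod = (\<lambda>(P, f, Q). Q),
    Ident = (\<lambda>(X, \<nu>, \<mu>). ((X, \<nu>, \<mu>), Ident C X, (X, \<nu>, \<mu>))),
    Comp = (\<lambda>(Q', g, R) (P, f, Q). (P, g \<cdot> f, R)),
    TensorO = bimodule_tensor,
    TensorA = (\<lambda>(P, f, P') (Q, g, Q').
      (bimodule_tensor P Q,
       factor C (bimodule_quot P Q) (bimodule_quot P' Q' \<cdot> (f \<odot> g)),
       bimodule_tensor P' Q')),
    UnitO = (A, m, m),
    Assoc = (\<lambda>P Q R.
      (bimodule_tensor P (bimodule_tensor Q R),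
       factor C (bimodule_quot P (bimodule_tensor Q R) \<cdot> (fst P \<rhd> bimodule_quot Q R))
         (bimodule_quot (bimodule_tensor P Q) R \<cdot> (bimodule_quot P Q \<lhd> fst R)),
       bimodule_tensor (bimodule_tensor P Q) R)),
    LUnit = (\<lambda>(X, \<nu>, \<mu>).
      (bimodule_tensor (A, m, m) (X, \<nu>, \<mu>), factor C (quot A m X \<nu>) \<nu>, (X, \<nu>, \<mu>))),
    RUnit = (\<lambda>(X, \<nu>, \<mu>).
      (bimodule_tensor (X, \<nu>, \<mu>) (A, m, m), factor C (quot X \<mu> A m) \<mu>, (X, \<nu>, \<mu>)))\<rparr>"

definition coflat_robust_bimodule_cat ::
  "('o \<times> 'a \<times> 'a, ('o \<times> 'a \<times> 'a) \<times> 'a \<times> ('o \<times> 'a \<times> 'a)) moncat"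
  where "coflat_robust_bimodule_cat =
    full_subcategory bimodule_cat (\<lambda>(X, \<nu>, \<mu>). left_coflat C X \<and> robust X \<nu>)"

end

end

theory Submission
  imports Defs
begin

text \<open>
  The functor sends \<open>(X, \<psi>)\<close> to the free left module \<open>A \<otimes> X\<close>, with right action induced by \<open>\<psi>\<close>, and
  \<open>f : X \<rightarrow> A \<otimes> Y\<close> to its left \<open>A\<close>-linear extension \<open>A \<otimes> X \<rightarrow> A \<otimes> Y\<close>; the compatibility of \<open>f\<close>
  with \<open>\<psi>\<close> is right linearity of the extension, whence full faithfulness. As \<open>A \<otimes> Y\<close> is free, the right
  action of \<open>A \<otimes> X\<close> tensored with \<open>Y\<close> is a split coequalizer presenting \<open>(A \<otimes> X) \<otimes>\<^sub>A (A \<otimes> Y)\<close> as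
  \<open>A \<otimes> X \<otimes> Y\<close>, which gives robustness of \<open>A \<otimes> Y\<close> and the monoidal structure of the functor.

  That \<open>\<otimes>\<^sub>A\<close> is a monoidal structure on coflat robust bimodules rests on interchange of coequalizers:
  \<open>(Z \<otimes>\<^sub>A X) \<otimes>\<^sub>A Y\<close> also satisfies the universal property of \<open>Z \<otimes>\<^sub>A (X \<otimes>\<^sub>A Y)\<close>, and this comparison is
  preserved by tensoring on the left. Every coherence law is then checked after composing with the
  quotient maps, which stay epic when tensored on both sides.
\<close>

section \<open>Coequalizers and strict monoidal categories\<close>

text \<open>The hypotheses are one-sided, and this shapes the proof. Coflatness of an object
  controls tensoring with it on the right only; tensoring on the left is exact only on the
  coequalizers that robustness provides. So each whiskered quotient map has to be justified from its
  own side: \<open>q \<lhd> N\<close> by coflatness of \<open>N\<close>, and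
  \<open>M \<rhd> q\<close> by robustness of the second factor of the quotient. In particular the
  right action on a tensor product over \<open>A\<close> exists because \<open>A\<close> is coflat,
  the left action because the second factor is robust.

  A chosen quotient is known only by its universal property. The constraints are therefore compared
  with explicit coequalizers of the same pair, such as an action map or an iterated quotient, which
  yields their invertibility at once.

  The source category composes as in the Kleisli category of the monad \<open>A \<otimes> -\<close>,
  so identities and composites of transfer morphisms are obtained from those of bimodule maps. The
  tensor product of transfer morphisms needs its own computation.\<close>

lemma in_Hom_iff: "f \<in> Hom\<^bsub>C\<^esub> X Y \<longleftrightarrow> f \<in> Arr C \<and> Dom C f = X \<and> Cod C f = Y"
  by (simp add: Hom_def)

context category
begin

lemma Dom_Obj [simp]: "f \<in> Arr C \<Longrightarrow> Dom C f \<in> Obj C"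
  and Cod_Obj [simp]: "f \<in> Arr C \<Longrightarrow> Cod C f \<in> Obj C"
  by (auto intro: Dom_in_Obj Cod_in_Obj)

lemma Ident_typing [simp]:
  assumes "X \<in> Obj C"
  shows "Ident C X \<in> Arr C" "Dom C (Ident C X) = X" "Cod C (Ident C X) = X"
  using Ident_in_Hom[OF assms] by (auto simp: in_Hom_iff)

lemma Comp_typing [simp]:
  assumes "f \<in> Arr C" "g \<in> Arr C" "Dom C g = Cod C f"
  shows "g \<cdot> f \<in> Arr C" "Dom C (g \<cdot> f) = Dom C f" "Cod C (g \<cdot> f) = Cod C g"
  using Comp_in_Hom[of f "Dom C f" "Cod C f" g "Cod C g"] assms by (auto simp: in_Hom_iff)

lemma Comp_Ident_Dom [simp]: "f \<in> Arr C \<Longrightarrow> Dom C f = X \<Longrightarrow> f \<cdot> Ident C X = f"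
  by (rule Comp_Ident) (auto simp: in_Hom_iff)

lemma Ident_Comp_Cod [simp]: "f \<in> Arr C \<Longrightarrow> Cod C f = X \<Longrightarrow> Ident C X \<cdot> f = f"
  by (rule Ident_Comp) (auto simp: in_Hom_iff)

lemma Comp_assoc_right [simp]:
  "\<lbrakk>f \<in> Arr C; g \<in> Arr C; h \<in> Arr C; Dom C g = Cod C f; Dom C h = Cod C g\<rbrakk>
    \<Longrightarrow> (h \<cdot> g) \<cdot> f = h \<cdot> (g \<cdot> f)"
  by (rule Comp_assoc) (auto simp: in_Hom_iff)

text \<open>Composites are normalized to nest to the right, so the left side of
  \<open>g \<cdot> f = h\<close> is no subterm of \<open>g \<cdot> (f \<cdot> k)\<close>. This is
  the same equation followed by a tail \<open>k\<close>; \<open>Comp_tail3\<close> does it for a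
  composite of three.\<close>

lemma Comp_tail:
  "\<lbrakk>g \<cdot> f = h; f \<in> Arr C; g \<in> Arr C; Dom C g = Cod C f; k \<in> Arr C; Cod C k = Dom C f\<rbrakk>
    \<Longrightarrow> g \<cdot> (f \<cdot> k) = h \<cdot> k"
  by (metis Comp_assoc_right)

lemma Comp_tail3:
  "\<lbrakk>h \<cdot> g \<cdot> f = e; f \<in> Arr C; g \<in> Arr C; h \<in> Arr C; Dom C g = Cod C f; Dom C h = Cod C g;
    k \<in> Arr C; Cod C k = Dom C f\<rbrakk> \<Longrightarrow> h \<cdot> g \<cdot> f \<cdot> k = e \<cdot> k"
  by (metis Comp_assoc_right Comp_typing(1-3))

section \<open>Epimorphisms, coequalizers and splittings\<close>

definition epi :: "'a \<Rightarrow> bool"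
  where "epi e \<longleftrightarrow> e \<in> Arr C \<and> (\<forall>h \<in> Arr C. \<forall>k \<in> Arr C.
    Dom C h = Cod C e \<longrightarrow> Dom C k = Cod C e \<longrightarrow> h \<cdot> e = k \<cdot> e \<longrightarrow> h = k)"

lemma epiD:
  "\<lbrakk>epi e; h \<cdot> e = k \<cdot> e; h \<in> Arr C; k \<in> Arr C; Dom C h = Cod C e; Dom C k = Cod C e\<rbrakk>
    \<Longrightarrow> h = k"
  by (auto simp: epi_def)

lemma epi_Arr: "epi e \<Longrightarrow> e \<in> Arr C"
  by (simp add: epi_def)

lemma epi_Comp:
  assumes "epi e" "epi d" "Dom C d = Cod C e"
  shows "epi (d \<cdot> e)"
  unfolding epi_def
proof (intro conjI ballI impI)
  show "d \<cdot> e \<in> Arr C"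
    using assms by (simp add: epi_Arr)
  fix h k assume *: "h \<in> Arr C" "k \<in> Arr C" "Dom C h = Cod C (d \<cdot> e)" "Dom C k = Cod C (d \<cdot> e)"
    "h \<cdot> d \<cdot> e = k \<cdot> d \<cdot> e"
  then have "h \<cdot> d = k \<cdot> d"
    using assms by - (rule epiD[OF assms(1)], simp_all add: epi_Arr)
  then show "h = k"
    using assms * by - (rule epiD[OF assms(2)], simp_all add: epi_Arr)
qed

text \<open>Epicness alone makes the description in \<open>factor\<close> unique. The associator
  needs this generality: it is defined by factoring through a composite of two quotient maps, not
  through a single coequalizer.\<close>

lemma factor_eqI:
  "\<lbrakk>epi e; k \<in> Arr C; Dom C k = Cod C e; k \<cdot> e = h\<rbrakk> \<Longrightarrow> factor C e h = k"
  unfolding factor_def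
  by (rule the_equality, auto simp: in_Hom_iff epi_Arr) (rule epiD[of e], auto)

lemma coequalizer_typing:
  assumes "is_coequalizer C f g q"
  shows "f \<in> Arr C" "g \<in> Arr C" "Dom C g = Dom C f" "Cod C g = Cod C f"
    "q \<in> Arr C" "Dom C q = Cod C f" "q \<cdot> g = q \<cdot> f"
  using assms by (auto simp: is_coequalizer_def)

lemma coequalizer_ex1:
  assumes "is_coequalizer C f g q" "h \<in> Arr C" "Dom C h = Cod C f" "h \<cdot> f = h \<cdot> g"
  shows "\<exists>!k. k \<in> Hom (Cod C q) (Cod C h) \<and> k \<cdot> q = h"
  using assms unfolding is_coequalizer_def by blast

lemma coequalizer_epi:
  assumes "is_coequalizer C f g q"
  shows "epi q"
proof -
  note t [simp] = coequalizer_typing[OF assms]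
  have "h = k" if h: "h \<in> Arr C" "k \<in> Arr C" "Dom C h = Cod C q" "Dom C k = Cod C q"
    "h \<cdot> q = k \<cdot> q" for h k
  proof -
    \<comment> \<open>\<open>epi\<close> compares arrows with unrelated codomains, whereas
      uniqueness for a coequalizer is stated with a fixed one; the codomains are read off from the
      common composite.\<close>
    have "Cod C h = Cod C (h \<cdot> q)"
      using h(1-4) by simp
    also have "\<dots> = Cod C k"
      using h(1-4) unfolding h(5) by simp
    finally have "Cod C h = Cod C k" .
    moreover have "\<exists>!l. l \<in> Hom (Cod C q) (Cod C (k \<cdot> q)) \<and> l \<cdot> q = k \<cdot> q"
      using h(2,4) by (intro coequalizer_ex1[OF assms]) simp_all
    ultimately show ?thesis
      using h by (auto simp: in_Hom_iff)
  qed
  then show ?thesis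
    unfolding epi_def using t(5) by blast
qed

lemma coequalizer_ex:
  assumes "is_coequalizer C f g q" "h \<in> Arr C" "Dom C h = Cod C f" "h \<cdot> f = h \<cdot> g"
  shows "\<exists>k \<in> Arr C. Dom C k = Cod C q \<and> Cod C k = Cod C h \<and> k \<cdot> q = h"
  using coequalizer_ex1[OF assms] by (auto simp: in_Hom_iff)

lemma coequalizer_factor:
  assumes "is_coequalizer C f g q" "h \<in> Arr C" "Dom C h = Cod C f" "h \<cdot> f = h \<cdot> g"
  shows "factor C q h \<in> Arr C" "Dom C (factor C q h) = Cod C q"
    "Cod C (factor C q h) = Cod C h" "factor C q h \<cdot> q = h"
  using coequalizer_ex[OF assms] factor_eqI[OF coequalizer_epi[OF assms(1)]] by auto

text \<open>Uniqueness of factorizations is traded for \<open>epi q\<close>, and the codomain of a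
  factorization is forced by the composite, so a diagram chase only has to produce some factoring
  arrow.\<close>

lemma coequalizerI:
  assumes "f \<in> Arr C" "g \<in> Arr C" "Dom C g = Dom C f" "Cod C g = Cod C f"
    and "Dom C q = Cod C f" "q \<cdot> f = q \<cdot> g" "epi q"
    and "\<And>h. \<lbrakk>h \<in> Arr C; Dom C h = Cod C f; h \<cdot> f = h \<cdot> g\<rbrakk>
      \<Longrightarrow> \<exists>k \<in> Arr C. Dom C k = Cod C q \<and> k \<cdot> q = h"
  shows "is_coequalizer C f g q"
  unfolding is_coequalizer_def
proof (intro conjI ballI impI)
  fix h assume h: "h \<in> Arr C" "Dom C h = Cod C f \<and> h \<cdot> f = h \<cdot> g"
  then obtain k where k: "k \<in> Arr C" "Dom C k = Cod C q" "k \<cdot> q = h"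
    using assms(8) by blast
  then have "Cod C h = Cod C k"
    using epi_Arr[OF assms(7)] by (simp flip: k(3))
  moreover have "l = k" if "l \<in> Hom (Cod C q) (Cod C h) \<and> l \<cdot> q = h" for l
    using that k unfolding in_Hom_iff by (intro epiD[OF assms(7), of l k]) simp_all
  ultimately show "\<exists>!k. k \<in> Hom (Cod C q) (Cod C h) \<and> k \<cdot> q = h"
    using k by (intro ex1I[of _ k]) (simp_all add: in_Hom_iff)
qed (simp_all add: assms(1-6) epi_Arr[OF assms(7)])

lemma split_epi:
  assumes "e \<in> Arr C" "s \<in> Arr C" "Dom C e = Cod C s" "e \<cdot> s = Ident C (Cod C e)"
  shows "epi e"
  unfolding epi_def
proof (intro conjI ballI impI)
  fix h k assume *: "h \<in> Arr C" "k \<in> Arr C" "Dom C h = Cod C e" "Dom C k = Cod C e" "h \<cdot> e = k \<cdot> e"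
  have [simp]: "Dom C s = Cod C e"
    using Comp_typing(2)[OF assms(2,1,3)] assms(1) unfolding assms(4) by simp
  have "h \<cdot> e \<cdot> s = k \<cdot> e \<cdot> s"
    using *(1-4) assms(1-3) Comp_tail[OF *(5)] by simp
  then show "h = k"
    using *(1-4) assms(4) by simp
qed (rule assms)

text \<open>Evaluating \<open>h \<cdot> f = h \<cdot> g\<close> on \<open>t\<close> gives
  \<open>h = h \<cdot> s \<cdot> e\<close>. The disjunction covers both orientations: for a left
  action \<open>t\<close> splits the first arrow of the pair, for a right action the second.\<close>

lemma split_coequalizer:
  assumes "f \<in> Arr C" "g \<in> Arr C" "Dom C g = Dom C f" "Cod C g = Cod C f"
    and "e \<in> Arr C" "Dom C e = Cod C f" "e \<cdot> f = e \<cdot> g"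
    and "s \<in> Arr C" "Dom C s = Cod C e" "Cod C s = Cod C f" "e \<cdot> s = Ident C (Cod C e)"
    and "t \<in> Arr C" "Dom C t = Cod C f" "Cod C t = Dom C f"
    and st: "f \<cdot> t = s \<cdot> e \<and> g \<cdot> t = Ident C (Cod C f) \<or> g \<cdot> t = s \<cdot> e \<and> f \<cdot> t = Ident C (Cod C f)"
  shows "is_coequalizer C f g e"
proof (rule coequalizerI)
  show "epi e"
    using assms by (intro split_epi[of e s]) auto
  fix h assume h: "h \<in> Arr C" "Dom C h = Cod C f" "h \<cdot> f = h \<cdot> g"
  have "h \<cdot> f \<cdot> t = h \<cdot> g \<cdot> t"
    using Comp_tail[OF h(3)] assms h by simp
  then have "(h \<cdot> s) \<cdot> e = h"
    using st assms(1-14) h by auto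
  then show "\<exists>k \<in> Arr C. Dom C k = Cod C e \<and> k \<cdot> e = h"
    using assms h by (intro bexI[of _ "h \<cdot> s"]) auto
qed (use assms in auto)

lemma isoI:
  "\<lbrakk>f \<in> Arr C; g \<in> Arr C; Dom C g = Cod C f; Cod C g = Dom C f;
    g \<cdot> f = Ident C (Dom C f); f \<cdot> g = Ident C (Cod C f)\<rbrakk> \<Longrightarrow> is_iso C f"
  unfolding is_iso_def by (auto simp: in_Hom_iff)

lemma isoE:
  assumes "is_iso C f"
  obtains g where "f \<in> Arr C" "g \<in> Arr C" "Dom C g = Cod C f" "Cod C g = Dom C f"
    "g \<cdot> f = Ident C (Dom C f)" "f \<cdot> g = Ident C (Cod C f)"
  using assms unfolding is_iso_def by (auto simp: in_Hom_iff)

lemma Ident_iso: "X \<in> Obj C \<Longrightarrow> is_iso C (Ident C X)"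
  by (rule isoI[of _ "Ident C X"]) auto

text \<open>The factorizations in both directions cancel against an epi. The associator, the unit
  constraints and the multiplication of the functor are all inverted in this way, by comparing a
  chosen quotient with an explicit coequalizer of the same pair.\<close>

lemma coequalizer_factor_iso:
  assumes "is_coequalizer C f g q" "is_coequalizer C f g e"
  shows "is_iso C (factor C q e)"
proof -
  note t [simp] = coequalizer_typing[OF assms(1)] coequalizer_typing[OF assms(2)]
  note F = coequalizer_factor[OF assms(1) t(12) t(13) t(14)[symmetric]]
  note G = coequalizer_factor[OF assms(2) t(5) t(6) t(7)[symmetric]]
  note [simp] = F(1-3) G(1-3)
  have "factor C e q \<cdot> factor C q e = Ident C (Dom C (factor C q e))"
    by (rule epiD[OF coequalizer_epi[OF assms(1)]]) (simp_all add: F(4) G(4))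
  moreover have "factor C q e \<cdot> factor C e q = Ident C (Cod C (factor C q e))"
    by (rule epiD[OF coequalizer_epi[OF assms(2)]]) (simp_all add: F(4) G(4))
  ultimately show ?thesis
    by (intro isoI[of _ "factor C e q"]) simp_all
qed

lemma iso_epi: "is_iso C i \<Longrightarrow> epi i"
  by (erule isoE, rule split_epi) auto

lemma coequalizer_iso_Comp:
  assumes "is_coequalizer C f g q" "is_iso C i" "Dom C i = Cod C q"
  shows "is_coequalizer C f g (i \<cdot> q)"
proof -
  note t [simp] = coequalizer_typing[OF assms(1)]
  obtain j where j [simp]: "i \<in> Arr C" "j \<in> Arr C" "Dom C j = Cod C i" "Cod C j = Dom C i"
    "j \<cdot> i = Ident C (Dom C i)" "i \<cdot> j = Ident C (Cod C i)"
    using isoE[OF assms(2)] by metis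
  show ?thesis
  proof (rule coequalizerI)
    show "epi (i \<cdot> q)"
      using assms by (intro epi_Comp coequalizer_epi iso_epi) auto
    fix h assume h: "h \<in> Arr C" "Dom C h = Cod C f" "h \<cdot> f = h \<cdot> g"
    obtain k where "k \<in> Arr C" "Dom C k = Cod C q" "k \<cdot> q = h"
      using coequalizer_ex[OF assms(1) h] by auto
    then show "\<exists>k \<in> Arr C. Dom C k = Cod C (i \<cdot> q) \<and> k \<cdot> i \<cdot> q = h"
      using assms(3) by (intro bexI[of _ "k \<cdot> j"]) (auto simp: Comp_tail[OF j(5)])
  qed (use assms in auto)
qed

end

section \<open>Whiskering and interchange in the strict category\<close>

context strict_monoidal_category
begin

lemma UnitO_Obj [simp]: "\<one> \<in> Obj C"
  by (rule UnitO_in_Obj)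

lemma TensorO_Obj [simp]: "X \<in> Obj C \<Longrightarrow> Y \<in> Obj C \<Longrightarrow> X \<otimes> Y \<in> Obj C"
  by (rule TensorO_in_Obj)

lemma TensorO_assoc [simp]:
  "\<lbrakk>X \<in> Obj C; Y \<in> Obj C; Z \<in> Obj C\<rbrakk> \<Longrightarrow> (X \<otimes> Y) \<otimes> Z = X \<otimes> (Y \<otimes> Z)"
  by (rule strict_assoc[symmetric])

lemmas TensorO_unit [simp] = strict_lunit strict_runit

lemma TensorA_typing [simp]:
  assumes "f \<in> Arr C" "g \<in> Arr C"
  shows "f \<odot> g \<in> Arr C" "Dom C (f \<odot> g) = Dom C f \<otimes> Dom C g"
    "Cod C (f \<odot> g) = Cod C f \<otimes> Cod C g"
  using TensorA_in_Hom[of f "Dom C f" "Cod C f" g "Dom C g" "Cod C g"] assms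
  by (auto simp: in_Hom_iff)

text \<open>Strictness is assumed for objects and constraints only. For arrows it is naturality of
  an associator that is an identity.\<close>

lemma TensorA_assoc [simp]:
  assumes "f \<in> Arr C" "g \<in> Arr C" "h \<in> Arr C"
  shows "(f \<odot> g) \<odot> h = f \<odot> (g \<odot> h)"
  using Assoc_natural[of f "Dom C f" "Cod C f" g "Dom C g" "Cod C g" h "Dom C h" "Cod C h"] assms
  by (simp add: in_Hom_iff Assoc_eq_Ident)

lemma TensorA_unit [simp]:
  assumes "f \<in> Arr C"
  shows "\<one> \<rhd> f = f" "f \<lhd> \<one> = f"
  using LUnit_natural[of f "Dom C f" "Cod C f"] RUnit_natural[of f "Dom C f" "Cod C f"] assms
  by (simp_all add: in_Hom_iff LUnit_eq_Ident RUnit_eq_Ident)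

lemma Ident_TensorA_Ident [simp]:
  "\<lbrakk>X \<in> Obj C; Y \<in> Obj C\<rbrakk> \<Longrightarrow> X \<rhd> Ident C Y = Ident C (X \<otimes> Y)"
  by (rule TensorA_Ident)

lemma whisker_left_twice [simp]:
  "\<lbrakk>X \<in> Obj C; Y \<in> Obj C; f \<in> Arr C\<rbrakk> \<Longrightarrow> X \<rhd> Y \<rhd> f = (X \<otimes> Y) \<rhd> f"
  by (metis TensorA_assoc TensorA_Ident Ident_typing(1))

lemma interchange:
  assumes "f \<in> Arr C" "f' \<in> Arr C" "Dom C f' = Cod C f"
    and "g \<in> Arr C" "g' \<in> Arr C" "Dom C g' = Cod C g"
  shows "(f' \<odot> g') \<cdot> (f \<odot> g) = (f' \<cdot> f) \<odot> (g' \<cdot> g)"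
  using TensorA_Comp[of f "Dom C f" "Cod C f" f' "Cod C f'" g "Dom C g" "Cod C g" g' "Cod C g'"]
    assms by (simp add: in_Hom_iff)

lemma whisker_left_Comp [simp]:
  "\<lbrakk>X \<in> Obj C; f \<in> Arr C; g \<in> Arr C; Dom C g = Cod C f\<rbrakk> \<Longrightarrow> X \<rhd> (g \<cdot> f) = (X \<rhd> g) \<cdot> (X \<rhd> f)"
  by (simp add: interchange)

lemma whisker_right_Comp [simp]:
  "\<lbrakk>X \<in> Obj C; f \<in> Arr C; g \<in> Arr C; Dom C g = Cod C f\<rbrakk> \<Longrightarrow> (g \<cdot> f) \<lhd> X = (g \<lhd> X) \<cdot> (f \<lhd> X)"
  by (simp add: interchange)

lemma TensorA_split:
  "\<lbrakk>f \<in> Arr C; g \<in> Arr C\<rbrakk> \<Longrightarrow> f \<odot> g = (f \<lhd> Cod C g) \<cdot> (Dom C f \<rhd> g)"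
  by (simp add: interchange)

text \<open>Both sides equal \<open>f \<odot> g\<close>. The objects are free variables tied to
  domains and codomains by equations, so that the law also matches objects whose brackets have been
  normalized.\<close>

lemma whisker_swap:
  "\<lbrakk>f \<in> Arr C; g \<in> Arr C; Dom C f = X; Cod C f = X'; Dom C g = Y; Cod C g = Y'\<rbrakk>
    \<Longrightarrow> (X' \<rhd> g) \<cdot> (f \<lhd> Y) = (f \<lhd> Y') \<cdot> (X \<rhd> g)"
  by (auto simp: interchange)

lemmas whisker_exchange = whisker_swap[OF _ _ refl refl refl refl]

lemma is_iso_whisker:
  assumes "is_iso C i" "X \<in> Obj C"
  shows "is_iso C (X \<rhd> i)" "is_iso C (i \<lhd> X)"
proof -
  obtain j where "i \<in> Arr C" "j \<in> Arr C" "Dom C j = Cod C i" "Cod C j = Dom C i"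
    "j \<cdot> i = Ident C (Dom C i)" "i \<cdot> j = Ident C (Cod C i)"
    using isoE[OF assms(1)] by metis
  then show "is_iso C (X \<rhd> i)" "is_iso C (i \<lhd> X)"
    using assms(2)
    by (auto intro!: isoI[of "X \<rhd> i" "X \<rhd> j"] isoI[of "i \<lhd> X" "j \<lhd> X"] simp: interchange)
qed

lemma left_coflatD:
  "\<lbrakk>left_coflat C N; is_coequalizer C f g q\<rbrakk> \<Longrightarrow> is_coequalizer C (f \<lhd> N) (g \<lhd> N) (q \<lhd> N)"
  unfolding left_coflat_def preserves_coequalizers_def by auto

lemma left_coflat_unit: "left_coflat C \<one>"
  unfolding left_coflat_def preserves_coequalizers_def by (auto simp: coequalizer_typing)

lemma left_coflat_TensorO:
  assumes "left_coflat C X" "left_coflat C Y" "X \<in> Obj C" "Y \<in> Obj C"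
  shows "left_coflat C (X \<otimes> Y)"
  unfolding left_coflat_def preserves_coequalizers_def
proof (intro allI impI)
  fix f g q assume q: "is_coequalizer C f g q"
  have "is_coequalizer C ((f \<lhd> X) \<lhd> Y) ((g \<lhd> X) \<lhd> Y) ((q \<lhd> X) \<lhd> Y)"
    using assms q by (intro left_coflatD)
  then show "is_coequalizer C
     (OnArr \<lparr>OnObj = \<lambda>Z. Z \<otimes> X \<otimes> Y, OnArr = \<lambda>f. f \<lhd> X \<otimes> Y\<rparr> f)
     (OnArr \<lparr>OnObj = \<lambda>Z. Z \<otimes> X \<otimes> Y, OnArr = \<lambda>f. f \<lhd> X \<otimes> Y\<rparr> g)
     (OnArr \<lparr>OnObj = \<lambda>Z. Z \<otimes> X \<otimes> Y, OnArr = \<lambda>f. f \<lhd> X \<otimes> Y\<rparr> q)"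
    using assms coequalizer_typing[OF q] by simp
qed

end

section \<open>Modules and their tensor product\<close>

context category
begin

lemma epi_cancel_right:
  assumes "epi (p \<cdot> e)" "p \<in> Arr C" "e \<in> Arr C" "Dom C p = Cod C e"
  shows "epi p"
  unfolding epi_def
proof (intro conjI ballI impI)
  fix h k assume *: "h \<in> Arr C" "k \<in> Arr C" "Dom C h = Cod C p" "Dom C k = Cod C p" "h \<cdot> p = k \<cdot> p"
  have "h \<cdot> p \<cdot> e = k \<cdot> p \<cdot> e"
    using Comp_tail[OF *(5)] *(1-4) assms(2-4) by simp
  then show "h = k"
    by (rule epiD[OF assms(1)]) (use * assms in simp_all)
qed (rule assms)

end

context monoidal_algebra
begin

lemma algebra_typing [simp]:
  "A \<in> Obj C" "m \<in> Arr C" "Dom C m = A \<otimes> A" "Cod C m = A"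
  "\<eta> \<in> Arr C" "Dom C \<eta> = \<one>" "Cod C \<eta> = A"
  using A_in_Obj m_in_Hom \<eta>_in_Hom by (simp_all add: in_Hom_iff)

lemma right_module_typing:
  assumes "right_module X \<mu>"
  shows "X \<in> Obj C" "\<mu> \<in> Arr C" "Dom C \<mu> = X \<otimes> A" "Cod C \<mu> = X"
  using assms by (simp_all add: right_module_def in_Hom_iff)

lemma right_module_eqs:
  assumes "right_module X \<mu>"
  shows "\<mu> \<cdot> (\<mu> \<lhd> A) = \<mu> \<cdot> (X \<rhd> m)" "\<mu> \<cdot> (X \<rhd> \<eta>) = Ident C X"
  using assms by (simp_all add: right_module_def)

lemma left_module_typing:
  assumes "left_module X \<nu>"
  shows "X \<in> Obj C" "\<nu> \<in> Arr C" "Dom C \<nu> = A \<otimes> X" "Cod C \<nu> = X"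
  using assms by (simp_all add: left_module_def in_Hom_iff)

lemma left_module_eqs:
  assumes "left_module X \<nu>"
  shows "\<nu> \<cdot> (A \<rhd> \<nu>) = \<nu> \<cdot> (m \<lhd> X)" "\<nu> \<cdot> (\<eta> \<lhd> X) = Ident C X"
  using assms by (simp_all add: left_module_def)

lemma bimodule_modules:
  assumes "bimodule X \<nu> \<mu>"
  shows "left_module X \<nu>" "right_module X \<mu>"
  using assms by (simp_all add: bimodule_def)

lemma bimodule_typing:
  assumes "bimodule X \<nu> \<mu>"
  shows "X \<in> Obj C" "\<nu> \<in> Arr C" "Dom C \<nu> = A \<otimes> X" "Cod C \<nu> = X"
    "\<mu> \<in> Arr C" "Dom C \<mu> = X \<otimes> A" "Cod C \<mu> = X"
  using left_module_typing[OF bimodule_modules(1)] right_module_typing[OF bimodule_modules(2)] assms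
  by auto

lemma bimodule_compat: "bimodule X \<nu> \<mu> \<Longrightarrow> \<mu> \<cdot> (\<nu> \<lhd> A) = \<nu> \<cdot> (A \<rhd> \<mu>)"
  by (simp add: bimodule_def)

text \<open>This turns left whiskering into a change of module: a statement about all right modules
  contains its own version tensored with \<open>M\<close> on the left. Both robustness proofs rest
  on it.\<close>

lemma right_module_whisker:
  assumes "right_module X \<mu>" "M \<in> Obj C"
  shows "right_module (M \<otimes> X) (M \<rhd> \<mu>)"
proof -
  note [simp] = right_module_typing[OF assms(1)] assms(2)
  note E = right_module_eqs[OF assms(1), THEN arg_cong, of "\<lambda>f. M \<rhd> f"]
  show ?thesis
    unfolding right_module_def using E by (simp add: in_Hom_iff)
qed

lemma left_module_whisker:
  assumes "left_module X \<nu>" "M \<in> Obj C"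
  shows "left_module (X \<otimes> M) (\<nu> \<lhd> M)"
proof -
  note [simp] = left_module_typing[OF assms(1)] assms(2)
  note E = left_module_eqs[OF assms(1), THEN arg_cong, of "\<lambda>f. f \<lhd> M"]
  show ?thesis
    unfolding left_module_def using E by (simp add: in_Hom_iff)
qed

lemma regular_bimodule: "bimodule A m m"
  unfolding bimodule_def left_module_def right_module_def
  using m_assoc m_lunit m_runit by (simp add: in_Hom_iff)

text \<open>The beginning of the bar resolution of \<open>X\<close>, contracted by inserting
  \<open>\<eta>\<close> in front. The pair is the one that defines
  \<open>A \<otimes>\<^sub>A X\<close>, so this is the source of the left unit constraint.\<close>

lemma left_action_coequalizer:
  assumes "left_module X \<nu>"
  shows "is_coequalizer C (m \<lhd> X) (A \<rhd> \<nu>) \<nu>"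
proof -
  note t [simp] = left_module_typing[OF assms]
  note E = left_module_eqs[OF assms]
  have "(m \<lhd> X) \<cdot> (\<eta> \<lhd> (A \<otimes> X)) = Ident C (A \<otimes> X)"
    using arg_cong[OF m_lunit, of "\<lambda>f. f \<lhd> X"] by simp
  moreover have "(A \<rhd> \<nu>) \<cdot> (\<eta> \<lhd> (A \<otimes> X)) = (\<eta> \<lhd> X) \<cdot> \<nu>"
    using whisker_exchange[of \<eta> \<nu>] by simp
  ultimately show ?thesis
    by (intro split_coequalizer[of _ _ _ "\<eta> \<lhd> X" "\<eta> \<lhd> (A \<otimes> X)"]) (simp_all add: E)
qed

text \<open>The pair defines the tensor product over \<open>A\<close> of \<open>X\<close> with the
  free module \<open>A \<otimes> Y\<close>, and inserting \<open>\<eta>\<close> in front of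
  \<open>Y\<close> contracts it. The case \<open>Y = \<one>\<close> gives the right unit constraint;
  a free bimodule in place of \<open>X\<close> gives the multiplication of the functor.\<close>

lemma right_action_coequalizer:
  assumes "right_module X \<mu>" "Y \<in> Obj C"
  shows "is_coequalizer C (\<mu> \<lhd> (A \<otimes> Y)) (X \<rhd> (m \<lhd> Y)) (\<mu> \<lhd> Y)"
proof -
  note [simp] = right_module_typing[OF assms(1)] assms(2)
  note E = right_module_eqs[OF assms(1), THEN arg_cong, of "\<lambda>f. f \<lhd> Y"]
  have "(X \<rhd> (m \<lhd> Y)) \<cdot> ((X \<otimes> A) \<rhd> (\<eta> \<lhd> Y)) = Ident C (X \<otimes> A \<otimes> Y)"
    using arg_cong[OF m_runit, of "\<lambda>f. X \<rhd> (f \<lhd> Y)"] by simp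
  moreover have "(\<mu> \<lhd> (A \<otimes> Y)) \<cdot> ((X \<otimes> A) \<rhd> (\<eta> \<lhd> Y)) = (X \<rhd> (\<eta> \<lhd> Y)) \<cdot> (\<mu> \<lhd> Y)"
    using whisker_exchange[of \<mu> "\<eta> \<lhd> Y"] by simp
  ultimately show ?thesis
    using E
    by (intro split_coequalizer[of _ _ _ "X \<rhd> (\<eta> \<lhd> Y)" "(X \<otimes> A) \<rhd> (\<eta> \<lhd> Y)"]) simp_all
qed

lemma robust_coequalizer:
  assumes "robust Y \<nu>" "right_module X \<mu>" "M \<in> Obj C"
  shows "is_coequalizer C (M \<rhd> (\<mu> \<lhd> Y)) (M \<rhd> (X \<rhd> \<nu>)) (M \<rhd> quot X \<mu> Y \<nu>)"
  using assms unfolding robust_def by blast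

end

section \<open>Quotients over a coflat algebra\<close>

locale coflat_algebra = monoidal_algebra +
  assumes coequalizers: "has_coequalizers C"
    and A_coflat: "left_coflat C A"
begin

lemma quot_coequalizer:
  assumes "right_module X \<mu>" "left_module Y \<nu>"
  shows "is_coequalizer C (\<mu> \<lhd> Y) (X \<rhd> \<nu>) (quot X \<mu> Y \<nu>)"
proof -
  note [simp] = right_module_typing[OF assms(1)] left_module_typing[OF assms(2)]
  have "\<exists>q. is_coequalizer C (\<mu> \<lhd> Y) (X \<rhd> \<nu>) q"
    using coequalizers unfolding has_coequalizers_def
    by (auto simp: in_Hom_iff)
  then show ?thesis
    unfolding quot_def by (rule someI_ex)
qed

text \<open>\<open>robust\<close> speaks about the arbitrarily chosen \<open>quot\<close>. Any
  coequalizer that survives left whiskering may replace it, since the two differ by an isomorphism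
  and whiskering preserves isomorphisms.\<close>

lemma robustI:
  assumes "left_module Y \<nu>"
    and "\<And>X \<mu>. right_module X \<mu> \<Longrightarrow> \<exists>e. is_coequalizer C (\<mu> \<lhd> Y) (X \<rhd> \<nu>) e \<and>
      (\<forall>M \<in> Obj C. is_coequalizer C (M \<rhd> (\<mu> \<lhd> Y)) (M \<rhd> (X \<rhd> \<nu>)) (M \<rhd> e))"
  shows "robust Y \<nu>"
  unfolding robust_def
proof (intro ballI allI impI)
  fix M X \<mu> assume M: "M \<in> Obj C" and X: "right_module X \<mu>"
  obtain e where e: "is_coequalizer C (\<mu> \<lhd> Y) (X \<rhd> \<nu>) e"
    "is_coequalizer C (M \<rhd> (\<mu> \<lhd> Y)) (M \<rhd> (X \<rhd> \<nu>)) (M \<rhd> e)"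
    using assms(2)[OF X] M by auto
  note q = quot_coequalizer[OF X assms(1)]
  let ?q = "quot X \<mu> Y \<nu>" and ?i = "factor C e (quot X \<mu> Y \<nu>)"
  note t [simp] = coequalizer_typing[OF e(1)] coequalizer_typing[OF q] M
  note i = coequalizer_factor[OF e(1) t(12,13) t(14)[symmetric]]
  note [simp] = i(1-3)
  have "is_coequalizer C (M \<rhd> (\<mu> \<lhd> Y)) (M \<rhd> (X \<rhd> \<nu>)) ((M \<rhd> ?i) \<cdot> (M \<rhd> e))"
    by (rule coequalizer_iso_Comp[OF e(2) is_iso_whisker(1)[OF coequalizer_factor_iso[OF e(1) q] M]])
      simp
  also have "(M \<rhd> ?i) \<cdot> (M \<rhd> e) = M \<rhd> (?i \<cdot> e)"
    by simp
  finally show "is_coequalizer C (M \<rhd> (\<mu> \<lhd> Y)) (M \<rhd> (X \<rhd> \<nu>)) (M \<rhd> ?q)"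
    by (simp only: i(4))
qed

lemma free_robust:
  assumes "X \<in> Obj C"
  shows "robust (A \<otimes> X) (m \<lhd> X)"
proof (rule robustI)
  show "left_module (A \<otimes> X) (m \<lhd> X)"
    using assms left_module_whisker bimodule_modules(1)[OF regular_bimodule] by blast
  fix Z \<mu> assume Z: "right_module Z \<mu>"
  note [simp] = right_module_typing[OF Z] assms
  \<comment> \<open>Whiskering with \<open>M\<close> amounts to replacing the right module
    \<open>Z\<close> by \<open>M \<otimes> Z\<close>.\<close>
  have "is_coequalizer C (M \<rhd> (\<mu> \<lhd> (A \<otimes> X))) ((M \<otimes> Z) \<rhd> (m \<lhd> X)) (M \<rhd> (\<mu> \<lhd> X))"
    if "M \<in> Obj C" for M
    using right_action_coequalizer[OF right_module_whisker[OF Z that] assms] that by simp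
  then show "\<exists>e. is_coequalizer C (\<mu> \<lhd> (A \<otimes> X)) (Z \<rhd> (m \<lhd> X)) e \<and>
      (\<forall>M \<in> Obj C. is_coequalizer C (M \<rhd> (\<mu> \<lhd> (A \<otimes> X))) (M \<rhd> (Z \<rhd> (m \<lhd> X))) (M \<rhd> e))"
    using right_action_coequalizer[OF Z assms] by (intro exI[of _ "\<mu> \<lhd> X"]) simp
qed

lemma regular_robust: "robust A m"
  using free_robust[of "\<one>"] by simp

lemma coequalizer_coflat:
  assumes "is_coequalizer C f g q" "left_coflat C N"
  shows "epi (q \<lhd> N)"
  using left_coflatD[OF assms(2,1)] by (rule coequalizer_epi)

context
  fixes Z \<mu>Z X \<nu>X \<mu>X q r
  assumes Z: "right_module Z \<mu>Z" and X: "bimodule X \<nu>X \<mu>X"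
    and q: "is_coequalizer C (\<mu>Z \<lhd> X) (Z \<rhd> \<nu>X) q"
    and r: "r = factor C (q \<lhd> A) (q \<cdot> (Z \<rhd> \<mu>X))"
begin

text \<open>Coflatness of \<open>A\<close> makes \<open>q \<lhd> A\<close> a coequalizer. The arrow
  \<open>q \<cdot> (Z \<rhd> \<mu>X)\<close> respects the whiskered pair because
  \<open>\<mu>X\<close> commutes with \<open>\<nu>X\<close> by the bimodule law and with
  \<open>\<mu>Z\<close> by interchange.\<close>

lemma quot_right_action:
  shows "r \<in> Arr C" "Dom C r = Cod C q \<otimes> A" "Cod C r = Cod C q"
    and "r \<cdot> (q \<lhd> A) = q \<cdot> (Z \<rhd> \<mu>X)"
proof -
  note [simp] = right_module_typing[OF Z] bimodule_typing[OF X]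
  note t = coequalizer_typing[OF q]
  have t6 [simp]: "Dom C q = Z \<otimes> X"
    using t(6) by simp
  note [simp] = t(5)
  have c1: "(Z \<rhd> \<mu>X) \<cdot> (Z \<rhd> (\<nu>X \<lhd> A)) = (Z \<rhd> \<nu>X) \<cdot> ((Z \<otimes> A) \<rhd> \<mu>X)"
    using arg_cong[OF bimodule_compat[OF X], of "\<lambda>f. Z \<rhd> f"] by simp
  have c2: "(Z \<rhd> \<mu>X) \<cdot> (\<mu>Z \<lhd> (X \<otimes> A)) = (\<mu>Z \<lhd> X) \<cdot> ((Z \<otimes> A) \<rhd> \<mu>X)"
    by (rule whisker_swap) simp_all
  have h: "(q \<cdot> (Z \<rhd> \<mu>X)) \<cdot> ((\<mu>Z \<lhd> X) \<lhd> A) = (q \<cdot> (Z \<rhd> \<mu>X)) \<cdot> ((Z \<rhd> \<nu>X) \<lhd> A)"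
    using Comp_tail[OF t(7)] by (simp add: c1 c2)
  note F = coequalizer_factor[OF left_coflatD[OF A_coflat q], OF _ _ h]
  show "r \<in> Arr C" "Dom C r = Cod C q \<otimes> A" "Cod C r = Cod C q"
    and "r \<cdot> (q \<lhd> A) = q \<cdot> (Z \<rhd> \<mu>X)"
    unfolding r using F by simp_all
qed

lemma quot_right_module: "right_module (Cod C q) r"
proof -
  note [simp] = right_module_typing[OF Z] bimodule_typing[OF X] quot_right_action(1-3)
  note E = quot_right_action(4)
  have [simp]: "q \<in> Arr C" "Dom C q = Z \<otimes> X"
    using coequalizer_typing[OF q] by simp_all
  note M = right_module_eqs[OF bimodule_modules(2)[OF X], THEN arg_cong, of "\<lambda>f. Z \<rhd> f"]
  have EA: "(r \<lhd> A) \<cdot> (q \<lhd> (A \<otimes> A)) = (q \<lhd> A) \<cdot> (Z \<rhd> (\<mu>X \<lhd> A))"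
    using arg_cong[OF E, of "\<lambda>f. f \<lhd> A"] by simp
  have sm: "(Cod C q \<rhd> m) \<cdot> (q \<lhd> (A \<otimes> A)) = (q \<lhd> A) \<cdot> ((Z \<otimes> X) \<rhd> m)"
    by (rule whisker_swap) simp_all
  have s\<eta>: "(Cod C q \<rhd> \<eta>) \<cdot> q = (q \<lhd> A) \<cdot> ((Z \<otimes> X) \<rhd> \<eta>)"
    using whisker_exchange[of q \<eta>] by simp
  have "epi (q \<lhd> (A \<otimes> A))"
    using coequalizer_coflat[OF q left_coflat_TensorO[OF A_coflat A_coflat]] by simp
  then have "r \<cdot> (r \<lhd> A) = r \<cdot> (Cod C q \<rhd> m)"
    by (rule epiD) (use M in \<open>simp_all add: E EA sm E[THEN Comp_tail]\<close>)
  moreover have "r \<cdot> (Cod C q \<rhd> \<eta>) = Ident C (Cod C q)"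
    by (rule epiD[OF coequalizer_epi[OF q]]) (use M in \<open>simp_all add: s\<eta> E[THEN Comp_tail]\<close>)
  ultimately show ?thesis
    unfolding right_module_def by (simp add: in_Hom_iff)
qed

end

section \<open>Coflatness and bimodule structure of a tensor product\<close>

context
  fixes X \<nu>X \<mu>X Y \<nu>Y \<mu>Y q
  assumes X: "bimodule X \<nu>X \<mu>X" and Y: "bimodule Y \<nu>Y \<mu>Y" and Y_robust: "robust Y \<nu>Y"
    and q: "q = quot X \<mu>X Y \<nu>Y"
begin

lemma bimodule_quot_coequalizer: "is_coequalizer C (\<mu>X \<lhd> Y) (X \<rhd> \<nu>Y) q"
  unfolding q by (intro quot_coequalizer bimodule_modules[OF X] bimodule_modules[OF Y])

lemma bimodule_quot_stable:
  "M \<in> Obj C \<Longrightarrow> is_coequalizer C (M \<rhd> (\<mu>X \<lhd> Y)) (M \<rhd> (X \<rhd> \<nu>Y)) (M \<rhd> q)"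
  unfolding q by (intro robust_coequalizer Y_robust bimodule_modules[OF X])

lemma bimodule_quot_typing: "q \<in> Arr C" "Dom C q = X \<otimes> Y"
  using coequalizer_typing[OF bimodule_quot_coequalizer] bimodule_typing[OF X] bimodule_typing[OF Y]
  by simp_all

text \<open>Two families of coequalizers are interchanged: \<open>e\<close> tensored with objects on
  its right, exact by coflatness of \<open>X\<close>, \<open>A\<close> and \<open>Y\<close>, and
  \<open>q\<close> tensored with objects on its left, exact by robustness of \<open>Y\<close>. An
  arrow \<open>h\<close> out of \<open>?T \<otimes> ?V\<close> is lifted to
  \<open>?T \<otimes> X \<otimes> Y\<close>, descends along \<open>e\<close> to \<open>k\<close>,
  and then along \<open>?R \<rhd> q\<close> to \<open>n\<close>.\<close>

lemma quot_coflat: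
  assumes "left_coflat C X" "left_coflat C Y"
  shows "left_coflat C (Cod C q)"
  unfolding left_coflat_def preserves_coequalizers_def
proof (intro allI impI)
  fix f g e assume e: "is_coequalizer C f g e"
  note X [simp] = bimodule_typing[OF X]
  note Y [simp] = bimodule_typing[OF Y]
  note t = coequalizer_typing[OF e]
  note [simp] = t(1-6) bimodule_quot_typing
  let ?V = "Cod C q" and ?S = "Dom C f" and ?T = "Cod C f" and ?R = "Cod C e"
  note eXY = left_coflatD[OF left_coflat_TensorO[OF assms X(1) Y(1)] e]
  have eXAY: "epi (e \<lhd> (X \<otimes> A \<otimes> Y))"
    by (rule coequalizer_coflat[OF e]) (intro left_coflat_TensorO assms A_coflat; simp)
  have sw: "(f \<lhd> ?V) \<cdot> (?S \<rhd> q) = (?T \<rhd> q) \<cdot> (f \<lhd> (X \<otimes> Y))"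
    "(g \<lhd> ?V) \<cdot> (?S \<rhd> q) = (?T \<rhd> q) \<cdot> (g \<lhd> (X \<otimes> Y))"
    "(e \<lhd> ?V) \<cdot> (?T \<rhd> q) = (?R \<rhd> q) \<cdot> (e \<lhd> (X \<otimes> Y))"
    "(?R \<rhd> (\<mu>X \<lhd> Y)) \<cdot> (e \<lhd> (X \<otimes> A \<otimes> Y)) = (e \<lhd> (X \<otimes> Y)) \<cdot> (?T \<rhd> (\<mu>X \<lhd> Y))"
    "((?R \<otimes> X) \<rhd> \<nu>Y) \<cdot> (e \<lhd> (X \<otimes> A \<otimes> Y)) = (e \<lhd> (X \<otimes> Y)) \<cdot> ((?T \<otimes> X) \<rhd> \<nu>Y)"
    using whisker_exchange[of f q] whisker_exchange[of g q] whisker_exchange[of e q]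
      whisker_exchange[of e "\<mu>X \<lhd> Y"] whisker_exchange[of e "X \<rhd> \<nu>Y"] by simp_all
  have qT: "(?T \<rhd> q) \<cdot> ((?T \<otimes> X) \<rhd> \<nu>Y) = (?T \<rhd> q) \<cdot> (?T \<rhd> (\<mu>X \<lhd> Y))"
    using coequalizer_typing(7)[OF bimodule_quot_stable[of ?T]] by simp
  have epiT: "epi (?T \<rhd> q)" and epiS: "epi (?S \<rhd> q)" and epiR: "epi (?R \<rhd> q)"
    by (rule coequalizer_epi[OF bimodule_quot_stable], simp)+
  have "is_coequalizer C (f \<lhd> ?V) (g \<lhd> ?V) (e \<lhd> ?V)"
  proof (rule coequalizerI)
    show "(e \<lhd> ?V) \<cdot> (f \<lhd> ?V) = (e \<lhd> ?V) \<cdot> (g \<lhd> ?V)"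
      using arg_cong[OF t(7), of "\<lambda>f. f \<lhd> ?V"] by simp
    have "epi ((e \<lhd> ?V) \<cdot> (?T \<rhd> q))"
      unfolding sw(3) by (rule epi_Comp[OF coequalizer_epi[OF eXY] epiR]) simp
    then show "epi (e \<lhd> ?V)"
      by (rule epi_cancel_right) simp_all
    fix h assume "h \<in> Arr C" "Dom C h = Cod C (f \<lhd> ?V)" and hfg: "h \<cdot> (f \<lhd> ?V) = h \<cdot> (g \<lhd> ?V)"
    then have h [simp]: "h \<in> Arr C" "Dom C h = ?T \<otimes> ?V"
      by simp_all
    have "(h \<cdot> (?T \<rhd> q)) \<cdot> (f \<lhd> (X \<otimes> Y)) = (h \<cdot> (?T \<rhd> q)) \<cdot> (g \<lhd> (X \<otimes> Y))"
      using Comp_tail[OF hfg, of "?S \<rhd> q"] by (simp add: sw)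
    from coequalizer_ex[OF eXY _ _ this]
    obtain k where k [simp]: "k \<in> Arr C" "Dom C k = ?R \<otimes> X \<otimes> Y"
      and ke: "k \<cdot> (e \<lhd> (X \<otimes> Y)) = h \<cdot> (?T \<rhd> q)"
      by auto
    \<comment> \<open>Tested against the epi \<open>e \<lhd> (X \<otimes> A \<otimes> Y)\<close>,
      the claim becomes the fact that \<open>?T \<rhd> q\<close> identifies the two actions of the
      middle \<open>A\<close>.\<close>
    have "k \<cdot> (?R \<rhd> (\<mu>X \<lhd> Y)) = k \<cdot> (?R \<rhd> (X \<rhd> \<nu>Y))"
      by (rule epiD[OF eXAY]) (simp_all add: sw ke[THEN Comp_tail] qT)
    from coequalizer_ex[OF bimodule_quot_stable _ _ this]
    obtain n where n [simp]: "n \<in> Arr C" "Dom C n = ?R \<otimes> ?V"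
      and nq: "n \<cdot> (?R \<rhd> q) = k"
      by auto
    have "n \<cdot> (e \<lhd> ?V) = h"
      by (rule epiD[OF epiT]) (simp_all add: sw nq[THEN Comp_tail] ke)
    then show "\<exists>k \<in> Arr C. Dom C k = Cod C (e \<lhd> ?V) \<and> k \<cdot> (e \<lhd> ?V) = h"
      by (intro bexI[of _ n]) simp_all
  qed simp_all
  then show "is_coequalizer C
     (OnArr \<lparr>OnObj = \<lambda>Z. Z \<otimes> ?V, OnArr = \<lambda>f. f \<lhd> ?V\<rparr> f)
     (OnArr \<lparr>OnObj = \<lambda>Z. Z \<otimes> ?V, OnArr = \<lambda>f. f \<lhd> ?V\<rparr> g)
     (OnArr \<lparr>OnObj = \<lambda>Z. Z \<otimes> ?V, OnArr = \<lambda>f. f \<lhd> ?V\<rparr> e)"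
    by simp
qed

context
  fixes l
  assumes l: "l = factor C (A \<rhd> q) (q \<cdot> (\<nu>X \<lhd> Y))"
begin

text \<open>Mirror image of the right action, except that \<open>A \<rhd> q\<close> is a coequalizer
  by robustness of \<open>Y\<close> and not by coflatness.\<close>

lemma quot_left_action:
  shows "l \<in> Arr C" "Dom C l = A \<otimes> Cod C q" "Cod C l = Cod C q"
    and "l \<cdot> (A \<rhd> q) = q \<cdot> (\<nu>X \<lhd> Y)"
proof -
  note [simp] = bimodule_typing[OF X] bimodule_typing[OF Y] bimodule_quot_typing
  note e = coequalizer_typing(7)[OF bimodule_quot_coequalizer]
  have c1: "(\<nu>X \<lhd> Y) \<cdot> (A \<rhd> (\<mu>X \<lhd> Y)) = (\<mu>X \<lhd> Y) \<cdot> (\<nu>X \<lhd> (A \<otimes> Y))"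
    using arg_cong[OF bimodule_compat[OF X], of "\<lambda>f. f \<lhd> Y"] by simp
  have c2: "(X \<rhd> \<nu>Y) \<cdot> (\<nu>X \<lhd> (A \<otimes> Y)) = (\<nu>X \<lhd> Y) \<cdot> ((A \<otimes> X) \<rhd> \<nu>Y)"
    by (rule whisker_swap) simp_all
  have h: "(q \<cdot> (\<nu>X \<lhd> Y)) \<cdot> (A \<rhd> (\<mu>X \<lhd> Y)) = (q \<cdot> (\<nu>X \<lhd> Y)) \<cdot> (A \<rhd> (X \<rhd> \<nu>Y))"
    using Comp_tail[OF e] by (simp add: c1 c2[symmetric])
  note F = coequalizer_factor[OF bimodule_quot_stable[OF algebra_typing(1)], OF _ _ h]
  show "l \<in> Arr C" "Dom C l = A \<otimes> Cod C q" "Cod C l = Cod C q"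
    and "l \<cdot> (A \<rhd> q) = q \<cdot> (\<nu>X \<lhd> Y)"
    unfolding l using F by simp_all
qed

context
  fixes r
  assumes r: "r = factor C (q \<lhd> A) (q \<cdot> (X \<rhd> \<mu>Y))"
begin

lemmas quot_bimodule_right =
  quot_right_action[OF bimodule_modules(2)[OF X] Y bimodule_quot_coequalizer r]
  quot_right_module[OF bimodule_modules(2)[OF X] Y bimodule_quot_coequalizer r]

lemma quot_bimodule: "bimodule (Cod C q) l r"
proof -
  note [simp] = bimodule_typing[OF X] bimodule_typing[OF Y] bimodule_quot_typing
    quot_left_action(1-3) quot_bimodule_right(1-3)
  note E = quot_left_action(4) quot_bimodule_right(4)
  note E' = E E[THEN Comp_tail]
  let ?V = "Cod C q"
  note M = left_module_eqs[OF bimodule_modules(1)[OF X], THEN arg_cong, of "\<lambda>f. f \<lhd> Y"]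
  have EA: "(A \<rhd> l) \<cdot> ((A \<otimes> A) \<rhd> q) = (A \<rhd> q) \<cdot> (A \<rhd> (\<nu>X \<lhd> Y))"
    "(l \<lhd> A) \<cdot> (A \<rhd> (q \<lhd> A)) = (q \<lhd> A) \<cdot> (\<nu>X \<lhd> (Y \<otimes> A))"
    "(A \<rhd> r) \<cdot> (A \<rhd> (q \<lhd> A)) = (A \<rhd> q) \<cdot> ((A \<otimes> X) \<rhd> \<mu>Y)"
    using arg_cong[OF E(1), of "\<lambda>f. A \<rhd> f"] arg_cong[OF E(1), of "\<lambda>f. f \<lhd> A"]
      arg_cong[OF E(2), of "\<lambda>f. A \<rhd> f"] by simp_all
  have sm: "(m \<lhd> ?V) \<cdot> ((A \<otimes> A) \<rhd> q) = (A \<rhd> q) \<cdot> (m \<lhd> (X \<otimes> Y))"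
    using whisker_exchange[of m q] by simp
  have s\<eta>: "(\<eta> \<lhd> ?V) \<cdot> q = (A \<rhd> q) \<cdot> (\<eta> \<lhd> (X \<otimes> Y))"
    using whisker_exchange[of \<eta> q] by simp
  have s\<nu>: "(\<nu>X \<lhd> Y) \<cdot> ((A \<otimes> X) \<rhd> \<mu>Y) = (X \<rhd> \<mu>Y) \<cdot> (\<nu>X \<lhd> (Y \<otimes> A))"
    using whisker_exchange[of \<nu>X \<mu>Y] by simp
  have "l \<cdot> (A \<rhd> l) = l \<cdot> (m \<lhd> ?V)"
    by (rule epiD[OF coequalizer_epi[OF bimodule_quot_stable[of "A \<otimes> A"]]])
      (use M in \<open>simp_all add: E' EA sm\<close>)
  moreover have "l \<cdot> (\<eta> \<lhd> ?V) = Ident C ?V"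
    by (rule epiD[OF coequalizer_epi[OF bimodule_quot_coequalizer]]) (use M in \<open>simp_all add: s\<eta> E'\<close>)
  \<comment> \<open>Compatibility of the two actions needs \<open>q\<close> whiskered on both sides:
    robustness of \<open>Y\<close> gives the coequalizer \<open>A \<rhd> q\<close>, which coflatness
    of \<open>A\<close> then preserves.\<close>
  moreover have "epi (A \<rhd> (q \<lhd> A))"
    using coequalizer_coflat[OF bimodule_quot_stable A_coflat, of A] by simp
  then have "r \<cdot> (l \<lhd> A) = l \<cdot> (A \<rhd> r)"
    by (rule epiD) (simp_all add: E' EA s\<nu>)
  ultimately show ?thesis
    using quot_bimodule_right(5) unfolding bimodule_def left_module_def by (simp add: in_Hom_iff)
qed

end

end

end

section \<open>Iterated tensor products\<close>

text \<open>
  Here \<open>q\<^sub>1 : Z \<otimes> X \<rightarrow> U\<close>, \<open>q\<^sub>2 : U \<otimes> Y \<rightarrow> W\<close> and \<open>q\<^sub>3 : X \<otimes> Y \<rightarrow> V\<close> are the projections onto the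
  iterated quotients, and \<open>p : Z \<otimes> V \<rightarrow> W\<close> is the comparison that makes \<open>W\<close> also a model of
  \<open>Z \<otimes>\<^sub>A (X \<otimes>\<^sub>A Y)\<close>.
\<close>

context
  fixes Z \<mu>Z X \<nu>X \<mu>X Y \<nu>Y q\<^sub>1 r U q\<^sub>2 W q\<^sub>3 l V
  assumes Z: "right_module Z \<mu>Z" and X: "bimodule X \<nu>X \<mu>X" and Y: "left_module Y \<nu>Y"
    and Y_coflat: "left_coflat C Y"
    and q\<^sub>1: "is_coequalizer C (\<mu>Z \<lhd> X) (Z \<rhd> \<nu>X) q\<^sub>1" "Cod C q\<^sub>1 = U"
    and r: "right_module U r" "r \<cdot> (q\<^sub>1 \<lhd> A) = q\<^sub>1 \<cdot> (Z \<rhd> \<mu>X)"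
    and q\<^sub>2: "is_coequalizer C (r \<lhd> Y) (U \<rhd> \<nu>Y) q\<^sub>2" "Cod C q\<^sub>2 = W"
    and q\<^sub>3: "q\<^sub>3 \<in> Arr C" "Dom C q\<^sub>3 = X \<otimes> Y" "Cod C q\<^sub>3 = V"
      "\<And>M. M \<in> Obj C \<Longrightarrow> is_coequalizer C (M \<rhd> (\<mu>X \<lhd> Y)) (M \<rhd> (X \<rhd> \<nu>Y)) (M \<rhd> q\<^sub>3)"
    and l: "left_module V l" "l \<cdot> (A \<rhd> q\<^sub>3) = q\<^sub>3 \<cdot> (\<nu>X \<lhd> Y)"
begin

lemma iterated_quot_typing:
  "q\<^sub>1 \<in> Arr C" "Dom C q\<^sub>1 = Z \<otimes> X" "q\<^sub>2 \<in> Arr C" "Dom C q\<^sub>2 = U \<otimes> Y"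
  using coequalizer_typing[OF q\<^sub>1(1)] coequalizer_typing[OF q\<^sub>2(1)]
    right_module_typing[OF Z] bimodule_typing[OF X] left_module_typing[OF Y]
    right_module_typing[OF r(1)] by simp_all

lemmas iterated_quot_simps = iterated_quot_typing q\<^sub>1(2) q\<^sub>2(2) q\<^sub>3(1-3)
  right_module_typing[OF Z] bimodule_typing[OF X] left_module_typing[OF Y]
  right_module_typing[OF r(1)] left_module_typing[OF l(1)]

lemma iterated_quot_eqs:
  "(r \<lhd> Y) \<cdot> (q\<^sub>1 \<lhd> (A \<otimes> Y)) = (q\<^sub>1 \<lhd> Y) \<cdot> (Z \<rhd> (\<mu>X \<lhd> Y))"
  "(U \<rhd> \<nu>Y) \<cdot> (q\<^sub>1 \<lhd> (A \<otimes> Y)) = (q\<^sub>1 \<lhd> Y) \<cdot> ((Z \<otimes> X) \<rhd> \<nu>Y)"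
  "(\<mu>Z \<lhd> V) \<cdot> ((Z \<otimes> A) \<rhd> q\<^sub>3) = (Z \<rhd> q\<^sub>3) \<cdot> (\<mu>Z \<lhd> (X \<otimes> Y))"
  "(Z \<rhd> l) \<cdot> ((Z \<otimes> A) \<rhd> q\<^sub>3) = (Z \<rhd> q\<^sub>3) \<cdot> (Z \<rhd> (\<nu>X \<lhd> Y))"
  "(q\<^sub>1 \<lhd> Y) \<cdot> (Z \<rhd> (\<nu>X \<lhd> Y)) = (q\<^sub>1 \<lhd> Y) \<cdot> (\<mu>Z \<lhd> (X \<otimes> Y))"
  "(Z \<rhd> q\<^sub>3) \<cdot> ((Z \<otimes> X) \<rhd> \<nu>Y) = (Z \<rhd> q\<^sub>3) \<cdot> (Z \<rhd> (\<mu>X \<lhd> Y))"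
  "q\<^sub>2 \<cdot> (U \<rhd> \<nu>Y) = q\<^sub>2 \<cdot> (r \<lhd> Y)"
proof -
  note [simp] = iterated_quot_simps
  show "(r \<lhd> Y) \<cdot> (q\<^sub>1 \<lhd> (A \<otimes> Y)) = (q\<^sub>1 \<lhd> Y) \<cdot> (Z \<rhd> (\<mu>X \<lhd> Y))"
    using arg_cong[OF r(2), of "\<lambda>f. f \<lhd> Y"] by simp
  show "(U \<rhd> \<nu>Y) \<cdot> (q\<^sub>1 \<lhd> (A \<otimes> Y)) = (q\<^sub>1 \<lhd> Y) \<cdot> ((Z \<otimes> X) \<rhd> \<nu>Y)"
    using whisker_exchange[of q\<^sub>1 \<nu>Y] by simp
  show "(\<mu>Z \<lhd> V) \<cdot> ((Z \<otimes> A) \<rhd> q\<^sub>3) = (Z \<rhd> q\<^sub>3) \<cdot> (\<mu>Z \<lhd> (X \<otimes> Y))"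
    using whisker_exchange[of \<mu>Z q\<^sub>3] by simp
  show "(Z \<rhd> l) \<cdot> ((Z \<otimes> A) \<rhd> q\<^sub>3) = (Z \<rhd> q\<^sub>3) \<cdot> (Z \<rhd> (\<nu>X \<lhd> Y))"
    using arg_cong[OF l(2), of "\<lambda>f. Z \<rhd> f"] by simp
  show "(q\<^sub>1 \<lhd> Y) \<cdot> (Z \<rhd> (\<nu>X \<lhd> Y)) = (q\<^sub>1 \<lhd> Y) \<cdot> (\<mu>Z \<lhd> (X \<otimes> Y))"
    using arg_cong[OF coequalizer_typing(7)[OF q\<^sub>1(1)], of "\<lambda>f. f \<lhd> Y"] by simp
  show "(Z \<rhd> q\<^sub>3) \<cdot> ((Z \<otimes> X) \<rhd> \<nu>Y) = (Z \<rhd> q\<^sub>3) \<cdot> (Z \<rhd> (\<mu>X \<lhd> Y))"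
    using coequalizer_typing(7)[OF q\<^sub>3(4)[of Z]] by simp
  show "q\<^sub>2 \<cdot> (U \<rhd> \<nu>Y) = q\<^sub>2 \<cdot> (r \<lhd> Y)"
    using coequalizer_typing(7)[OF q\<^sub>2(1)] .
qed

text \<open>The action \<open>r\<close> is induced by \<open>\<mu>X\<close>, and
  \<open>q\<^sub>2\<close> identifies \<open>r\<close> with \<open>\<nu>Y\<close>. Hence
  \<open>q\<^sub>2 \<cdot> (q\<^sub>1 \<lhd> Y)\<close> identifies \<open>\<mu>X\<close> with
  \<open>\<nu>Y\<close> and factors through \<open>Z \<rhd> q\<^sub>3\<close>.\<close>

lemma iterated_quot_comparison:
  "\<exists>p \<in> Arr C. Dom C p = Z \<otimes> V \<and> Cod C p = W \<and> p \<cdot> (Z \<rhd> q\<^sub>3) = q\<^sub>2 \<cdot> (q\<^sub>1 \<lhd> Y)"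
proof -
  note [simp] = iterated_quot_simps
  note E = iterated_quot_eqs
  have "(q\<^sub>2 \<cdot> (q\<^sub>1 \<lhd> Y)) \<cdot> (Z \<rhd> (\<mu>X \<lhd> Y)) = (q\<^sub>2 \<cdot> (q\<^sub>1 \<lhd> Y)) \<cdot> (Z \<rhd> (X \<rhd> \<nu>Y))"
    using E(7)[THEN Comp_tail, of "q\<^sub>1 \<lhd> (A \<otimes> Y)"] by (simp add: E(1,2))
  from coequalizer_ex[OF q\<^sub>3(4) _ _ this] show ?thesis
    by auto
qed

text \<open>An arrow out of \<open>Z \<otimes> V\<close> that respects the pair is lifted along
  \<open>Z \<rhd> q\<^sub>3\<close>, descends along \<open>q\<^sub>1 \<lhd> Y\<close> by coflatness
  of \<open>Y\<close>, and then along \<open>q\<^sub>2\<close>. The quotients are arbitrary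
  coequalizers and not the chosen ones, so that the result also applies to their versions whiskered
  by \<open>M\<close>.\<close>

lemma iterated_quot_coequalizer:
  assumes p: "p \<in> Arr C" "Dom C p = Z \<otimes> V" "p \<cdot> (Z \<rhd> q\<^sub>3) = q\<^sub>2 \<cdot> (q\<^sub>1 \<lhd> Y)"
  shows "is_coequalizer C (\<mu>Z \<lhd> V) (Z \<rhd> l) p"
proof -
  note [simp] = iterated_quot_simps p(1,2)
  have [simp]: "Cod C p = W"
    using arg_cong[OF p(3), of "Cod C"] by simp
  note E = iterated_quot_eqs p(3)
  note E' = E E[THEN Comp_tail]
  have epi3: "epi (M \<rhd> q\<^sub>3)" if "M \<in> Obj C" for M
    using coequalizer_epi[OF q\<^sub>3(4)[OF that]] .
  note q1Y = left_coflatD[OF Y_coflat q\<^sub>1(1)]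
  have epi1: "epi (q\<^sub>1 \<lhd> (A \<otimes> Y))"
    by (rule coequalizer_coflat[OF q\<^sub>1(1) left_coflat_TensorO[OF A_coflat Y_coflat]]) simp_all
  show ?thesis
  proof (rule coequalizerI)
    show "p \<cdot> (\<mu>Z \<lhd> V) = p \<cdot> (Z \<rhd> l)"
      by (rule epiD[OF epi3[of "Z \<otimes> A"]]) (simp_all add: E')
    have "epi (p \<cdot> (Z \<rhd> q\<^sub>3))"
      unfolding p(3) using coequalizer_epi[OF q1Y] coequalizer_epi[OF q\<^sub>2(1)]
      by (rule epi_Comp) simp
    then show "epi p"
      by (rule epi_cancel_right) simp_all
    fix h assume "h \<in> Arr C" "Dom C h = Cod C (\<mu>Z \<lhd> V)" and hl: "h \<cdot> (\<mu>Z \<lhd> V) = h \<cdot> (Z \<rhd> l)"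
    then have h [simp]: "h \<in> Arr C" "Dom C h = Z \<otimes> V"
      by simp_all
    have "(h \<cdot> (Z \<rhd> q\<^sub>3)) \<cdot> ((\<mu>Z \<lhd> X) \<lhd> Y) = (h \<cdot> (Z \<rhd> q\<^sub>3)) \<cdot> ((Z \<rhd> \<nu>X) \<lhd> Y)"
      using Comp_tail[OF hl, of "(Z \<otimes> A) \<rhd> q\<^sub>3"] by (simp add: E(3,4))
    from coequalizer_ex[OF q1Y _ _ this]
    obtain k where k [simp]: "k \<in> Arr C" "Dom C k = U \<otimes> Y"
      and k1: "k \<cdot> (q\<^sub>1 \<lhd> Y) = h \<cdot> (Z \<rhd> q\<^sub>3)"
      by auto
    have "k \<cdot> (r \<lhd> Y) = k \<cdot> (U \<rhd> \<nu>Y)"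
      by (rule epiD[OF epi1]) (simp_all add: E(1,2,6) k1[THEN Comp_tail])
    from coequalizer_ex[OF q\<^sub>2(1) _ _ this]
    obtain n where n [simp]: "n \<in> Arr C" "Dom C n = W" and n2: "n \<cdot> q\<^sub>2 = k"
      by auto
    have "n \<cdot> p = h"
      by (rule epiD[OF epi3[of Z]]) (simp_all add: p(3) n2[THEN Comp_tail] k1)
    then show "\<exists>k \<in> Arr C. Dom C k = Cod C p \<and> k \<cdot> p = h"
      by (intro bexI[of _ n]) simp_all
  qed simp_all
qed

end

text \<open>The chase for iterated quotients is run twice, over \<open>Z\<close> and over
  \<open>M \<otimes> Z\<close>. Robustness of \<open>X\<close> and of \<open>Y\<close> says that in
  the second run the whiskered quotients of the first may be used, so its comparison map is
  \<open>M \<rhd> p\<close>; thus \<open>p\<close> is a coequalizer that survives left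
  whiskering.\<close>

lemma quot_robust:
  fixes X Y q
  assumes X: "bimodule X \<nu>X \<mu>X" and X_coflat: "left_coflat C X" and X_robust: "robust X \<nu>X"
    and Y: "bimodule Y \<nu>Y \<mu>Y" and Y_coflat: "left_coflat C Y" and Y_robust: "robust Y \<nu>Y"
    and q: "q = quot X \<mu>X Y \<nu>Y"
    and l: "l = factor C (A \<rhd> q) (q \<cdot> (\<nu>X \<lhd> Y))"
  shows "robust (Cod C q) l"
proof (rule robustI)
  note quot_bimodule[OF X Y Y_robust q l refl]
  then show V: "left_module (Cod C q) l"
    by (rule bimodule_modules)
  fix Z \<mu>Z assume Z: "right_module Z \<mu>Z"
  let ?q = "quot Z \<mu>Z X \<nu>X"
  let ?U = "Cod C ?q" and ?r = "factor C (?q \<lhd> A) (?q \<cdot> (Z \<rhd> \<mu>X))"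
  let ?q2 = "quot ?U ?r Y \<nu>Y"
  note q1 = quot_coequalizer[OF Z bimodule_modules(1)[OF X]]
  note r = quot_right_action[OF Z X q1 refl]
  note U = quot_right_module[OF Z X q1 refl]
  note q2 = quot_coequalizer[OF U bimodule_modules(1)[OF Y]]
  note qt = bimodule_quot_typing[OF X Y Y_robust q]
  note qs = bimodule_quot_stable[OF X Y Y_robust q]
  note lE = quot_left_action(4)[OF X Y Y_robust q l]
  note hyps = Z X bimodule_modules(1)[OF Y] Y_coflat q1 refl U r(4) q2 refl qt refl qs V lE
  obtain p where p: "p \<in> Arr C" "Dom C p = Z \<otimes> Cod C q"
    "p \<cdot> (Z \<rhd> q) = ?q2 \<cdot> (?q \<lhd> Y)"
    using iterated_quot_comparison[OF hyps] by auto
  have "is_coequalizer C (M \<rhd> (\<mu>Z \<lhd> Cod C q)) (M \<rhd> (Z \<rhd> l)) (M \<rhd> p)" if M: "M \<in> Obj C" for M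
  proof -
    note [simp] = right_module_typing[OF Z] bimodule_typing[OF X] bimodule_typing[OF Y] qt M p(1,2)
      r(1-3) left_module_typing[OF V]
    have [simp]: "?q \<in> Arr C" "Dom C ?q = Z \<otimes> X"
      using coequalizer_typing[OF q1] by simp_all
    have [simp]: "?q2 \<in> Arr C" "Dom C ?q2 = ?U \<otimes> Y"
      using coequalizer_typing[OF q2] by simp_all
    have 1: "is_coequalizer C ((M \<rhd> \<mu>Z) \<lhd> X) ((M \<otimes> Z) \<rhd> \<nu>X) (M \<rhd> ?q)"
      using robust_coequalizer[OF X_robust Z M] by simp
    have 2: "is_coequalizer C ((M \<rhd> ?r) \<lhd> Y) ((M \<otimes> ?U) \<rhd> \<nu>Y) (M \<rhd> ?q2)"
      using robust_coequalizer[OF Y_robust U M] by simp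
    have 3: "(M \<rhd> ?r) \<cdot> ((M \<rhd> ?q) \<lhd> A) = (M \<rhd> ?q) \<cdot> ((M \<otimes> Z) \<rhd> \<mu>X)"
      using arg_cong[OF r(4), of "\<lambda>f. M \<rhd> f"] by simp
    have 4: "(M \<rhd> p) \<cdot> ((M \<otimes> Z) \<rhd> q) = (M \<rhd> ?q2) \<cdot> ((M \<rhd> ?q) \<lhd> Y)"
      using arg_cong[OF p(3), of "\<lambda>f. M \<rhd> f"] by simp
    have "is_coequalizer C ((M \<rhd> \<mu>Z) \<lhd> Cod C q) ((M \<otimes> Z) \<rhd> l) (M \<rhd> p)"
      by (rule iterated_quot_coequalizer[OF right_module_whisker[OF Z M] X bimodule_modules(1)[OF Y]
        Y_coflat 1 _ right_module_whisker[OF U M] 3 2 refl qt refl qs V lE _ _ 4]) simp_all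
    then show ?thesis
      by simp
  qed
  then show "\<exists>p. is_coequalizer C (\<mu>Z \<lhd> Cod C q) (Z \<rhd> l) p \<and>
      (\<forall>M \<in> Obj C. is_coequalizer C (M \<rhd> (\<mu>Z \<lhd> Cod C q)) (M \<rhd> (Z \<rhd> l)) (M \<rhd> p))"
    using iterated_quot_coequalizer[OF hyps p] by auto
qed

section \<open>The category of coflat robust bimodules\<close>

abbreviation carrier :: "'a \<times> 'b \<times> 'b \<Rightarrow> 'a"
  where "carrier P \<equiv> fst P"

abbreviation lact :: "'a \<times> 'b \<times> 'b \<Rightarrow> 'b"
  where "lact P \<equiv> fst (snd P)"

abbreviation ract :: "'a \<times> 'b \<times> 'b \<Rightarrow> 'b"
  where "ract P \<equiv> snd (snd P)"

text \<open>The objects of the target category, phrased by projections of a single variable so that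
  tensor products can be nested without taking triples apart.\<close>

definition admissible :: "'a \<times> 'b \<times> 'b \<Rightarrow> bool"
  where "admissible P \<longleftrightarrow> bimodule (carrier P) (lact P) (ract P) \<and>
    left_coflat C (carrier P) \<and> robust (carrier P) (lact P)"

lemma admissible_modules:
  assumes "admissible P"
  shows "bimodule (carrier P) (lact P) (ract P)" "left_coflat C (carrier P)"
    "robust (carrier P) (lact P)" "left_module (carrier P) (lact P)"
    "right_module (carrier P) (ract P)"
  using assms bimodule_modules unfolding admissible_def by auto

lemma admissible_typing [simp]:
  assumes "admissible P"
  shows "carrier P \<in> Obj C" "lact P \<in> Arr C" "ract P \<in> Arr C"
    "Dom C (lact P) = A \<otimes> carrier P" "Cod C (lact P) = carrier P"
    "Dom C (ract P) = carrier P \<otimes> A" "Cod C (ract P) = carrier P"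
  using bimodule_typing[OF admissible_modules(1)[OF assms]] by simp_all

lemma coflat_simps [simp]:
  "left_coflat C A" "left_coflat C \<one>" "admissible P \<Longrightarrow> left_coflat C (carrier P)"
  "\<lbrakk>left_coflat C X; left_coflat C Y; X \<in> Obj C; Y \<in> Obj C\<rbrakk> \<Longrightarrow> left_coflat C (X \<otimes> Y)"
  using A_coflat left_coflat_unit admissible_modules(2) left_coflat_TensorO by auto

lemma admissible_regular [simp]: "admissible (A, m, m)"
  unfolding admissible_def using regular_bimodule A_coflat regular_robust by simp

lemma bimodule_quot_eq: "bimodule_quot P Q = quot (carrier P) (ract P) (carrier Q) (lact Q)"
  by (simp add: bimodule_quot_def split_beta)

lemma bimodule_tensor_eq:
  "bimodule_tensor P Q = (Cod C (bimodule_quot P Q),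
    factor C (A \<rhd> bimodule_quot P Q) (bimodule_quot P Q \<cdot> (lact P \<lhd> carrier Q)),
    factor C (bimodule_quot P Q \<lhd> A) (bimodule_quot P Q \<cdot> (carrier P \<rhd> ract Q)))"
  by (simp add: bimodule_tensor_def bimodule_quot_eq split_beta Let_def)

context
  fixes P Q
  assumes P: "admissible P" and Q: "admissible Q"
begin

lemmas admissible_pair = admissible_modules(1)[OF P] admissible_modules(1,3)[OF Q] bimodule_quot_eq

lemma bimodule_quot_simps [simp]:
  shows "bimodule_quot P Q \<in> Arr C" "Dom C (bimodule_quot P Q) = carrier P \<otimes> carrier Q"
    "Cod C (bimodule_quot P Q) = carrier (bimodule_tensor P Q)"
  using bimodule_quot_typing[OF admissible_pair] by (simp_all add: bimodule_tensor_eq)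

lemma admissible_tensor [simp]: "admissible (bimodule_tensor P Q)"
  unfolding admissible_def bimodule_tensor_eq fst_conv snd_conv
  using quot_bimodule[OF admissible_pair refl refl] quot_coflat[OF admissible_pair]
    quot_robust[OF admissible_pair(1) _ _ admissible_pair(2) _ admissible_pair(3,4) refl]
    admissible_modules[OF P] admissible_modules[OF Q] by simp

lemma tensor_actions:
  "lact (bimodule_tensor P Q) \<cdot> (A \<rhd> bimodule_quot P Q) = bimodule_quot P Q \<cdot> (lact P \<lhd> carrier Q)"
  "ract (bimodule_tensor P Q) \<cdot> (bimodule_quot P Q \<lhd> A) = bimodule_quot P Q \<cdot> (carrier P \<rhd> ract Q)"
  unfolding bimodule_tensor_eq fst_conv snd_conv
  using quot_left_action(4)[OF admissible_pair refl] quot_bimodule_right(4)[OF admissible_pair refl]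
  by simp_all

lemma bimodule_quot_coeq:
  "is_coequalizer C (ract P \<lhd> carrier Q) (carrier P \<rhd> lact Q) (bimodule_quot P Q)"
  using bimodule_quot_coequalizer[OF admissible_pair] .

lemma bimodule_quot_coeq_whisker:
  "M \<in> Obj C \<Longrightarrow> is_coequalizer C (M \<rhd> (ract P \<lhd> carrier Q)) (M \<rhd> (carrier P \<rhd> lact Q))
    (M \<rhd> bimodule_quot P Q)"
  using bimodule_quot_stable[OF admissible_pair] .

lemma bimodule_quot_balanced:
  "bimodule_quot P Q \<cdot> (carrier P \<rhd> lact Q) = bimodule_quot P Q \<cdot> (ract P \<lhd> carrier Q)"
  using coequalizer_typing(7)[OF bimodule_quot_coeq] .

text \<open>Left whiskering is covered by robustness of \<open>Q\<close>, right whiskering by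
  coflatness of \<open>N\<close>; for both at once, coflatness is applied to the coequalizer given
  by robustness.\<close>

lemma bimodule_quot_epi:
  shows "epi (bimodule_quot P Q)"
    and "M \<in> Obj C \<Longrightarrow> epi (M \<rhd> bimodule_quot P Q)"
    and "\<lbrakk>N \<in> Obj C; left_coflat C N\<rbrakk> \<Longrightarrow> epi (bimodule_quot P Q \<lhd> N)"
    and "\<lbrakk>M \<in> Obj C; N \<in> Obj C; left_coflat C N\<rbrakk> \<Longrightarrow> epi (M \<rhd> (bimodule_quot P Q \<lhd> N))"
proof -
  show "epi (bimodule_quot P Q)"
    using coequalizer_epi[OF bimodule_quot_coeq] .
  show "epi (M \<rhd> bimodule_quot P Q)" if "M \<in> Obj C"
    using coequalizer_epi[OF bimodule_quot_coeq_whisker[OF that]] .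
  show "epi (bimodule_quot P Q \<lhd> N)" if "N \<in> Obj C" "left_coflat C N"
    using coequalizer_coflat[OF bimodule_quot_coeq that(2)] .
  show "epi (M \<rhd> (bimodule_quot P Q \<lhd> N))" if "M \<in> Obj C" "N \<in> Obj C" "left_coflat C N"
    using coequalizer_coflat[OF bimodule_quot_coeq_whisker[OF that(1)] that(3)] that P Q by simp
qed

end

section \<open>Bimodule morphisms and their tensor product\<close>

definition bimod_hom :: "'a \<times> 'b \<times> 'b \<Rightarrow> 'b \<Rightarrow> 'a \<times> 'b \<times> 'b \<Rightarrow> bool"
  where "bimod_hom P f Q \<longleftrightarrow> admissible P \<and> admissible Q \<and> bimodule_mor P f Q"

lemma bimod_hom_iff:
  "bimod_hom P f Q \<longleftrightarrow> admissible P \<and> admissible Q \<and> f \<in> Arr C \<and>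
    Dom C f = carrier P \<and> Cod C f = carrier Q \<and>
    f \<cdot> lact P = lact Q \<cdot> (A \<rhd> f) \<and> f \<cdot> ract P = ract Q \<cdot> (f \<lhd> A)"
  by (auto simp: bimod_hom_def bimodule_mor_def split_beta in_Hom_iff)

lemma bimod_homD:
  assumes "bimod_hom P f Q"
  shows "admissible P" "admissible Q" "f \<in> Arr C" "Dom C f = carrier P" "Cod C f = carrier Q"
    "f \<cdot> lact P = lact Q \<cdot> (A \<rhd> f)" "f \<cdot> ract P = ract Q \<cdot> (f \<lhd> A)"
  using assms by (simp_all add: bimod_hom_iff)

lemma bimod_hom_Ident: "admissible P \<Longrightarrow> bimod_hom P (Ident C (carrier P)) P"
  by (simp add: bimod_hom_iff)

lemma bimod_hom_Comp:
  assumes "bimod_hom P f Q" "bimod_hom Q g R"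
  shows "bimod_hom P (g \<cdot> f) R"
proof -
  note f = bimod_homD[OF assms(1)] and g = bimod_homD[OF assms(2)]
  note [simp] = f(1-5) g(1-5)
  show ?thesis
    by (simp add: bimod_hom_iff f(6,7) g(6,7)[THEN Comp_tail])
qed

text \<open>Inserting \<open>f \<cdot> g\<close> tensored with \<open>A\<close> and using linearity
  of \<open>f\<close> shows that \<open>g\<close> is linear. Isomorphisms of bimodules can therefore
  be recognized in \<open>C\<close>.\<close>

lemma bimod_hom_inverse:
  assumes "bimod_hom P f Q" "is_iso C f"
  obtains g where "bimod_hom Q g P" "g \<cdot> f = Ident C (carrier P)" "f \<cdot> g = Ident C (carrier Q)"
proof -
  note f = bimod_homD[OF assms(1)]
  note [simp] = f(1-5)
  obtain g where g [simp]: "g \<in> Arr C" "Dom C g = carrier Q" "Cod C g = carrier P"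
    and gf: "g \<cdot> f = Ident C (carrier P)" and fg: "f \<cdot> g = Ident C (carrier Q)"
    using isoE[OF assms(2)] f(4,5) by metis
  have w: "(A \<rhd> f) \<cdot> (A \<rhd> g) = Ident C (A \<otimes> carrier Q)" "(f \<lhd> A) \<cdot> (g \<lhd> A) = Ident C (carrier Q \<otimes> A)"
    using arg_cong[OF fg, of "\<lambda>h. A \<rhd> h"] arg_cong[OF fg, of "\<lambda>h. h \<lhd> A"] by simp_all
  have "g \<cdot> lact Q = g \<cdot> (f \<cdot> lact P) \<cdot> (A \<rhd> g)"
    unfolding f(6) by (simp add: w)
  also have "\<dots> = lact P \<cdot> (A \<rhd> g)"
    by (simp add: gf[THEN Comp_tail])
  finally have l: "g \<cdot> lact Q = lact P \<cdot> (A \<rhd> g)" .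
  have "g \<cdot> ract Q = g \<cdot> (f \<cdot> ract P) \<cdot> (g \<lhd> A)"
    unfolding f(7) by (simp add: w)
  also have "\<dots> = ract P \<cdot> (g \<lhd> A)"
    by (simp add: gf[THEN Comp_tail])
  finally have "bimod_hom Q g P"
    using l by (simp add: bimod_hom_iff)
  then show ?thesis
    using gf fg that by blast
qed

definition tensor_hom ::
  "'a \<times> 'b \<times> 'b \<Rightarrow> 'a \<times> 'b \<times> 'b \<Rightarrow> 'a \<times> 'b \<times> 'b \<Rightarrow> 'a \<times> 'b \<times> 'b \<Rightarrow> 'b \<Rightarrow> 'b \<Rightarrow> 'b"
  where "tensor_hom P P' Q Q' f g = factor C (bimodule_quot P Q) (bimodule_quot P' Q' \<cdot> (f \<odot> g))"

context
  fixes P P' Q Q' f g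
  assumes f: "bimod_hom P f P'" and g: "bimod_hom Q g Q'"
begin

lemma tensor_hom_simps:
  "tensor_hom P P' Q Q' f g \<in> Arr C"
  "Dom C (tensor_hom P P' Q Q' f g) = carrier (bimodule_tensor P Q)"
  "Cod C (tensor_hom P P' Q Q' f g) = carrier (bimodule_tensor P' Q')"
  "tensor_hom P P' Q Q' f g \<cdot> bimodule_quot P Q = bimodule_quot P' Q' \<cdot> (f \<odot> g)"
proof -
  note f' = bimod_homD[OF f] and g' = bimod_homD[OF g]
  note [simp] = f'(1-5) g'(1-5)
  \<comment> \<open>The factor \<open>f \<lhd> A\<close> has to stay bracketed for interchange with
    \<open>ract P'\<close>, hence associativity of the tensor is switched off.\<close>
  have "(f \<odot> g) \<cdot> (ract P \<lhd> carrier Q) = (ract P' \<lhd> carrier Q') \<cdot> ((f \<lhd> A) \<odot> g)"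
    by (simp add: interchange f'(7) del: TensorA_assoc)
  moreover have "(f \<odot> g) \<cdot> (carrier P \<rhd> lact Q) = (carrier P' \<rhd> lact Q') \<cdot> (f \<odot> (A \<rhd> g))"
    by (simp add: interchange g'(6))
  ultimately have h: "(bimodule_quot P' Q' \<cdot> (f \<odot> g)) \<cdot> (ract P \<lhd> carrier Q) =
    (bimodule_quot P' Q' \<cdot> (f \<odot> g)) \<cdot> (carrier P \<rhd> lact Q)"
    by (simp add: bimodule_quot_balanced[THEN Comp_tail])
  note F = coequalizer_factor[OF bimodule_quot_coeq _ _ h]
  show "tensor_hom P P' Q Q' f g \<in> Arr C"
    "Dom C (tensor_hom P P' Q Q' f g) = carrier (bimodule_tensor P Q)"
    "Cod C (tensor_hom P P' Q Q' f g) = carrier (bimodule_tensor P' Q')"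
    "tensor_hom P P' Q Q' f g \<cdot> bimodule_quot P Q = bimodule_quot P' Q' \<cdot> (f \<odot> g)"
    using F unfolding tensor_hom_def by simp_all
qed

lemma bimod_hom_tensor:
  "bimod_hom (bimodule_tensor P Q) (tensor_hom P P' Q Q' f g) (bimodule_tensor P' Q')"
proof -
  note f' = bimod_homD[OF f] and g' = bimod_homD[OF g]
  note [simp] = f'(1-5) g'(1-5) tensor_hom_simps(1-3)
  let ?t = "tensor_hom P P' Q Q' f g"
  note E = tensor_hom_simps(4) tensor_actions[OF f'(1) g'(1)] tensor_actions[OF f'(2) g'(2)]
  note E' = E E[THEN Comp_tail]
  have w: "(A \<rhd> ?t) \<cdot> (A \<rhd> bimodule_quot P Q) = (A \<rhd> bimodule_quot P' Q') \<cdot> (A \<rhd> (f \<odot> g))"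
    "(?t \<lhd> A) \<cdot> (bimodule_quot P Q \<lhd> A) = (bimodule_quot P' Q' \<lhd> A) \<cdot> (f \<odot> (g \<lhd> A))"
    using arg_cong[OF E(1), of "\<lambda>f. A \<rhd> f"] arg_cong[OF E(1), of "\<lambda>f. f \<lhd> A"] by simp_all
  have "(f \<odot> g) \<cdot> (lact P \<lhd> carrier Q) = (lact P' \<lhd> carrier Q') \<cdot> ((A \<rhd> f) \<odot> g)"
    by (simp add: interchange f'(6) del: TensorA_assoc)
  then have c: "(f \<odot> g) \<cdot> (lact P \<lhd> carrier Q) = (lact P' \<lhd> carrier Q') \<cdot> (A \<rhd> (f \<odot> g))"
    by simp
  have d: "(f \<odot> g) \<cdot> (carrier P \<rhd> ract Q) = (carrier P' \<rhd> ract Q') \<cdot> (f \<odot> (g \<lhd> A))"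
    by (simp add: interchange g'(7))
  have "?t \<cdot> lact (bimodule_tensor P Q) = lact (bimodule_tensor P' Q') \<cdot> (A \<rhd> ?t)"
    by (rule epiD[OF bimodule_quot_epi(2)[of P Q A]]) (simp_all add: E' w c)
  moreover have "?t \<cdot> ract (bimodule_tensor P Q) = ract (bimodule_tensor P' Q') \<cdot> (?t \<lhd> A)"
    by (rule epiD[OF bimodule_quot_epi(3)[of P Q A]]) (simp_all add: E' w d)
  ultimately show ?thesis
    by (simp add: bimod_hom_iff)
qed

end

lemma tensor_hom_eqI:
  assumes "admissible P" "admissible Q" "k \<in> Arr C" "Dom C k = carrier (bimodule_tensor P Q)"
    and "k \<cdot> bimodule_quot P Q = bimodule_quot P' Q' \<cdot> (f \<odot> g)"
  shows "tensor_hom P P' Q Q' f g = k"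
  unfolding tensor_hom_def
  by (rule factor_eqI[OF bimodule_quot_epi(1)[OF assms(1,2)]])
    (use assms in simp_all)

lemma tensor_hom_Ident:
  "\<lbrakk>admissible P; admissible Q\<rbrakk> \<Longrightarrow>
    tensor_hom P P Q Q (Ident C (carrier P)) (Ident C (carrier Q)) =
    Ident C (carrier (bimodule_tensor P Q))"
  by (rule tensor_hom_eqI) simp_all

lemma tensor_hom_Comp:
  assumes f: "bimod_hom P f P'" "bimod_hom P' f' P''" and g: "bimod_hom Q g Q'" "bimod_hom Q' g' Q''"
  shows "tensor_hom P P'' Q Q'' (f' \<cdot> f) (g' \<cdot> g) =
    tensor_hom P' P'' Q' Q'' f' g' \<cdot> tensor_hom P P' Q Q' f g"
proof -
  note [simp] = f[THEN bimod_homD(1)] f[THEN bimod_homD(2)] f[THEN bimod_homD(3)]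
    f[THEN bimod_homD(4)] f[THEN bimod_homD(5)] g[THEN bimod_homD(1)] g[THEN bimod_homD(2)]
    g[THEN bimod_homD(3)] g[THEN bimod_homD(4)] g[THEN bimod_homD(5)]
    tensor_hom_simps(1-3)[OF f(1) g(1)] tensor_hom_simps(1-3)[OF f(2) g(2)]
  note E = tensor_hom_simps(4)[OF f(1) g(1)] tensor_hom_simps(4)[OF f(2) g(2)]
  show ?thesis
    by (rule tensor_hom_eqI) (simp_all add: E E[THEN Comp_tail] interchange)
qed

section \<open>Associativity and unit constraints\<close>

definition assoc_hom :: "'a \<times> 'b \<times> 'b \<Rightarrow> 'a \<times> 'b \<times> 'b \<Rightarrow> 'a \<times> 'b \<times> 'b \<Rightarrow> 'b"
  where "assoc_hom P Q R =
    factor C (bimodule_quot P (bimodule_tensor Q R) \<cdot> (carrier P \<rhd> bimodule_quot Q R))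
      (bimodule_quot (bimodule_tensor P Q) R \<cdot> (bimodule_quot P Q \<lhd> carrier R))"

definition lunit_hom :: "'a \<times> 'b \<times> 'b \<Rightarrow> 'b"
  where "lunit_hom P = factor C (bimodule_quot (A, m, m) P) (lact P)"

definition runit_hom :: "'a \<times> 'b \<times> 'b \<Rightarrow> 'b"
  where "runit_hom P = factor C (bimodule_quot P (A, m, m)) (ract P)"

lemma iterated_quot_epi:
  assumes "admissible P" "admissible Q" "admissible R"
  shows "epi (bimodule_quot P (bimodule_tensor Q R) \<cdot> (carrier P \<rhd> bimodule_quot Q R))"
  by (intro epi_Comp bimodule_quot_epi) (use assms in simp_all)

text \<open>The comparison \<open>p\<close> of iterated quotients and the chosen outer quotient are
  coequalizers of the same pair; the associator is the isomorphism between them.\<close>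

lemma assoc_hom_props:
  assumes P: "admissible P" and Q: "admissible Q" and R: "admissible R"
  shows "assoc_hom P Q R \<in> Arr C"
    "Dom C (assoc_hom P Q R) = carrier (bimodule_tensor P (bimodule_tensor Q R))"
    "Cod C (assoc_hom P Q R) = carrier (bimodule_tensor (bimodule_tensor P Q) R)"
    "assoc_hom P Q R \<cdot> bimodule_quot P (bimodule_tensor Q R) \<cdot> (carrier P \<rhd> bimodule_quot Q R) =
      bimodule_quot (bimodule_tensor P Q) R \<cdot> (bimodule_quot P Q \<lhd> carrier R)"
    "is_iso C (assoc_hom P Q R)"
proof -
  note [simp] = P Q R
  let ?q = "bimodule_quot P (bimodule_tensor Q R)"
  have PQ: "admissible (bimodule_tensor P Q)" and QR: "admissible (bimodule_tensor Q R)"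
    by simp_all
  note hyps = admissible_modules(5)[OF P] admissible_modules(1)[OF Q] admissible_modules(4)[OF R]
    admissible_modules(2)[OF R] bimodule_quot_coeq[OF P Q] bimodule_quot_simps(3)[OF P Q]
    admissible_modules(5)[OF PQ] tensor_actions(2)[OF P Q] bimodule_quot_coeq[OF PQ R]
    bimodule_quot_simps(3)[OF PQ R] bimodule_quot_simps[OF Q R] bimodule_quot_coeq_whisker[OF Q R]
    admissible_modules(4)[OF QR] tensor_actions(1)[OF Q R]
  obtain p where p: "p \<in> Arr C" "Dom C p = carrier P \<otimes> carrier (bimodule_tensor Q R)"
      "Cod C p = carrier (bimodule_tensor (bimodule_tensor P Q) R)"
    and pq: "p \<cdot> (carrier P \<rhd> bimodule_quot Q R) =
      bimodule_quot (bimodule_tensor P Q) R \<cdot> (bimodule_quot P Q \<lhd> carrier R)"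
    using iterated_quot_comparison[OF hyps] by auto
  note c = iterated_quot_coequalizer[OF hyps p(1,2) pq]
  note d = bimodule_quot_coeq[OF P QR]
  have h: "p \<cdot> (ract P \<lhd> carrier (bimodule_tensor Q R)) =
    p \<cdot> (carrier P \<rhd> lact (bimodule_tensor Q R))"
    using coequalizer_typing(7)[OF c] by simp
  note F = coequalizer_factor[OF d _ _ h]
  \<comment> \<open>The inner epi is stripped from the definition: factoring through the composite
    of two quotient maps agrees with factoring \<open>p\<close> through the outer one.\<close>
  have a: "assoc_hom P Q R = factor C ?q p"
    unfolding assoc_hom_def
    by (rule factor_eqI[OF iterated_quot_epi[OF P Q R]])
      (use F p in \<open>simp_all add: pq F(4)[THEN Comp_tail]\<close>)
  show "assoc_hom P Q R \<in> Arr C"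
    "Dom C (assoc_hom P Q R) = carrier (bimodule_tensor P (bimodule_tensor Q R))"
    "Cod C (assoc_hom P Q R) = carrier (bimodule_tensor (bimodule_tensor P Q) R)"
    unfolding a using F p by simp_all
  show "is_iso C (assoc_hom P Q R)"
    unfolding a by (rule coequalizer_factor_iso[OF d c])
  show "assoc_hom P Q R \<cdot> ?q \<cdot> (carrier P \<rhd> bimodule_quot Q R) =
      bimodule_quot (bimodule_tensor P Q) R \<cdot> (bimodule_quot P Q \<lhd> carrier R)"
    unfolding a using F p by (simp add: pq F(4)[THEN Comp_tail])
qed

lemma bimod_hom_assoc:
  assumes P: "admissible P" and Q: "admissible Q" and R: "admissible R"
  shows "bimod_hom (bimodule_tensor P (bimodule_tensor Q R)) (assoc_hom P Q R)
    (bimodule_tensor (bimodule_tensor P Q) R)"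
proof -
  note a = assoc_hom_props[OF P Q R]
  note [simp] = P Q R a(1-3)
  let ?X = "carrier P" and ?Y = "carrier Q" and ?Z = "carrier R"
  let ?PQ = "bimodule_tensor P Q" and ?QR = "bimodule_tensor Q R"
  let ?P_QR = "bimodule_tensor P ?QR" and ?PQ_R = "bimodule_tensor ?PQ R"
  have T: "admissible ?PQ" "admissible ?QR"
    by simp_all
  note E = tensor_actions[OF P T(2)] tensor_actions[OF T(1) R]
  note E' = E E[THEN Comp_tail] a(4) a(4)[THEN Comp_tail3]
  have w: "(A \<rhd> assoc_hom P Q R) \<cdot> (A \<rhd> bimodule_quot P ?QR) \<cdot> ((A \<otimes> ?X) \<rhd> bimodule_quot Q R) =
      (A \<rhd> bimodule_quot ?PQ R) \<cdot> (A \<rhd> (bimodule_quot P Q \<lhd> ?Z))"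
    "(assoc_hom P Q R \<lhd> A) \<cdot> (bimodule_quot P ?QR \<lhd> A) \<cdot> (?X \<rhd> (bimodule_quot Q R \<lhd> A)) =
      (bimodule_quot ?PQ R \<lhd> A) \<cdot> (bimodule_quot P Q \<lhd> (?Z \<otimes> A))"
    "(lact ?PQ \<lhd> ?Z) \<cdot> (A \<rhd> (bimodule_quot P Q \<lhd> ?Z)) =
      (bimodule_quot P Q \<lhd> ?Z) \<cdot> (lact P \<lhd> (?Y \<otimes> ?Z))"
    "(?X \<rhd> ract ?QR) \<cdot> (?X \<rhd> (bimodule_quot Q R \<lhd> A)) =
      (?X \<rhd> bimodule_quot Q R) \<cdot> ((?X \<otimes> ?Y) \<rhd> ract R)"
    using arg_cong[OF a(4), of "\<lambda>f. A \<rhd> f"] arg_cong[OF a(4), of "\<lambda>f. f \<lhd> A"]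
      arg_cong[OF tensor_actions(1)[OF P Q], of "\<lambda>f. f \<lhd> ?Z"]
      arg_cong[OF tensor_actions(2)[OF Q R], of "\<lambda>f. ?X \<rhd> f"] by simp_all
  have s: "(lact P \<lhd> carrier ?QR) \<cdot> ((A \<otimes> ?X) \<rhd> bimodule_quot Q R) =
      (?X \<rhd> bimodule_quot Q R) \<cdot> (lact P \<lhd> (?Y \<otimes> ?Z))"
    "(carrier ?PQ \<rhd> ract R) \<cdot> (bimodule_quot P Q \<lhd> (?Z \<otimes> A)) =
      (bimodule_quot P Q \<lhd> ?Z) \<cdot> ((?X \<otimes> ?Y) \<rhd> ract R)"
    using whisker_exchange[of "lact P" "bimodule_quot Q R"]
      whisker_exchange[of "bimodule_quot P Q" "ract R"] by simp_all
  have "epi ((A \<rhd> bimodule_quot P ?QR) \<cdot> ((A \<otimes> ?X) \<rhd> bimodule_quot Q R))"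
    by (intro epi_Comp bimodule_quot_epi(2)) simp_all
  then have "assoc_hom P Q R \<cdot> lact ?P_QR = lact ?PQ_R \<cdot> (A \<rhd> assoc_hom P Q R)"
    by (rule epiD) (simp_all add: E' w s s[THEN Comp_tail])
  moreover have "epi ((bimodule_quot P ?QR \<lhd> A) \<cdot> (?X \<rhd> (bimodule_quot Q R \<lhd> A)))"
    by (intro epi_Comp bimodule_quot_epi(3,4)) simp_all
  then have "assoc_hom P Q R \<cdot> ract ?P_QR = ract ?PQ_R \<cdot> (assoc_hom P Q R \<lhd> A)"
    by (rule epiD) (simp_all add: E' w s)
  ultimately show ?thesis
    by (simp add: bimod_hom_iff)
qed

text \<open>After the iterated quotient map, both sides are \<open>f \<odot> g \<odot> h\<close>
  followed by the quotient bracketed to the left.\<close>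

lemma assoc_hom_natural:
  assumes f: "bimod_hom P f P'" and g: "bimod_hom Q g Q'" and h: "bimod_hom R h R'"
  shows "assoc_hom P' Q' R' \<cdot>
      tensor_hom P P' (bimodule_tensor Q R) (bimodule_tensor Q' R') f (tensor_hom Q Q' R R' g h) =
    tensor_hom (bimodule_tensor P Q) (bimodule_tensor P' Q') R R' (tensor_hom P P' Q Q' f g) h \<cdot>
      assoc_hom P Q R"
proof -
  note f' = bimod_homD[OF f] and g' = bimod_homD[OF g] and h' = bimod_homD[OF h]
  note gh = bimod_hom_tensor[OF g h] and fg = bimod_hom_tensor[OF f g]
  note a = assoc_hom_props[OF f'(1) g'(1) h'(1)] assoc_hom_props[OF f'(2) g'(2) h'(2)]
  note [simp] = f'(1-5) g'(1-5) h'(1-5) a(1-3,6-8) tensor_hom_simps(1-3)[OF f g]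
    tensor_hom_simps(1-3)[OF g h] tensor_hom_simps(1-3)[OF f gh] tensor_hom_simps(1-3)[OF fg h]
  note E = tensor_hom_simps(4)[OF f gh] tensor_hom_simps(4)[OF fg h]
  note E' = E E[THEN Comp_tail] a(4,9) a(4,9)[THEN Comp_tail3]
  have "(f \<odot> tensor_hom Q Q' R R' g h) \<cdot> (carrier P \<rhd> bimodule_quot Q R) =
      (carrier P' \<rhd> bimodule_quot Q' R') \<cdot> (f \<odot> (g \<odot> h))"
    by (simp add: interchange tensor_hom_simps(4)[OF g h])
  moreover have "(tensor_hom P P' Q Q' f g \<odot> h) \<cdot> (bimodule_quot P Q \<lhd> carrier R) =
      (bimodule_quot P' Q' \<lhd> carrier R') \<cdot> ((f \<odot> g) \<odot> h)"
    by (simp add: interchange tensor_hom_simps(4)[OF f g] del: TensorA_assoc)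
  ultimately show ?thesis
    by - (rule epiD[OF iterated_quot_epi[OF f'(1) g'(1) h'(1)]], simp_all add: E')
qed

text \<open>On the fourfold tensor product in \<open>C\<close> each associator only changes the
  bracketing of the quotient maps, so both sides become the quotient bracketed fully to the left.
  The one further ingredient is \<open>s\<close>: the quotients of the first two and of the last two
  factors commute.\<close>

lemma assoc_hom_pentagon:
  assumes S: "admissible S" and P: "admissible P" and Q: "admissible Q" and R: "admissible R"
  shows "assoc_hom (bimodule_tensor S P) Q R \<cdot> assoc_hom S P (bimodule_tensor Q R) =
    tensor_hom (bimodule_tensor S (bimodule_tensor P Q)) (bimodule_tensor (bimodule_tensor S P) Q) R R
      (assoc_hom S P Q) (Ident C (carrier R)) \<cdot>
    assoc_hom S (bimodule_tensor P Q) R \<cdot>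
    tensor_hom S S (bimodule_tensor P (bimodule_tensor Q R)) (bimodule_tensor (bimodule_tensor P Q) R)
      (Ident C (carrier S)) (assoc_hom P Q R)"
proof -
  let ?SP = "bimodule_tensor S P" and ?PQ = "bimodule_tensor P Q" and ?QR = "bimodule_tensor Q R"
  let ?W = "carrier S" and ?X = "carrier P" and ?Y = "carrier Q" and ?Z = "carrier R"
  note [simp] = S P Q R
  have T: "admissible ?SP" "admissible ?PQ" "admissible ?QR"
    by simp_all
  note a = assoc_hom_props[OF T(1) Q R] assoc_hom_props[OF S P T(3)] assoc_hom_props[OF S P Q]
    assoc_hom_props[OF S T(2) R] assoc_hom_props[OF P Q R]
  note h1 = bimod_hom_assoc[OF S P Q] bimod_hom_Ident[OF R]
  note h2 = bimod_hom_Ident[OF S] bimod_hom_assoc[OF P Q R]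
  note [simp] = a(1-3,6-8,11-13,16-18,21-23) tensor_hom_simps(1-3)[OF h1] tensor_hom_simps(1-3)[OF h2]
  note E = tensor_hom_simps(4)[OF h1] tensor_hom_simps(4)[OF h2]
  note E' = E E[THEN Comp_tail] a(4,9,19) a(4,9,19)[THEN Comp_tail3]
  have w: "(?W \<rhd> assoc_hom P Q R) \<cdot> (?W \<rhd> bimodule_quot P ?QR) \<cdot> ((?W \<otimes> ?X) \<rhd> bimodule_quot Q R) =
      (?W \<rhd> bimodule_quot ?PQ R) \<cdot> (?W \<rhd> (bimodule_quot P Q \<lhd> ?Z))"
    "(assoc_hom S P Q \<lhd> ?Z) \<cdot> (bimodule_quot S ?PQ \<lhd> ?Z) \<cdot> (?W \<rhd> (bimodule_quot P Q \<lhd> ?Z)) =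
      (bimodule_quot ?SP Q \<lhd> ?Z) \<cdot> (bimodule_quot S P \<lhd> (?Y \<otimes> ?Z))"
    using arg_cong[OF a(24), of "\<lambda>f. ?W \<rhd> f"] arg_cong[OF a(14), of "\<lambda>f. f \<lhd> ?Z"] by simp_all
  have s: "(bimodule_quot S P \<lhd> carrier ?QR) \<cdot> ((?W \<otimes> ?X) \<rhd> bimodule_quot Q R) =
      (carrier ?SP \<rhd> bimodule_quot Q R) \<cdot> (bimodule_quot S P \<lhd> (?Y \<otimes> ?Z))"
    using whisker_exchange[of "bimodule_quot S P" "bimodule_quot Q R"] by simp
  have "epi (bimodule_quot S (bimodule_tensor P ?QR) \<cdot> (?W \<rhd> bimodule_quot P ?QR) \<cdot>
      ((?W \<otimes> ?X) \<rhd> bimodule_quot Q R))"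
    by (intro epi_Comp bimodule_quot_epi(1,2)) simp_all
  then show ?thesis
    by (rule epiD) (simp_all add: E' w s)
qed

text \<open>The chosen quotient and the left action of \<open>P\<close> are coequalizers of the same
  pair.\<close>

lemma lunit_hom_props:
  assumes P: "admissible P"
  shows "lunit_hom P \<in> Arr C" "Dom C (lunit_hom P) = carrier (bimodule_tensor (A, m, m) P)"
    "Cod C (lunit_hom P) = carrier P" "lunit_hom P \<cdot> bimodule_quot (A, m, m) P = lact P"
    "is_iso C (lunit_hom P)"
proof -
  note [simp] = P
  note q = bimodule_quot_coeq[OF admissible_regular P]
  note n = left_action_coequalizer[OF admissible_modules(4)[OF P]]
  have h: "lact P \<cdot> (m \<lhd> carrier P) = lact P \<cdot> (A \<rhd> lact P)"
    using coequalizer_typing(7)[OF n] by simp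
  note F = coequalizer_factor[OF q, of "lact P", unfolded fst_conv snd_conv, OF _ _ h]
  show "lunit_hom P \<in> Arr C" "Dom C (lunit_hom P) = carrier (bimodule_tensor (A, m, m) P)"
    "Cod C (lunit_hom P) = carrier P" "lunit_hom P \<cdot> bimodule_quot (A, m, m) P = lact P"
    using F unfolding lunit_hom_def by simp_all
  show "is_iso C (lunit_hom P)"
    unfolding lunit_hom_def using coequalizer_factor_iso[OF q] n by simp
qed

lemma runit_hom_props:
  assumes P: "admissible P"
  shows "runit_hom P \<in> Arr C" "Dom C (runit_hom P) = carrier (bimodule_tensor P (A, m, m))"
    "Cod C (runit_hom P) = carrier P" "runit_hom P \<cdot> bimodule_quot P (A, m, m) = ract P"
    "is_iso C (runit_hom P)"
proof -
  note [simp] = P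
  note q = bimodule_quot_coeq[OF P admissible_regular]
  have n: "is_coequalizer C (ract P \<lhd> A) (carrier P \<rhd> m) (ract P)"
    using right_action_coequalizer[OF admissible_modules(5)[OF P] UnitO_Obj] by simp
  have h: "ract P \<cdot> (ract P \<lhd> A) = ract P \<cdot> (carrier P \<rhd> m)"
    using coequalizer_typing(7)[OF n] by simp
  note F = coequalizer_factor[OF q, of "ract P", unfolded fst_conv snd_conv, OF _ _ h]
  show "runit_hom P \<in> Arr C" "Dom C (runit_hom P) = carrier (bimodule_tensor P (A, m, m))"
    "Cod C (runit_hom P) = carrier P" "runit_hom P \<cdot> bimodule_quot P (A, m, m) = ract P"
    using F unfolding runit_hom_def by simp_all
  show "is_iso C (runit_hom P)"
    unfolding runit_hom_def using coequalizer_factor_iso[OF q] n by simp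
qed

text \<open>Left linearity is associativity of the left action, right linearity is compatibility of
  the two actions. For \<open>runit_hom\<close> the roles are exchanged.\<close>

lemma bimod_hom_lunit:
  assumes P: "admissible P"
  shows "bimod_hom (bimodule_tensor (A, m, m) P) (lunit_hom P) P"
proof -
  note u = lunit_hom_props[OF P]
  note [simp] = P u(1-3)
  let ?q = "bimodule_quot (A, m, m) P" and ?T = "bimodule_tensor (A, m, m) P"
  note E = u(4) tensor_actions[OF admissible_regular P, unfolded fst_conv snd_conv]
  note E' = E E[THEN Comp_tail]
  have w: "(A \<rhd> lunit_hom P) \<cdot> (A \<rhd> ?q) = A \<rhd> lact P" "(lunit_hom P \<lhd> A) \<cdot> (?q \<lhd> A) = lact P \<lhd> A"
    using arg_cong[OF u(4), of "\<lambda>f. A \<rhd> f"] arg_cong[OF u(4), of "\<lambda>f. f \<lhd> A"] by simp_all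
  note l = left_module_eqs(1)[OF admissible_modules(4)[OF P]]
  note b = bimodule_compat[OF admissible_modules(1)[OF P]]
  have "lunit_hom P \<cdot> lact ?T = lact P \<cdot> (A \<rhd> lunit_hom P)"
    by (rule epiD[OF bimodule_quot_epi(2)[OF admissible_regular P algebra_typing(1)]])
      (simp_all add: E' w l)
  moreover have "lunit_hom P \<cdot> ract ?T = ract P \<cdot> (lunit_hom P \<lhd> A)"
    by (rule epiD[OF bimodule_quot_epi(3)[OF admissible_regular P algebra_typing(1) A_coflat]])
      (simp_all add: E' w b)
  ultimately show ?thesis
    by (simp add: bimod_hom_iff)
qed

lemma bimod_hom_runit:
  assumes P: "admissible P"
  shows "bimod_hom (bimodule_tensor P (A, m, m)) (runit_hom P) P"
proof -
  note u = runit_hom_props[OF P]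
  note [simp] = P u(1-3)
  let ?q = "bimodule_quot P (A, m, m)" and ?T = "bimodule_tensor P (A, m, m)"
  note E = u(4) tensor_actions[OF P admissible_regular, unfolded fst_conv snd_conv]
  note E' = E E[THEN Comp_tail]
  have w: "(A \<rhd> runit_hom P) \<cdot> (A \<rhd> ?q) = A \<rhd> ract P" "(runit_hom P \<lhd> A) \<cdot> (?q \<lhd> A) = ract P \<lhd> A"
    using arg_cong[OF u(4), of "\<lambda>f. A \<rhd> f"] arg_cong[OF u(4), of "\<lambda>f. f \<lhd> A"] by simp_all
  note l = right_module_eqs(1)[OF admissible_modules(5)[OF P]]
  note b = bimodule_compat[OF admissible_modules(1)[OF P]]
  have "runit_hom P \<cdot> lact ?T = lact P \<cdot> (A \<rhd> runit_hom P)"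
    by (rule epiD[OF bimodule_quot_epi(2)[OF P admissible_regular algebra_typing(1)]])
      (simp_all add: E' w b)
  moreover have "runit_hom P \<cdot> ract ?T = ract P \<cdot> (runit_hom P \<lhd> A)"
    by (rule epiD[OF bimodule_quot_epi(3)[OF P admissible_regular algebra_typing(1) A_coflat]])
      (simp_all add: E' w l)
  ultimately show ?thesis
    by (simp add: bimod_hom_iff)
qed

lemma lunit_hom_natural:
  assumes f: "bimod_hom P f P'"
  shows "lunit_hom P' \<cdot> tensor_hom (A, m, m) (A, m, m) P P' (Ident C A) f = f \<cdot> lunit_hom P"
proof -
  note f' = bimod_homD[OF f]
  have i: "bimod_hom (A, m, m) (Ident C A) (A, m, m)"
    using bimod_hom_Ident[OF admissible_regular] by simp
  note u = lunit_hom_props[OF f'(1)] lunit_hom_props[OF f'(2)]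
  note t = tensor_hom_simps[OF i f]
  note [simp] = f'(1-5) u(1-3,6-8) t(1-3)
  note E = u(4,9) t(4) f'(6)
  show ?thesis
    by (rule epiD[OF bimodule_quot_epi(1)[OF admissible_regular f'(1)]])
      (simp_all add: E E[THEN Comp_tail])
qed

lemma runit_hom_natural:
  assumes f: "bimod_hom P f P'"
  shows "runit_hom P' \<cdot> tensor_hom P P' (A, m, m) (A, m, m) f (Ident C A) = f \<cdot> runit_hom P"
proof -
  note f' = bimod_homD[OF f]
  have i: "bimod_hom (A, m, m) (Ident C A) (A, m, m)"
    using bimod_hom_Ident[OF admissible_regular] by simp
  note u = runit_hom_props[OF f'(1)] runit_hom_props[OF f'(2)]
  note t = tensor_hom_simps[OF f i]
  note [simp] = f'(1-5) u(1-3,6-8) t(1-3)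
  note E = u(4,9) t(4) f'(7)
  show ?thesis
    by (rule epiD[OF bimodule_quot_epi(1)[OF f'(1) admissible_regular]])
      (simp_all add: E E[THEN Comp_tail])
qed

text \<open>Once the quotient maps are removed, the sides are the right action of \<open>P\<close>
  and the left action of \<open>Q\<close>, each followed by the quotient of \<open>P\<close> and
  \<open>Q\<close>. The triangle is thus the defining relation of that quotient.\<close>

lemma unit_triangle:
  assumes P: "admissible P" and Q: "admissible Q"
  shows "tensor_hom (bimodule_tensor P (A, m, m)) P Q Q (runit_hom P) (Ident C (carrier Q)) \<cdot>
      assoc_hom P (A, m, m) Q =
    tensor_hom P P (bimodule_tensor (A, m, m) Q) Q (Ident C (carrier P)) (lunit_hom Q)"
proof -
  note a = assoc_hom_props[OF P admissible_regular Q]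
  note u = runit_hom_props[OF P] lunit_hom_props[OF Q]
  note t = tensor_hom_simps[OF bimod_hom_runit[OF P] bimod_hom_Ident[OF Q]]
    tensor_hom_simps[OF bimod_hom_Ident[OF P] bimod_hom_lunit[OF Q]]
  note [simp] = P Q a(1-3) u(1-3,6-8) t(1-3,5-7)
  note E = t(4,8)
  have w: "(runit_hom P \<lhd> carrier Q) \<cdot> (bimodule_quot P (A, m, m) \<lhd> carrier Q) = ract P \<lhd> carrier Q"
    "(carrier P \<rhd> lunit_hom Q) \<cdot> (carrier P \<rhd> bimodule_quot (A, m, m) Q) = carrier P \<rhd> lact Q"
    using arg_cong[OF u(4), of "\<lambda>f. f \<lhd> carrier Q"] arg_cong[OF u(9), of "\<lambda>f. carrier P \<rhd> f"]
    by simp_all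
  show ?thesis
    by (rule epiD[OF iterated_quot_epi[OF P admissible_regular Q]])
      (simp_all add: E E[THEN Comp_tail] a(4) a(4)[THEN Comp_tail3] w bimodule_quot_balanced)
qed

end

section \<open>Assembly of the monoidal category of bimodules\<close>

lemma full_subcategory_simps:
  "Obj (full_subcategory C P) = {X \<in> Obj C. P X}"
  "Arr (full_subcategory C P) = {f \<in> Arr C. P (Dom C f) \<and> P (Cod C f)}"
  "Dom (full_subcategory C P) = Dom C" "Cod (full_subcategory C P) = Cod C"
  "Ident (full_subcategory C P) = Ident C" "Comp (full_subcategory C P) = Comp C"
  by (simp_all add: full_subcategory_def)

lemma full_subcategory_moncat_simps:
  fixes C :: "('o, 'a, 'z) moncat_scheme"
  shows "TensorO (full_subcategory C P) = TensorO C" "TensorA (full_subcategory C P) = TensorA C"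
    "UnitO (full_subcategory C P) = UnitO C" "Assoc (full_subcategory C P) = Assoc C"
    "LUnit (full_subcategory C P) = LUnit C" "RUnit (full_subcategory C P) = RUnit C"
  by (simp_all add: full_subcategory_def)

context coflat_algebra
begin

lemma bimodule_cat_simps:
  "Obj coflat_robust_bimodule_cat = {P. admissible P}"
  "Arr coflat_robust_bimodule_cat = {(P, f, Q). bimod_hom P f Q}"
  "Dom coflat_robust_bimodule_cat (P, f, Q) = P"
  "Cod coflat_robust_bimodule_cat (P, f, Q) = Q"
  "Ident coflat_robust_bimodule_cat P = (P, Ident C (carrier P), P)"
  "Comp coflat_robust_bimodule_cat (Q', g, R) (P, f, Q) = (P, g \<cdot> f, R)"
  "TensorO coflat_robust_bimodule_cat = bimodule_tensor"
  "TensorA coflat_robust_bimodule_cat (P, f, P') (Q, g, Q') =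
    (bimodule_tensor P Q, tensor_hom P P' Q Q' f g, bimodule_tensor P' Q')"
  "UnitO coflat_robust_bimodule_cat = (A, m, m)"
  "Assoc coflat_robust_bimodule_cat P Q R = (bimodule_tensor P (bimodule_tensor Q R),
    assoc_hom P Q R, bimodule_tensor (bimodule_tensor P Q) R)"
  "LUnit coflat_robust_bimodule_cat P = (bimodule_tensor (A, m, m) P, lunit_hom P, P)"
  "RUnit coflat_robust_bimodule_cat P = (bimodule_tensor P (A, m, m), runit_hom P, P)"
  unfolding coflat_robust_bimodule_cat_def full_subcategory_simps full_subcategory_moncat_simps
  by (auto simp: bimodule_cat_def admissible_def bimod_hom_def tensor_hom_def assoc_hom_def
    lunit_hom_def runit_hom_def bimodule_quot_eq split_beta)

lemma bimodule_cat_Hom: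
  "F \<in> Hom\<^bsub>coflat_robust_bimodule_cat\<^esub> P Q \<longleftrightarrow> (\<exists>f. F = (P, f, Q) \<and> bimod_hom P f Q)"
  by (cases F) (auto simp: in_Hom_iff bimodule_cat_simps)

lemma bimodule_cat_iso:
  assumes "bimod_hom P f Q" "is_iso C f"
  shows "is_iso coflat_robust_bimodule_cat (P, f, Q)"
proof -
  obtain g where g: "bimod_hom Q g P" "g \<cdot> f = Ident C (carrier P)" "f \<cdot> g = Ident C (carrier Q)"
    using bimod_hom_inverse[OF assms] .
  have "(Q, g, P) \<in> Hom\<^bsub>coflat_robust_bimodule_cat\<^esub> Q P"
    using g(1) by (simp add: bimodule_cat_Hom)
  then show ?thesis
    using assms(1) g(2,3) unfolding is_iso_def
    by (auto simp: bimodule_cat_simps intro!: bexI[of _ "(Q, g, P)"])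
qed

lemma coflat_robust_bimodule_monoidal_category: "monoidal_category coflat_robust_bimodule_cat"
proof
  note D = bimodule_cat_simps bimodule_cat_Hom
  fix P Q R S P' P'' Q' Q'' R' F G H F' G'
  let ?D = coflat_robust_bimodule_cat
  show "Dom ?D F \<in> Obj ?D" "Cod ?D F \<in> Obj ?D" if "F \<in> Arr ?D"
    using that by (auto simp: D dest: bimod_homD)
  show "Ident ?D P \<in> Hom\<^bsub>?D\<^esub> P P" if "P \<in> Obj ?D"
    using that by (auto simp: D bimod_hom_Ident)
  show "G \<cdot>\<^bsub>?D\<^esub> F \<in> Hom\<^bsub>?D\<^esub> P R" if "F \<in> Hom\<^bsub>?D\<^esub> P Q" "G \<in> Hom\<^bsub>?D\<^esub> Q R"
    using that by (auto simp: D intro: bimod_hom_Comp)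
  show "F \<cdot>\<^bsub>?D\<^esub> Ident ?D P = F" "Ident ?D Q \<cdot>\<^bsub>?D\<^esub> F = F" if "F \<in> Hom\<^bsub>?D\<^esub> P Q"
    using that by (auto simp: D bimod_hom_iff)
  show "(H \<cdot>\<^bsub>?D\<^esub> G) \<cdot>\<^bsub>?D\<^esub> F = H \<cdot>\<^bsub>?D\<^esub> (G \<cdot>\<^bsub>?D\<^esub> F)"
    if "F \<in> Hom\<^bsub>?D\<^esub> P Q" "G \<in> Hom\<^bsub>?D\<^esub> Q R" "H \<in> Hom\<^bsub>?D\<^esub> R S"
    using that by (auto simp: D bimod_hom_iff)
  show "\<one>\<^bsub>?D\<^esub> \<in> Obj ?D"
    by (simp add: D)
  show "P \<otimes>\<^bsub>?D\<^esub> Q \<in> Obj ?D" if "P \<in> Obj ?D" "Q \<in> Obj ?D"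
    using that by (simp add: D)
  show "F \<odot>\<^bsub>?D\<^esub> G \<in> Hom\<^bsub>?D\<^esub> (P \<otimes>\<^bsub>?D\<^esub> Q) (P' \<otimes>\<^bsub>?D\<^esub> Q')"
    if "F \<in> Hom\<^bsub>?D\<^esub> P P'" "G \<in> Hom\<^bsub>?D\<^esub> Q Q'"
    using that by (auto simp: D intro: bimod_hom_tensor)
  show "Ident ?D P \<odot>\<^bsub>?D\<^esub> Ident ?D Q = Ident ?D (P \<otimes>\<^bsub>?D\<^esub> Q)" if "P \<in> Obj ?D" "Q \<in> Obj ?D"
    using that by (simp add: D tensor_hom_Ident)
  show "(F' \<cdot>\<^bsub>?D\<^esub> F) \<odot>\<^bsub>?D\<^esub> (G' \<cdot>\<^bsub>?D\<^esub> G) = (F' \<odot>\<^bsub>?D\<^esub> G') \<cdot>\<^bsub>?D\<^esub> (F \<odot>\<^bsub>?D\<^esub> G)"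
    if "F \<in> Hom\<^bsub>?D\<^esub> P P'" "F' \<in> Hom\<^bsub>?D\<^esub> P' P''" "G \<in> Hom\<^bsub>?D\<^esub> Q Q'" "G' \<in> Hom\<^bsub>?D\<^esub> Q' Q''"
    using that by (auto simp: D tensor_hom_Comp)
  show "Assoc ?D P Q R \<in> Hom\<^bsub>?D\<^esub> (P \<otimes>\<^bsub>?D\<^esub> (Q \<otimes>\<^bsub>?D\<^esub> R)) ((P \<otimes>\<^bsub>?D\<^esub> Q) \<otimes>\<^bsub>?D\<^esub> R)"
    "is_iso ?D (Assoc ?D P Q R)"
    if "P \<in> Obj ?D" "Q \<in> Obj ?D" "R \<in> Obj ?D"
    using that by (auto simp: D intro!: bimod_hom_assoc bimodule_cat_iso assoc_hom_props)
  show "Assoc ?D P' Q' R' \<cdot>\<^bsub>?D\<^esub> (F \<odot>\<^bsub>?D\<^esub> (G \<odot>\<^bsub>?D\<^esub> H)) =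
      ((F \<odot>\<^bsub>?D\<^esub> G) \<odot>\<^bsub>?D\<^esub> H) \<cdot>\<^bsub>?D\<^esub> Assoc ?D P Q R"
    if "F \<in> Hom\<^bsub>?D\<^esub> P P'" "G \<in> Hom\<^bsub>?D\<^esub> Q Q'" "H \<in> Hom\<^bsub>?D\<^esub> R R'"
    using that by (auto simp: D assoc_hom_natural)
  show "LUnit ?D P \<in> Hom\<^bsub>?D\<^esub> (\<one>\<^bsub>?D\<^esub> \<otimes>\<^bsub>?D\<^esub> P) P" "is_iso ?D (LUnit ?D P)"
    "RUnit ?D P \<in> Hom\<^bsub>?D\<^esub> (P \<otimes>\<^bsub>?D\<^esub> \<one>\<^bsub>?D\<^esub>) P" "is_iso ?D (RUnit ?D P)"
    if "P \<in> Obj ?D"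
    using that by (auto simp: D intro!: bimod_hom_lunit bimod_hom_runit bimodule_cat_iso
      lunit_hom_props runit_hom_props)
  show "LUnit ?D Q \<cdot>\<^bsub>?D\<^esub> (Ident ?D \<one>\<^bsub>?D\<^esub> \<odot>\<^bsub>?D\<^esub> F) = F \<cdot>\<^bsub>?D\<^esub> LUnit ?D P"
    "RUnit ?D Q \<cdot>\<^bsub>?D\<^esub> (F \<odot>\<^bsub>?D\<^esub> Ident ?D \<one>\<^bsub>?D\<^esub>) = F \<cdot>\<^bsub>?D\<^esub> RUnit ?D P"
    if "F \<in> Hom\<^bsub>?D\<^esub> P Q"
    using that by (auto simp: D lunit_hom_natural runit_hom_natural)
  show "Assoc ?D (S \<otimes>\<^bsub>?D\<^esub> P) Q R \<cdot>\<^bsub>?D\<^esub> Assoc ?D S P (Q \<otimes>\<^bsub>?D\<^esub> R) =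
      (Assoc ?D S P Q \<odot>\<^bsub>?D\<^esub> Ident ?D R) \<cdot>\<^bsub>?D\<^esub> Assoc ?D S (P \<otimes>\<^bsub>?D\<^esub> Q) R \<cdot>\<^bsub>?D\<^esub>
        (Ident ?D S \<odot>\<^bsub>?D\<^esub> Assoc ?D P Q R)"
    if "S \<in> Obj ?D" "P \<in> Obj ?D" "Q \<in> Obj ?D" "R \<in> Obj ?D"
    using that by (simp add: D assoc_hom_pentagon)
  show "(RUnit ?D P \<odot>\<^bsub>?D\<^esub> Ident ?D Q) \<cdot>\<^bsub>?D\<^esub> Assoc ?D P \<one>\<^bsub>?D\<^esub> Q = Ident ?D P \<odot>\<^bsub>?D\<^esub> LUnit ?D Q"
    if "P \<in> Obj ?D" "Q \<in> Obj ?D"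
    using that by (simp add: D unit_triangle)
qed

section \<open>Free bimodules\<close>

definition coflat_transfer :: "'a \<times> 'b \<Rightarrow> bool"
  where "coflat_transfer P \<longleftrightarrow> transfer P \<and> left_coflat C (fst P)"

lemma coflat_transfer_simps [simp]:
  assumes "coflat_transfer P"
  shows "fst P \<in> Obj C" "left_coflat C (fst P)" "snd P \<in> Arr C"
    "Dom C (snd P) = fst P \<otimes> A" "Cod C (snd P) = A \<otimes> fst P"
  using assms unfolding coflat_transfer_def transfer_def in_Hom_iff case_prod_beta by blast+

lemma coflat_transfer_eqs:
  assumes "coflat_transfer P"
  shows "snd P \<cdot> (fst P \<rhd> m) = (m \<lhd> fst P) \<cdot> (A \<rhd> snd P) \<cdot> (snd P \<lhd> A)"
    "snd P \<cdot> (fst P \<rhd> \<eta>) = \<eta> \<lhd> fst P"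
  using assms unfolding coflat_transfer_def transfer_def case_prod_beta by blast+

text \<open>This is \<open>linear_ext (fst P) (snd P)\<close>, the left linear extension of the
  transfer map \<open>\<psi>\<close>.\<close>

definition free_ract :: "'a \<times> 'b \<Rightarrow> 'b"
  where "free_ract P = (m \<lhd> fst P) \<cdot> (A \<rhd> snd P)"

lemma free_ract_typing [simp]:
  assumes "coflat_transfer P"
  shows "free_ract P \<in> Arr C" "Dom C (free_ract P) = A \<otimes> fst P \<otimes> A"
    "Cod C (free_ract P) = A \<otimes> fst P"
  using assms by (simp_all add: free_ract_def)

lemma whiskered_algebra_eqs:
  assumes "X \<in> Obj C"
  shows "(m \<lhd> X) \<cdot> (m \<lhd> (A \<otimes> X)) = (m \<lhd> X) \<cdot> (A \<rhd> (m \<lhd> X))"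
    "(m \<lhd> X) \<cdot> (\<eta> \<lhd> (A \<otimes> X)) = Ident C (A \<otimes> X)"
    "(m \<lhd> X) \<cdot> (A \<rhd> (\<eta> \<lhd> X)) = Ident C (A \<otimes> X)"
  using m_assoc[THEN arg_cong, of "\<lambda>f. f \<lhd> X"] m_lunit[THEN arg_cong, of "\<lambda>f. f \<lhd> X"]
    m_runit[THEN arg_cong, of "\<lambda>f. f \<lhd> X"] assms by simp_all

lemma whisker_m_swap:
  "\<lbrakk>f \<in> Arr C; Dom C f = X\<rbrakk> \<Longrightarrow> (A \<rhd> f) \<cdot> (m \<lhd> X) = (m \<lhd> Cod C f) \<cdot> ((A \<otimes> A) \<rhd> f)"
  using whisker_exchange[of m f] by simp

lemma whisker_\<eta>_swap:
  "\<lbrakk>f \<in> Arr C; Dom C f = X\<rbrakk> \<Longrightarrow> (A \<rhd> f) \<cdot> (\<eta> \<lhd> X) = (\<eta> \<lhd> Cod C f) \<cdot> f"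
  using whisker_exchange[of \<eta> f] by simp

lemma free_ract_left_linear:
  assumes "coflat_transfer P"
  shows "free_ract P \<cdot> (m \<lhd> (fst P \<otimes> A)) = (m \<lhd> fst P) \<cdot> (A \<rhd> free_ract P)"
    and "free_ract P \<cdot> (\<eta> \<lhd> (fst P \<otimes> A)) = snd P"
  using assms by (simp_all add: free_ract_def whisker_m_swap whisker_\<eta>_swap
    whiskered_algebra_eqs whiskered_algebra_eqs[THEN Comp_tail])

text \<open>Associativity is the multiplicativity axiom of \<open>\<psi>\<close>, extended by left
  linearity; unitality is the unit axiom of \<open>\<psi>\<close>.\<close>

lemma free_ract_module:
  assumes "coflat_transfer P"
  shows "free_ract P \<cdot> (free_ract P \<lhd> A) = free_ract P \<cdot> ((A \<otimes> fst P) \<rhd> m)"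
    and "free_ract P \<cdot> ((A \<otimes> fst P) \<rhd> \<eta>) = Ident C (A \<otimes> fst P)"
proof -
  note [simp] = assms
  note E = coflat_transfer_eqs[OF assms]
  have w: "(A \<rhd> snd P) \<cdot> ((A \<otimes> fst P) \<rhd> m) =
      (A \<rhd> (m \<lhd> fst P)) \<cdot> ((A \<otimes> A) \<rhd> snd P) \<cdot> (A \<rhd> (snd P \<lhd> A))"
    "(A \<rhd> snd P) \<cdot> ((A \<otimes> fst P) \<rhd> \<eta>) = A \<rhd> (\<eta> \<lhd> fst P)"
    using E[THEN arg_cong, of "\<lambda>f. A \<rhd> f"] by simp_all
  have "free_ract P \<cdot> (free_ract P \<lhd> A) =
      (free_ract P \<cdot> (m \<lhd> (fst P \<otimes> A))) \<cdot> (A \<rhd> (snd P \<lhd> A))"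
    by (simp add: free_ract_def)
  also have "\<dots> = (m \<lhd> fst P) \<cdot> (A \<rhd> (m \<lhd> fst P)) \<cdot> ((A \<otimes> A) \<rhd> snd P) \<cdot> (A \<rhd> (snd P \<lhd> A))"
    unfolding free_ract_left_linear(1)[OF assms] by (simp add: free_ract_def)
  also have "\<dots> = free_ract P \<cdot> ((A \<otimes> fst P) \<rhd> m)"
    by (simp add: free_ract_def w)
  finally show "free_ract P \<cdot> (free_ract P \<lhd> A) = free_ract P \<cdot> ((A \<otimes> fst P) \<rhd> m)" .
  show "free_ract P \<cdot> ((A \<otimes> fst P) \<rhd> \<eta>) = Ident C (A \<otimes> fst P)"
    by (simp add: free_ract_def w whiskered_algebra_eqs)
qed

definition free_bimodule :: "'a \<times> 'b \<Rightarrow> 'a \<times> 'b \<times> 'b"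
  where "free_bimodule P = (A \<otimes> fst P, m \<lhd> fst P, free_ract P)"

lemma free_bimodule_simps [simp]:
  "carrier (free_bimodule P) = A \<otimes> fst P" "lact (free_bimodule P) = m \<lhd> fst P"
  "ract (free_bimodule P) = free_ract P"
  by (simp_all add: free_bimodule_def)

lemma admissible_free [simp]:
  assumes "coflat_transfer P"
  shows "admissible (free_bimodule P)"
proof -
  note [simp] = assms
  have "left_module (A \<otimes> fst P) (m \<lhd> fst P)"
    by (intro left_module_whisker bimodule_modules(1)[OF regular_bimodule]) simp
  moreover have "right_module (A \<otimes> fst P) (free_ract P)"
    by (simp add: right_module_def in_Hom_iff free_ract_module)
  ultimately show ?thesis
    using free_robust[of "fst P"]
    by (simp add: admissible_def bimodule_def free_ract_left_linear)
qed

text \<open>The Kleisli extension for the monad \<open>A \<otimes> -\<close>. In these terms the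
  composite of \<open>f\<close> and \<open>g\<close> in the source category is
  \<open>linear_ext Z g \<cdot> f\<close>.\<close>

definition linear_ext :: "'a \<Rightarrow> 'b \<Rightarrow> 'b"
  where "linear_ext Y f = (m \<lhd> Y) \<cdot> (A \<rhd> f)"

context
  fixes X Y f
  assumes Y [simp]: "Y \<in> Obj C" and f [simp]: "f \<in> Arr C" "Dom C f = X" "Cod C f = A \<otimes> Y"
begin

lemma linear_ext_domain: "X \<in> Obj C"
  using Dom_Obj[OF f(1)] f(2) by simp

lemma linear_ext_typing: "linear_ext Y f \<in> Arr C" "Dom C (linear_ext Y f) = A \<otimes> X" "Cod C (linear_ext Y f) = A \<otimes> Y"
  by (simp_all add: linear_ext_def linear_ext_domain)

lemma linear_ext_unit: "linear_ext Y f \<cdot> (\<eta> \<lhd> X) = f"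
  by (simp add: linear_ext_def linear_ext_domain whisker_\<eta>_swap whiskered_algebra_eqs whiskered_algebra_eqs[THEN Comp_tail])

lemma linear_ext_left_linear: "linear_ext Y f \<cdot> (m \<lhd> X) = (m \<lhd> Y) \<cdot> (A \<rhd> linear_ext Y f)"
  by (simp add: linear_ext_def linear_ext_domain whisker_m_swap whiskered_algebra_eqs whiskered_algebra_eqs[THEN Comp_tail])

end

lemma linear_ext_of_left_linear:
  assumes "X \<in> Obj C" "Y \<in> Obj C" "h \<in> Arr C" "Dom C h = A \<otimes> X" "Cod C h = A \<otimes> Y"
    and "h \<cdot> (m \<lhd> X) = (m \<lhd> Y) \<cdot> (A \<rhd> h)"
  shows "linear_ext Y (h \<cdot> (\<eta> \<lhd> X)) = h"
  using assms(1-5) by (simp add: linear_ext_def assms(6)[symmetric, THEN Comp_tail] whiskered_algebra_eqs)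

lemma linear_ext_unit_eq: "X \<in> Obj C \<Longrightarrow> linear_ext X (\<eta> \<lhd> X) = Ident C (A \<otimes> X)"
  by (simp add: linear_ext_def whiskered_algebra_eqs)

lemma linear_ext_Comp:
  assumes "Y \<in> Obj C" "Z \<in> Obj C" "f \<in> Arr C" "Cod C f = A \<otimes> Y"
    "g \<in> Arr C" "Dom C g = Y" "Cod C g = A \<otimes> Z"
  shows "linear_ext Z (linear_ext Z g \<cdot> f) = linear_ext Z g \<cdot> linear_ext Y f"
proof -
  note [simp] = assms linear_ext_typing[OF assms(2,5-7)]
  have "linear_ext Z (linear_ext Z g \<cdot> f) = (m \<lhd> Z) \<cdot> (A \<rhd> linear_ext Z g) \<cdot> (A \<rhd> f)"
    by (simp add: linear_ext_def[of _ "linear_ext Z g \<cdot> f"])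
  also have "\<dots> = linear_ext Z g \<cdot> linear_ext Y f"
    using linear_ext_left_linear[OF assms(2,5-7), symmetric, THEN Comp_tail, of "A \<rhd> f"]
    by (simp add: linear_ext_def[of _ f])
  finally show ?thesis .
qed

section \<open>Transfer morphisms as bimodule maps between free bimodules\<close>

definition transfer_hom :: "'a \<times> 'b \<Rightarrow> 'b \<Rightarrow> 'a \<times> 'b \<Rightarrow> bool"
  where "transfer_hom P f Q \<longleftrightarrow> coflat_transfer P \<and> coflat_transfer Q \<and> transfer_mor P f Q"

lemma transfer_hom_iff:
  "transfer_hom P f Q \<longleftrightarrow> coflat_transfer P \<and> coflat_transfer Q \<and> f \<in> Arr C \<and>
    Dom C f = fst P \<and> Cod C f = A \<otimes> fst Q \<and>
    linear_ext (fst Q) f \<cdot> snd P = free_ract Q \<cdot> (f \<lhd> A)"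
  by (cases "coflat_transfer P \<and> coflat_transfer Q")
    (auto simp: transfer_hom_def transfer_mor_def split_beta in_Hom_iff linear_ext_def free_ract_def)

lemma transfer_homD:
  assumes "transfer_hom P f Q"
  shows "coflat_transfer P" "coflat_transfer Q" "f \<in> Arr C" "Dom C f = fst P"
    "Cod C f = A \<otimes> fst Q" "linear_ext (fst Q) f \<cdot> snd P = free_ract Q \<cdot> (f \<lhd> A)"
    "linear_ext (fst Q) f \<in> Arr C" "Dom C (linear_ext (fst Q) f) = A \<otimes> fst P"
    "Cod C (linear_ext (fst Q) f) = A \<otimes> fst Q"
  using assms linear_ext_typing[of "fst Q" f "fst P"] by (simp_all add: transfer_hom_iff)

text \<open>Both composites in the right linearity condition are left linear maps on a free module,
  so it suffices to compare them after inserting \<open>\<eta>\<close>; there the condition reads as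
  the equation that defines transfer morphisms.\<close>

lemma transfer_hom_iff_bimod_hom:
  assumes [simp]: "coflat_transfer P" "coflat_transfer Q" "f \<in> Arr C" "Dom C f = fst P"
    "Cod C f = A \<otimes> fst Q"
  shows "transfer_hom P f Q \<longleftrightarrow> bimod_hom (free_bimodule P) (linear_ext (fst Q) f) (free_bimodule Q)"
proof -
  let ?e = "linear_ext (fst Q) f"
  note e = linear_ext_typing[OF _ assms(3-5)] linear_ext_unit[OF _ assms(3-5)]
    linear_ext_left_linear[OF _ assms(3-5)]
  have [simp]: "?e \<in> Arr C" "Dom C ?e = A \<otimes> fst P" "Cod C ?e = A \<otimes> fst Q"
    using e by simp_all
  have "?e \<cdot> free_ract P = free_ract Q \<cdot> (?e \<lhd> A)" if h: "?e \<cdot> snd P = free_ract Q \<cdot> (f \<lhd> A)"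
  proof -
    have "?e \<cdot> free_ract P = (m \<lhd> fst Q) \<cdot> (A \<rhd> (?e \<cdot> snd P))"
      using e(5)[THEN Comp_tail] by (simp add: free_ract_def)
    also have "\<dots> = free_ract Q \<cdot> (m \<lhd> (fst Q \<otimes> A)) \<cdot> (A \<rhd> (f \<lhd> A))"
      unfolding h by (simp add: free_ract_left_linear(1)[THEN Comp_tail])
    also have "\<dots> = free_ract Q \<cdot> (?e \<lhd> A)"
      by (simp add: linear_ext_def)
    finally show ?thesis .
  qed
  moreover have "?e \<cdot> snd P = free_ract Q \<cdot> (f \<lhd> A)"
    if h: "?e \<cdot> free_ract P = free_ract Q \<cdot> (?e \<lhd> A)"
  proof -
    have "?e \<cdot> snd P = ?e \<cdot> free_ract P \<cdot> (\<eta> \<lhd> (fst P \<otimes> A))"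
      by (simp add: free_ract_left_linear(2))
    also have "\<dots> = free_ract Q \<cdot> ((?e \<cdot> (\<eta> \<lhd> fst P)) \<lhd> A)"
      using h[THEN Comp_tail, of "\<eta> \<lhd> (fst P \<otimes> A)"] by simp
    finally show ?thesis
      by (simp add: e(4))
  qed
  ultimately show ?thesis
    using e(5) by (auto simp: transfer_hom_iff bimod_hom_iff)
qed

lemma bimod_hom_linear_ext:
  "transfer_hom P f Q \<Longrightarrow> bimod_hom (free_bimodule P) (linear_ext (fst Q) f) (free_bimodule Q)"
  using transfer_hom_iff_bimod_hom transfer_homD(1-5) by blast

section \<open>Tensor products of transfer morphisms\<close>

lemma transfer_tensor_eq:
  "transfer_tensor P Q = (fst P \<otimes> fst Q, (snd P \<lhd> fst Q) \<cdot> (fst P \<rhd> snd Q))"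
  by (simp add: transfer_tensor_def case_prod_beta)

lemma transfer_tensor_simps [simp]:
  "fst (transfer_tensor P Q) = fst P \<otimes> fst Q"
  "snd (transfer_tensor P Q) = (snd P \<lhd> fst Q) \<cdot> (fst P \<rhd> snd Q)"
  by (simp_all add: transfer_tensor_eq)

lemma coflat_transferI:
  assumes "fst P \<in> Obj C" "left_coflat C (fst P)" "snd P \<in> Arr C"
    "Dom C (snd P) = fst P \<otimes> A" "Cod C (snd P) = A \<otimes> fst P"
    "snd P \<cdot> (fst P \<rhd> m) = (m \<lhd> fst P) \<cdot> (A \<rhd> snd P) \<cdot> (snd P \<lhd> A)"
    "snd P \<cdot> (fst P \<rhd> \<eta>) = \<eta> \<lhd> fst P"
  shows "coflat_transfer P"
  using assms unfolding coflat_transfer_def transfer_def in_Hom_iff case_prod_beta by blast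

text \<open>Multiplicativity of the composite transfer follows from that of its two factors, after
  the transfers of two different copies of \<open>A\<close> are commuted by interchange in
  \<open>s\<close>.\<close>

lemma coflat_transfer_tensor [simp]:
  assumes P: "coflat_transfer P" and Q: "coflat_transfer Q"
  shows "coflat_transfer (transfer_tensor P Q)"
proof (rule coflat_transferI)
  note [simp] = P Q
  let ?X = "fst P" and ?Y = "fst Q"
  have "(snd P \<lhd> ?Y) \<cdot> (?X \<rhd> (m \<lhd> ?Y)) =
      (m \<lhd> (?X \<otimes> ?Y)) \<cdot> (A \<rhd> (snd P \<lhd> ?Y)) \<cdot> (snd P \<lhd> (A \<otimes> ?Y))"
    using coflat_transfer_eqs(1)[OF P, THEN arg_cong, of "\<lambda>f. f \<lhd> ?Y"] by simp
  moreover have "(snd P \<lhd> ?Y) \<cdot> (?X \<rhd> (\<eta> \<lhd> ?Y)) = \<eta> \<lhd> (?X \<otimes> ?Y)"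
    using coflat_transfer_eqs(2)[OF P, THEN arg_cong, of "\<lambda>f. f \<lhd> ?Y"] by simp
  moreover have "(?X \<rhd> snd Q) \<cdot> ((?X \<otimes> ?Y) \<rhd> m) =
      (?X \<rhd> (m \<lhd> ?Y)) \<cdot> ((?X \<otimes> A) \<rhd> snd Q) \<cdot> (?X \<rhd> (snd Q \<lhd> A))"
    using coflat_transfer_eqs(1)[OF Q, THEN arg_cong, of "\<lambda>f. ?X \<rhd> f"] by simp
  moreover have "(?X \<rhd> snd Q) \<cdot> ((?X \<otimes> ?Y) \<rhd> \<eta>) = ?X \<rhd> (\<eta> \<lhd> ?Y)"
    using coflat_transfer_eqs(2)[OF Q, THEN arg_cong, of "\<lambda>f. ?X \<rhd> f"] by simp
  moreover note w = calculation
  have s: "((A \<otimes> ?X) \<rhd> snd Q) \<cdot> (snd P \<lhd> (?Y \<otimes> A)) = (snd P \<lhd> (A \<otimes> ?Y)) \<cdot> ((?X \<otimes> A) \<rhd> snd Q)"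
    using whisker_exchange[of "snd P" "snd Q"] by simp
  show "snd (transfer_tensor P Q) \<cdot> (fst (transfer_tensor P Q) \<rhd> m) =
      (m \<lhd> fst (transfer_tensor P Q)) \<cdot> (A \<rhd> snd (transfer_tensor P Q)) \<cdot>
        (snd (transfer_tensor P Q) \<lhd> A)"
    by (simp add: w w(1)[THEN Comp_tail] s[THEN Comp_tail])
  show "snd (transfer_tensor P Q) \<cdot> (fst (transfer_tensor P Q) \<rhd> \<eta>) =
      \<eta> \<lhd> fst (transfer_tensor P Q)"
    by (simp add: w)
qed (use P Q in simp_all)

lemma coflat_transfer_unit [simp]: "coflat_transfer (\<one>, Ident C A)"
  by (rule coflat_transferI) simp_all

lemma free_bimodule_unit: "free_bimodule (\<one>, Ident C A) = (A, m, m)"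
  by (simp add: free_bimodule_def free_ract_def)

lemma transfer_tensor_assoc:
  assumes "coflat_transfer P" "coflat_transfer Q" "coflat_transfer R"
  shows "transfer_tensor P (transfer_tensor Q R) = transfer_tensor (transfer_tensor P Q) R"
  using assms by (simp add: transfer_tensor_eq)

lemma transfer_tensor_unit:
  assumes "coflat_transfer P"
  shows "transfer_tensor (\<one>, Ident C A) P = P" "transfer_tensor P (\<one>, Ident C A) = P"
  using assms by (simp_all add: transfer_tensor_eq)

lemma free_ract_tensor:
  assumes "coflat_transfer P" "coflat_transfer Q"
  shows "free_ract (transfer_tensor P Q) = (free_ract P \<lhd> fst Q) \<cdot> ((A \<otimes> fst P) \<rhd> snd Q)"
  using assms by (simp add: free_ract_def)

text \<open>Right linearity of the arrow \<open>free_ract P \<lhd> fst Q\<close> that induces the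
  multiplication of the functor. The same identity, tensored with a third object, yields
  associativity of both the source tensor and the multiplication.\<close>

lemma free_ract_tensor_balanced:
  assumes P: "coflat_transfer P" and Q: "coflat_transfer Q"
  shows "(free_ract P \<lhd> fst Q) \<cdot> ((A \<otimes> fst P) \<rhd> free_ract Q) =
    free_ract (transfer_tensor P Q) \<cdot> (free_ract P \<lhd> (fst Q \<otimes> A))"
proof -
  note [simp] = P Q
  have "(free_ract P \<lhd> fst Q) \<cdot> ((A \<otimes> fst P) \<rhd> (m \<lhd> fst Q)) =
      (free_ract P \<lhd> fst Q) \<cdot> (free_ract P \<lhd> (A \<otimes> fst Q))"
    using free_ract_module(1)[OF P, THEN arg_cong, of "\<lambda>f. f \<lhd> fst Q"] by simp
  moreover have "((A \<otimes> fst P) \<rhd> snd Q) \<cdot> (free_ract P \<lhd> (fst Q \<otimes> A)) =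
      (free_ract P \<lhd> (A \<otimes> fst Q)) \<cdot> ((A \<otimes> fst P \<otimes> A) \<rhd> snd Q)"
    using whisker_exchange[of "free_ract P" "snd Q"] by simp
  moreover note E = calculation
  show ?thesis
    by (simp add: free_ract_tensor E E[THEN Comp_tail] free_ract_def[of Q])
qed

text \<open>The tensor formula of the source, regrouped so that the arrow inducing
  \<open>mult_hom P' Q'\<close> appears in it.\<close>

definition transfer_hom_tensor :: "'a \<times> 'b \<Rightarrow> 'a \<times> 'b \<Rightarrow> 'b \<Rightarrow> 'b \<Rightarrow> 'b"
  where "transfer_hom_tensor P' Q' f g = (free_ract P' \<lhd> fst Q') \<cdot> (f \<odot> g)"

context
  fixes P P' Q Q' f g
  assumes f: "transfer_hom P f P'" and g: "transfer_hom Q g Q'"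
begin

lemma transfer_hom_tensor_typing:
  "transfer_hom_tensor P' Q' f g \<in> Arr C"
  "Dom C (transfer_hom_tensor P' Q' f g) = fst P \<otimes> fst Q"
  "Cod C (transfer_hom_tensor P' Q' f g) = A \<otimes> fst P' \<otimes> fst Q'"
  using transfer_homD(1-5)[OF f] transfer_homD(1-5)[OF g]
  by (simp_all add: transfer_hom_tensor_def)

lemma linear_ext_tensor:
  "linear_ext (fst P' \<otimes> fst Q') (transfer_hom_tensor P' Q' f g) =
    (free_ract P' \<lhd> fst Q') \<cdot> (linear_ext (fst P') f \<odot> g)"
proof -
  note [simp] = transfer_homD(1-5,7-9)[OF f] transfer_homD(1-5,7-9)[OF g]
  have w: "(m \<lhd> (fst P' \<otimes> fst Q')) \<cdot> (A \<rhd> (free_ract P' \<lhd> fst Q')) =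
      (free_ract P' \<lhd> fst Q') \<cdot> (m \<lhd> (fst P' \<otimes> A \<otimes> fst Q'))"
    using free_ract_left_linear(1)[of P', THEN arg_cong, of "\<lambda>f. f \<lhd> fst Q'"] by simp
  have "((m \<lhd> fst P') \<lhd> (A \<otimes> fst Q')) \<cdot> ((A \<rhd> f) \<odot> g) = linear_ext (fst P') f \<odot> g"
    unfolding linear_ext_def by (simp add: interchange del: TensorA_assoc)
  then show ?thesis
    by (simp add: linear_ext_def[of "fst P' \<otimes> fst Q'"] transfer_hom_tensor_def w[THEN Comp_tail])
qed

text \<open>Naturality of the multiplication before passing to quotients. It also carries the
  interchange law and the closure of transfer morphisms under tensoring.\<close>

lemma linear_ext_tensor_quot:
  "linear_ext (fst P' \<otimes> fst Q') (transfer_hom_tensor P' Q' f g) \<cdot> (free_ract P \<lhd> fst Q) =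
    (free_ract P' \<lhd> fst Q') \<cdot> (linear_ext (fst P') f \<odot> linear_ext (fst Q') g)"
proof -
  note [simp] = transfer_homD(1-5,7-9)[OF f] transfer_homD(1-5,7-9)[OF g]
  let ?f = "linear_ext (fst P') f"
  have r: "?f \<cdot> free_ract P = free_ract P' \<cdot> (?f \<lhd> A)"
    using bimod_hom_linear_ext[OF f] by (simp add: bimod_hom_iff)
  have "(?f \<odot> g) \<cdot> (free_ract P \<lhd> fst Q) = (free_ract P' \<lhd> (A \<otimes> fst Q')) \<cdot> ((?f \<lhd> A) \<odot> g)"
    by (simp add: interchange r del: TensorA_assoc)
  moreover have "(free_ract P' \<lhd> fst Q') \<cdot> (free_ract P' \<lhd> (A \<otimes> fst Q')) =
      (free_ract P' \<lhd> fst Q') \<cdot> ((A \<otimes> fst P') \<rhd> (m \<lhd> fst Q'))"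
    using free_ract_module(1)[of P', THEN arg_cong, of "\<lambda>f. f \<lhd> fst Q'"] by simp
  moreover have "((A \<otimes> fst P') \<rhd> (m \<lhd> fst Q')) \<cdot> (?f \<odot> (A \<rhd> g)) = ?f \<odot> linear_ext (fst Q') g"
    by (simp add: interchange linear_ext_def[of _ g])
  moreover note E = calculation
  show ?thesis
    by (simp add: linear_ext_tensor E E[THEN Comp_tail])
qed

lemma transfer_hom_tensor_transfer_hom:
  "transfer_hom (transfer_tensor P Q) (transfer_hom_tensor P' Q' f g) (transfer_tensor P' Q')"
proof -
  note f' = transfer_homD[OF f] and g' = transfer_homD[OF g]
  note [simp] = f'(1-5,7-9) g'(1-5,7-9) transfer_hom_tensor_typing
  let ?t = "transfer_hom_tensor P' Q' f g" and ?f = "linear_ext (fst P') f"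
    and ?g = "linear_ext (fst Q') g" and ?XY = "fst P' \<otimes> fst Q'"
  have t: "linear_ext ?XY ?t \<in> Arr C" "Dom C (linear_ext ?XY ?t) = A \<otimes> fst P \<otimes> fst Q"
    "Cod C (linear_ext ?XY ?t) = A \<otimes> ?XY"
    by (rule linear_ext_typing; simp)+
  note [simp] = t
  \<comment> \<open>The unit is inserted into the first copy of \<open>A\<close> only: this reduces
    the action to \<open>\<psi>\<close> and \<open>?f\<close> to \<open>f\<close>, while
    \<open>?g\<close> stays whole because the second copy is to receive the output of
    \<open>snd Q\<close>.\<close>
  have "(free_ract P \<lhd> fst Q) \<cdot> (\<eta> \<lhd> (fst P \<otimes> A \<otimes> fst Q)) = snd P \<lhd> fst Q"
    using free_ract_left_linear(2)[of P, THEN arg_cong, of "\<lambda>f. f \<lhd> fst Q"] by simp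
  moreover have "(?f \<odot> ?g) \<cdot> ((\<eta> \<lhd> fst P) \<lhd> (A \<otimes> fst Q)) = f \<odot> ?g"
    using linear_ext_unit[of "fst P'" f] by (simp add: interchange del: TensorA_assoc)
  ultimately have 1: "linear_ext ?XY ?t \<cdot> (snd P \<lhd> fst Q) = (free_ract P' \<lhd> fst Q') \<cdot> (f \<odot> ?g)"
    using linear_ext_tensor_quot[THEN Comp_tail, of "\<eta> \<lhd> (fst P \<otimes> A \<otimes> fst Q)"] by simp
  have 2: "(f \<odot> ?g) \<cdot> (fst P \<rhd> snd Q) = ((A \<otimes> fst P') \<rhd> free_ract Q') \<cdot> (f \<odot> (g \<lhd> A))"
    by (simp add: interchange g'(6))
  show ?thesis
    using 1[THEN Comp_tail, of "fst P \<rhd> snd Q"]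
    by (simp add: transfer_hom_iff 2 free_ract_tensor_balanced[THEN Comp_tail])
      (simp add: transfer_hom_tensor_def)
qed

end

text \<open>Closure under composition is transported from bimodule maps, because linear extension
  turns the Kleisli composite into an ordinary one.\<close>

lemma transfer_hom_Comp:
  assumes f: "transfer_hom P f Q" and g: "transfer_hom Q g R"
  shows "transfer_hom P (linear_ext (fst R) g \<cdot> f) R"
    "linear_ext (fst R) (linear_ext (fst R) g \<cdot> f) = linear_ext (fst R) g \<cdot> linear_ext (fst Q) f"
proof -
  note [simp] = transfer_homD(1-5,7-9)[OF f] transfer_homD(1-5,7-9)[OF g]
  show *: "linear_ext (fst R) (linear_ext (fst R) g \<cdot> f) = linear_ext (fst R) g \<cdot> linear_ext (fst Q) f"
    by (rule linear_ext_Comp) simp_all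
  show "transfer_hom P (linear_ext (fst R) g \<cdot> f) R"
    using bimod_hom_Comp[OF bimod_hom_linear_ext[OF f] bimod_hom_linear_ext[OF g]]
    by (simp add: transfer_hom_iff_bimod_hom *)
qed

lemma transfer_hom_Ident: "coflat_transfer P \<Longrightarrow> transfer_hom P (\<eta> \<lhd> fst P) P"
  using bimod_hom_Ident[of "free_bimodule P"]
  by (simp add: transfer_hom_iff_bimod_hom linear_ext_unit_eq)

lemma transfer_hom_tensor_Ident:
  assumes "coflat_transfer P" "coflat_transfer Q"
  shows "transfer_hom_tensor P Q (\<eta> \<lhd> fst P) (\<eta> \<lhd> fst Q) = \<eta> \<lhd> (fst P \<otimes> fst Q)"
proof -
  note [simp] = assms
  have "(\<eta> \<lhd> fst P) \<odot> (\<eta> \<lhd> fst Q) = (\<eta> \<lhd> (fst P \<otimes> A \<otimes> fst Q)) \<cdot> (fst P \<rhd> (\<eta> \<lhd> fst Q))"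
    using TensorA_split[of "\<eta> \<lhd> fst P" "\<eta> \<lhd> fst Q"] by simp
  moreover have "(free_ract P \<lhd> fst Q) \<cdot> (\<eta> \<lhd> (fst P \<otimes> A \<otimes> fst Q)) = snd P \<lhd> fst Q"
    using free_ract_left_linear(2)[of P, THEN arg_cong, of "\<lambda>f. f \<lhd> fst Q"] by simp
  moreover have "(snd P \<lhd> fst Q) \<cdot> (fst P \<rhd> (\<eta> \<lhd> fst Q)) = \<eta> \<lhd> (fst P \<otimes> fst Q)"
    using coflat_transfer_eqs(2)[of P, THEN arg_cong, of "\<lambda>f. f \<lhd> fst Q"] by simp
  moreover note E = calculation
  show ?thesis
    by (simp add: transfer_hom_tensor_def E E(2,3)[THEN Comp_tail])
qed

text \<open>Precomposing \<open>linear_ext_tensor_quot\<close> with \<open>f \<odot> g\<close>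
  leaves only the interchange law of \<open>C\<close>.\<close>

lemma transfer_hom_tensor_Comp:
  assumes f: "transfer_hom P f P'" "transfer_hom P' f' P''"
    and g: "transfer_hom Q g Q'" "transfer_hom Q' g' Q''"
  shows "transfer_hom_tensor P'' Q'' (linear_ext (fst P'') f' \<cdot> f) (linear_ext (fst Q'') g' \<cdot> g) =
    linear_ext (fst P'' \<otimes> fst Q'') (transfer_hom_tensor P'' Q'' f' g') \<cdot> transfer_hom_tensor P' Q' f g"
proof -
  note [simp] = transfer_homD(1-5,7-9)[OF f(1)] transfer_homD(1-5,7-9)[OF g(1)]
    transfer_homD(1-5,7-9)[OF f(2)] transfer_homD(1-5,7-9)[OF g(2)]
    transfer_hom_tensor_typing[OF f(2) g(2)]
  have t: "linear_ext (fst P'' \<otimes> fst Q'') (transfer_hom_tensor P'' Q'' f' g') \<in> Arr C"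
    "Dom C (linear_ext (fst P'' \<otimes> fst Q'') (transfer_hom_tensor P'' Q'' f' g')) =
      A \<otimes> fst P' \<otimes> fst Q'"
    by (rule linear_ext_typing; simp)+
  have "linear_ext (fst P'' \<otimes> fst Q'') (transfer_hom_tensor P'' Q'' f' g') \<cdot>
      transfer_hom_tensor P' Q' f g =
    (free_ract P'' \<lhd> fst Q'') \<cdot> (linear_ext (fst P'') f' \<odot> linear_ext (fst Q'') g') \<cdot> (f \<odot> g)"
    using linear_ext_tensor_quot[OF f(2) g(2), THEN Comp_tail, of "f \<odot> g"] t
    by (simp add: transfer_hom_tensor_def[of P' Q'])
  then show ?thesis
    by (simp add: transfer_hom_tensor_def[of _ _ "linear_ext (fst P'') f' \<cdot> f"] interchange)
qed

lemma transfer_hom_tensor_assoc: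
  assumes f: "transfer_hom P f P'" and g: "transfer_hom Q g Q'" and h: "transfer_hom R h R'"
  shows "transfer_hom_tensor P' (transfer_tensor Q' R') f (transfer_hom_tensor Q' R' g h) =
    transfer_hom_tensor (transfer_tensor P' Q') R' (transfer_hom_tensor P' Q' f g) h"
proof -
  note [simp] = transfer_homD(1-5)[OF f] transfer_homD(1-5)[OF g] transfer_homD(1-5)[OF h]
  have "f \<odot> ((free_ract Q' \<lhd> fst R') \<cdot> (g \<odot> h)) =
      ((A \<otimes> fst P') \<rhd> (free_ract Q' \<lhd> fst R')) \<cdot> (f \<odot> (g \<odot> h))"
    by (simp add: interchange)
  moreover have "((free_ract P' \<lhd> fst Q') \<cdot> (f \<odot> g)) \<odot> h =
      ((free_ract P' \<lhd> fst Q') \<lhd> (A \<otimes> fst R')) \<cdot> ((f \<odot> g) \<odot> h)"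
    by (simp add: interchange del: TensorA_assoc)
  moreover have "(free_ract P' \<lhd> (fst Q' \<otimes> fst R')) \<cdot> ((A \<otimes> fst P') \<rhd> (free_ract Q' \<lhd> fst R')) =
      (free_ract (transfer_tensor P' Q') \<lhd> fst R') \<cdot> (free_ract P' \<lhd> (fst Q' \<otimes> A \<otimes> fst R'))"
    using free_ract_tensor_balanced[of P' Q', THEN arg_cong, of "\<lambda>f. f \<lhd> fst R'"] by simp
  moreover note E = calculation
  show ?thesis
    by (simp add: transfer_hom_tensor_def E E(3)[THEN Comp_tail])
qed

lemma transfer_hom_tensor_unit:
  assumes f: "transfer_hom P f P'"
  shows "transfer_hom_tensor (\<one>, Ident C A) P' \<eta> f = f"
    "transfer_hom_tensor P' (\<one>, Ident C A) f \<eta> = f"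
proof -
  note [simp] = transfer_homD(1-5)[OF f]
  have "\<eta> \<odot> f = (\<eta> \<lhd> (A \<otimes> fst P')) \<cdot> f" "f \<odot> \<eta> = ((A \<otimes> fst P') \<rhd> \<eta>) \<cdot> f"
    using interchange[of "Ident C \<one>" \<eta> f "Ident C (A \<otimes> fst P')"]
      interchange[of f "Ident C (A \<otimes> fst P')" "Ident C \<one>" \<eta>] by simp_all
  then show "transfer_hom_tensor (\<one>, Ident C A) P' \<eta> f = f"
    "transfer_hom_tensor P' (\<one>, Ident C A) f \<eta> = f"
    using whiskered_algebra_eqs(2)[of "fst P'", THEN Comp_tail, of f]
      free_ract_module(2)[of P', THEN Comp_tail, of f]
    by (simp_all add: transfer_hom_tensor_def) (simp_all add: free_ract_def)
qed

section \<open>The functor\<close>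

lemma transfer_ident_eq: "transfer_ident P = (P, \<eta> \<lhd> fst P, P)"
  by (simp add: transfer_ident_def case_prod_beta)

lemma transfer_cat_simps:
  "Obj coflat_transfer_cat = {P. coflat_transfer P}"
  "Arr coflat_transfer_cat = {(P, f, Q). transfer_hom P f Q}"
  "Dom coflat_transfer_cat (P, f, Q) = P"
  "Cod coflat_transfer_cat (P, f, Q) = Q"
  "Ident coflat_transfer_cat P = (P, \<eta> \<lhd> fst P, P)"
  "TensorO coflat_transfer_cat = transfer_tensor"
  "UnitO coflat_transfer_cat = (\<one>, Ident C A)"
  "Assoc coflat_transfer_cat P Q R = (transfer_tensor P (transfer_tensor Q R),
    \<eta> \<lhd> fst (transfer_tensor P (transfer_tensor Q R)), transfer_tensor P (transfer_tensor Q R))"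
  "LUnit coflat_transfer_cat P = (P, \<eta> \<lhd> fst P, P)"
  "RUnit coflat_transfer_cat P = (P, \<eta> \<lhd> fst P, P)"
  unfolding coflat_transfer_cat_def full_subcategory_simps full_subcategory_moncat_simps
  by (auto simp: transfer_cat_def coflat_transfer_def transfer_hom_def transfer_ident_eq
    case_prod_beta)

text \<open>Typing is needed to rebracket the record's formula as a linear extension. The middle
  objects are equated by a hypothesis, since they may agree only up to strict associativity or unit
  laws.\<close>

lemma transfer_cat_Comp:
  assumes "transfer_hom P f Q" "transfer_hom Q' g R" "Q = Q'"
  shows "Comp coflat_transfer_cat (Q', g, R) (P, f, Q) = (P, linear_ext (fst R) g \<cdot> f, R)"
  using transfer_homD(1-5)[OF assms(1)] transfer_homD(1-5)[OF assms(2)] assms(3)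
  by (simp add: coflat_transfer_cat_def full_subcategory_simps transfer_cat_def case_prod_beta
    linear_ext_def)

lemma transfer_cat_TensorA:
  assumes "transfer_hom P f P'" "transfer_hom Q g Q'"
  shows "TensorA coflat_transfer_cat (P, f, P') (Q, g, Q') =
    (transfer_tensor P Q, transfer_hom_tensor P' Q' f g, transfer_tensor P' Q')"
  using transfer_homD(1-5)[OF assms(1)] transfer_homD(1-5)[OF assms(2)]
  by (simp add: coflat_transfer_cat_def full_subcategory_moncat_simps transfer_cat_def
    case_prod_beta transfer_hom_tensor_def free_ract_def)

lemma transfer_cat_Hom:
  "F \<in> Hom\<^bsub>coflat_transfer_cat\<^esub> P Q \<longleftrightarrow> (\<exists>f. F = (P, f, Q) \<and> transfer_hom P f Q)"
  by (cases F) (auto simp: in_Hom_iff transfer_cat_simps)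

lemma transfer_hom_Comp_Ident:
  assumes "transfer_hom P f Q"
  shows "linear_ext (fst Q) f \<cdot> (\<eta> \<lhd> fst P) = f"
    "linear_ext (fst Q) (\<eta> \<lhd> fst Q) \<cdot> f = f"
  using transfer_homD(1-5)[OF assms] by (simp_all add: linear_ext_unit linear_ext_unit_eq)

lemma transfer_hom_Comp_assoc:
  assumes f: "transfer_hom P f Q" and g: "transfer_hom Q g R" and h: "transfer_hom R h S"
  shows "linear_ext (fst S) (linear_ext (fst S) h \<cdot> g) \<cdot> f =
    linear_ext (fst S) h \<cdot> (linear_ext (fst R) g \<cdot> f)"
proof -
  note [simp] = transfer_homD(1-5,7-9)[OF f] transfer_homD(1-5,7-9)[OF g] transfer_homD(1-5,7-9)[OF h]
  show ?thesis
    by (simp add: transfer_hom_Comp(2)[OF g h])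
qed

text \<open>All constraints are identities, so the coherence laws reduce to strict associativity and
  unitality of the tensor of objects and of arrows.\<close>

lemma coflat_transfer_monoidal_category: "monoidal_category coflat_transfer_cat"
proof
  note T = transfer_cat_simps transfer_cat_Hom transfer_cat_Comp transfer_cat_TensorA
    transfer_hom_Ident transfer_hom_Comp_Ident transfer_hom_tensor_Ident
  fix P Q R S P' P'' Q' Q'' R' F G H F' G'
  let ?T = coflat_transfer_cat
  have Ident_iso: "is_iso ?T (P, \<eta> \<lhd> fst P, P)" if "coflat_transfer P" for P
    using that unfolding is_iso_def by (auto simp: T intro!: bexI[of _ "(P, \<eta> \<lhd> fst P, P)"])
  show "Dom ?T F \<in> Obj ?T" "Cod ?T F \<in> Obj ?T" if "F \<in> Arr ?T"
    using that by (auto simp: T dest: transfer_homD)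
  show "Ident ?T P \<in> Hom\<^bsub>?T\<^esub> P P" if "P \<in> Obj ?T"
    using that by (auto simp: T)
  show "G \<cdot>\<^bsub>?T\<^esub> F \<in> Hom\<^bsub>?T\<^esub> P R" if "F \<in> Hom\<^bsub>?T\<^esub> P Q" "G \<in> Hom\<^bsub>?T\<^esub> Q R"
    using that by (auto simp: T intro: transfer_hom_Comp)
  show "F \<cdot>\<^bsub>?T\<^esub> Ident ?T P = F" "Ident ?T Q \<cdot>\<^bsub>?T\<^esub> F = F" if "F \<in> Hom\<^bsub>?T\<^esub> P Q"
    using that by (auto simp: T transfer_homD(1,2))
  show "(H \<cdot>\<^bsub>?T\<^esub> G) \<cdot>\<^bsub>?T\<^esub> F = H \<cdot>\<^bsub>?T\<^esub> (G \<cdot>\<^bsub>?T\<^esub> F)"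
    if "F \<in> Hom\<^bsub>?T\<^esub> P Q" "G \<in> Hom\<^bsub>?T\<^esub> Q R" "H \<in> Hom\<^bsub>?T\<^esub> R S"
    using that by (auto simp: T transfer_hom_Comp(1) transfer_hom_Comp_assoc)
  show "\<one>\<^bsub>?T\<^esub> \<in> Obj ?T"
    by (simp add: T)
  show "P \<otimes>\<^bsub>?T\<^esub> Q \<in> Obj ?T" if "P \<in> Obj ?T" "Q \<in> Obj ?T"
    using that by (simp add: T)
  show "F \<odot>\<^bsub>?T\<^esub> G \<in> Hom\<^bsub>?T\<^esub> (P \<otimes>\<^bsub>?T\<^esub> Q) (P' \<otimes>\<^bsub>?T\<^esub> Q')"
    if "F \<in> Hom\<^bsub>?T\<^esub> P P'" "G \<in> Hom\<^bsub>?T\<^esub> Q Q'"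
    using that by (auto simp: T intro: transfer_hom_tensor_transfer_hom)
  show "Ident ?T P \<odot>\<^bsub>?T\<^esub> Ident ?T Q = Ident ?T (P \<otimes>\<^bsub>?T\<^esub> Q)" if "P \<in> Obj ?T" "Q \<in> Obj ?T"
    using that by (simp add: T)
  show "(F' \<cdot>\<^bsub>?T\<^esub> F) \<odot>\<^bsub>?T\<^esub> (G' \<cdot>\<^bsub>?T\<^esub> G) = (F' \<odot>\<^bsub>?T\<^esub> G') \<cdot>\<^bsub>?T\<^esub> (F \<odot>\<^bsub>?T\<^esub> G)"
    if "F \<in> Hom\<^bsub>?T\<^esub> P P'" "F' \<in> Hom\<^bsub>?T\<^esub> P' P''" "G \<in> Hom\<^bsub>?T\<^esub> Q Q'" "G' \<in> Hom\<^bsub>?T\<^esub> Q' Q''"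
    using that by (auto simp: T transfer_hom_tensor_Comp transfer_hom_Comp(1)
      transfer_hom_tensor_transfer_hom)
  show "Assoc ?T P Q R \<in> Hom\<^bsub>?T\<^esub> (P \<otimes>\<^bsub>?T\<^esub> (Q \<otimes>\<^bsub>?T\<^esub> R)) ((P \<otimes>\<^bsub>?T\<^esub> Q) \<otimes>\<^bsub>?T\<^esub> R)"
    "is_iso ?T (Assoc ?T P Q R)"
    if "P \<in> Obj ?T" "Q \<in> Obj ?T" "R \<in> Obj ?T"
    using that transfer_hom_Ident[of "transfer_tensor P (transfer_tensor Q R)"]
      Ident_iso[of "transfer_tensor P (transfer_tensor Q R)"]
    by (simp_all add: T transfer_tensor_assoc)
  show "Assoc ?T P' Q' R' \<cdot>\<^bsub>?T\<^esub> (F \<odot>\<^bsub>?T\<^esub> (G \<odot>\<^bsub>?T\<^esub> H)) =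
      ((F \<odot>\<^bsub>?T\<^esub> G) \<odot>\<^bsub>?T\<^esub> H) \<cdot>\<^bsub>?T\<^esub> Assoc ?T P Q R"
    if F: "F \<in> Hom\<^bsub>?T\<^esub> P P'" and G: "G \<in> Hom\<^bsub>?T\<^esub> Q Q'" and H: "H \<in> Hom\<^bsub>?T\<^esub> R R'"
  proof -
    obtain f g h where f: "F = (P, f, P')" "transfer_hom P f P'"
      and g: "G = (Q, g, Q')" "transfer_hom Q g Q'" and h: "H = (R, h, R')" "transfer_hom R h R'"
      using F G H by (auto simp: T)
    note [simp] = transfer_homD(1,2)[OF f(2)] transfer_homD(1,2)[OF g(2)] transfer_homD(1,2)[OF h(2)]
    \<comment> \<open>Both bracketings give one and the same triple: the objects agree by
      \<open>transfer_tensor_assoc\<close>, the arrows by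
      \<open>transfer_hom_tensor_assoc\<close>.\<close>
    let ?D = "transfer_tensor P (transfer_tensor Q R)"
    let ?E = "transfer_tensor P' (transfer_tensor Q' R')"
    let ?t = "transfer_hom_tensor P' (transfer_tensor Q' R') f (transfer_hom_tensor Q' R' g h)"
    have t: "transfer_hom ?D ?t ?E"
      by (intro transfer_hom_tensor_transfer_hom f g h)
    have "F \<odot>\<^bsub>?T\<^esub> (G \<odot>\<^bsub>?T\<^esub> H) = (?D, ?t, ?E)"
      by (simp add: f g h T transfer_hom_tensor_transfer_hom)
    moreover have "(F \<odot>\<^bsub>?T\<^esub> G) \<odot>\<^bsub>?T\<^esub> H = (?D, ?t, ?E)"
      by (simp add: f g h T transfer_hom_tensor_transfer_hom transfer_tensor_assoc
        transfer_hom_tensor_assoc[OF f(2) g(2) h(2)])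
    moreover have "Assoc ?T P Q R = Ident ?T ?D" "Assoc ?T P' Q' R' = Ident ?T ?E"
      by (simp_all add: T)
    ultimately show ?thesis
      using t transfer_cat_Comp[OF t transfer_hom_Ident refl]
        transfer_cat_Comp[OF transfer_hom_Ident t refl] transfer_hom_Comp_Ident[OF t]
      unfolding transfer_cat_simps by simp
  qed
  show "LUnit ?T P \<in> Hom\<^bsub>?T\<^esub> (\<one>\<^bsub>?T\<^esub> \<otimes>\<^bsub>?T\<^esub> P) P" "is_iso ?T (LUnit ?T P)"
    "RUnit ?T P \<in> Hom\<^bsub>?T\<^esub> (P \<otimes>\<^bsub>?T\<^esub> \<one>\<^bsub>?T\<^esub>) P" "is_iso ?T (RUnit ?T P)"
    if "P \<in> Obj ?T"
    using that Ident_iso[of P] by (simp_all add: T transfer_tensor_unit)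
  have unit: "transfer_hom (\<one>, Ident C A) \<eta> (\<one>, Ident C A)"
    using transfer_hom_Ident[OF coflat_transfer_unit] by simp
  show "LUnit ?T Q \<cdot>\<^bsub>?T\<^esub> (Ident ?T \<one>\<^bsub>?T\<^esub> \<odot>\<^bsub>?T\<^esub> F) = F \<cdot>\<^bsub>?T\<^esub> LUnit ?T P"
    "RUnit ?T Q \<cdot>\<^bsub>?T\<^esub> (F \<odot>\<^bsub>?T\<^esub> Ident ?T \<one>\<^bsub>?T\<^esub>) = F \<cdot>\<^bsub>?T\<^esub> RUnit ?T P"
    if "F \<in> Hom\<^bsub>?T\<^esub> P Q"
    using that unit
    by (auto simp: T transfer_homD(1,2) transfer_tensor_unit transfer_hom_tensor_unit)
  show "Assoc ?T (S \<otimes>\<^bsub>?T\<^esub> P) Q R \<cdot>\<^bsub>?T\<^esub> Assoc ?T S P (Q \<otimes>\<^bsub>?T\<^esub> R) =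
      (Assoc ?T S P Q \<odot>\<^bsub>?T\<^esub> Ident ?T R) \<cdot>\<^bsub>?T\<^esub> Assoc ?T S (P \<otimes>\<^bsub>?T\<^esub> Q) R \<cdot>\<^bsub>?T\<^esub>
        (Ident ?T S \<odot>\<^bsub>?T\<^esub> Assoc ?T P Q R)"
    if "S \<in> Obj ?T" "P \<in> Obj ?T" "Q \<in> Obj ?T" "R \<in> Obj ?T"
  proof -
    have [simp]: "coflat_transfer S" "coflat_transfer P" "coflat_transfer Q" "coflat_transfer R"
      using that by (simp_all add: T)
    \<comment> \<open>With every associator an identity, both sides of the pentagon collapse to the
      identity of the fourfold tensor product.\<close>
    have a: "Assoc ?T P Q R = Ident ?T (P \<otimes>\<^bsub>?T\<^esub> (Q \<otimes>\<^bsub>?T\<^esub> R))" for P Q R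
      by (simp add: T)
    have t: "Ident ?T P \<odot>\<^bsub>?T\<^esub> Ident ?T Q = Ident ?T (P \<otimes>\<^bsub>?T\<^esub> Q)"
      if "coflat_transfer P" "coflat_transfer Q" for P Q
      using that by (simp add: T)
    have c: "Ident ?T P \<cdot>\<^bsub>?T\<^esub> Ident ?T P = Ident ?T P" if "coflat_transfer P" for P
      using that by (simp add: T)
    show ?thesis
      unfolding a by (simp add: t c transfer_cat_simps(6) transfer_tensor_assoc)
  qed
  show "(RUnit ?T P \<odot>\<^bsub>?T\<^esub> Ident ?T Q) \<cdot>\<^bsub>?T\<^esub> Assoc ?T P \<one>\<^bsub>?T\<^esub> Q = Ident ?T P \<odot>\<^bsub>?T\<^esub> LUnit ?T Q"
    if "P \<in> Obj ?T" "Q \<in> Obj ?T"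
  proof -
    have [simp]: "coflat_transfer P" "coflat_transfer Q"
      using that by (simp_all add: T)
    show ?thesis
      using transfer_hom_Ident[of "transfer_tensor P Q"]
        transfer_hom_Comp_Ident[OF transfer_hom_Ident, of "transfer_tensor P Q"]
      by (simp add: T transfer_tensor_unit)
  qed
qed

section \<open>Structure maps of the functor\<close>

definition mult_hom :: "'a \<times> 'b \<Rightarrow> 'a \<times> 'b \<Rightarrow> 'b"
  where "mult_hom P Q = factor C (bimodule_quot (free_bimodule P) (free_bimodule Q))
    (free_ract P \<lhd> fst Q)"

text \<open>The arrow \<open>free_ract P \<lhd> fst Q\<close> and the chosen quotient are
  coequalizers of the same pair, because the second factor is free.\<close>

lemma mult_hom_props:
  assumes P: "coflat_transfer P" and Q: "coflat_transfer Q"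
  shows "mult_hom P Q \<in> Arr C"
    "Dom C (mult_hom P Q) = carrier (bimodule_tensor (free_bimodule P) (free_bimodule Q))"
    "Cod C (mult_hom P Q) = A \<otimes> fst P \<otimes> fst Q"
    "mult_hom P Q \<cdot> bimodule_quot (free_bimodule P) (free_bimodule Q) = free_ract P \<lhd> fst Q"
    "is_iso C (mult_hom P Q)"
proof -
  note [simp] = P Q
  note q = bimodule_quot_coeq[OF admissible_free[OF P] admissible_free[OF Q], simplified]
  have e: "is_coequalizer C (free_ract P \<lhd> (A \<otimes> fst Q)) ((A \<otimes> fst P) \<rhd> (m \<lhd> fst Q))
      (free_ract P \<lhd> fst Q)"
    using right_action_coequalizer[OF admissible_modules(5)[OF admissible_free[OF P]], of "fst Q"]
    by simp
  note F = coequalizer_factor[OF q, OF _ _ coequalizer_typing(7)[OF e, symmetric]]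
  show "mult_hom P Q \<in> Arr C"
    "Dom C (mult_hom P Q) = carrier (bimodule_tensor (free_bimodule P) (free_bimodule Q))"
    "Cod C (mult_hom P Q) = A \<otimes> fst P \<otimes> fst Q"
    "mult_hom P Q \<cdot> bimodule_quot (free_bimodule P) (free_bimodule Q) = free_ract P \<lhd> fst Q"
    using F unfolding mult_hom_def by simp_all
  show "is_iso C (mult_hom P Q)"
    unfolding mult_hom_def by (rule coequalizer_factor_iso[OF q e])
qed

lemma bimod_hom_mult:
  assumes P: "coflat_transfer P" and Q: "coflat_transfer Q"
  shows "bimod_hom (bimodule_tensor (free_bimodule P) (free_bimodule Q)) (mult_hom P Q)
    (free_bimodule (transfer_tensor P Q))"
proof -
  note M = mult_hom_props[OF P Q]
  note F = admissible_free[OF P] admissible_free[OF Q]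
  note [simp] = P Q M(1-3)
  let ?FP = "free_bimodule P" and ?FQ = "free_bimodule Q"
  let ?q = "bimodule_quot ?FP ?FQ"
  note E = M(4) tensor_actions[OF F]
  have w: "(A \<rhd> mult_hom P Q) \<cdot> (A \<rhd> ?q) = A \<rhd> (free_ract P \<lhd> fst Q)"
    "(mult_hom P Q \<lhd> A) \<cdot> (?q \<lhd> A) = free_ract P \<lhd> (fst Q \<otimes> A)"
    using M(4)[THEN arg_cong, of "\<lambda>f. A \<rhd> f"] M(4)[THEN arg_cong, of "\<lambda>f. f \<lhd> A"] by simp_all
  have l: "(free_ract P \<lhd> fst Q) \<cdot> (m \<lhd> (fst P \<otimes> A \<otimes> fst Q)) =
      (m \<lhd> (fst P \<otimes> fst Q)) \<cdot> (A \<rhd> (free_ract P \<lhd> fst Q))"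
    using free_ract_left_linear(1)[OF P, THEN arg_cong, of "\<lambda>f. f \<lhd> fst Q"] by simp
  have "mult_hom P Q \<cdot> lact (bimodule_tensor ?FP ?FQ) =
      (m \<lhd> (fst P \<otimes> fst Q)) \<cdot> (A \<rhd> mult_hom P Q)"
    by (rule epiD[OF bimodule_quot_epi(2)[OF F algebra_typing(1)]])
      (simp_all add: E E[THEN Comp_tail] w l)
  moreover have "mult_hom P Q \<cdot> ract (bimodule_tensor ?FP ?FQ) =
      free_ract (transfer_tensor P Q) \<cdot> (mult_hom P Q \<lhd> A)"
    by (rule epiD[OF bimodule_quot_epi(3)[OF F algebra_typing(1) A_coflat]])
      (simp_all add: E E[THEN Comp_tail] w free_ract_tensor_balanced)
  ultimately show ?thesis
    by (simp add: bimod_hom_iff)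
qed

lemma mult_hom_natural:
  assumes f: "transfer_hom P f P'" and g: "transfer_hom Q g Q'"
  shows "mult_hom P' Q' \<cdot> tensor_hom (free_bimodule P) (free_bimodule P') (free_bimodule Q)
      (free_bimodule Q') (linear_ext (fst P') f) (linear_ext (fst Q') g) =
    linear_ext (fst P' \<otimes> fst Q') (transfer_hom_tensor P' Q' f g) \<cdot> mult_hom P Q"
proof -
  note f' = transfer_homD[OF f] and g' = transfer_homD[OF g]
  note M = mult_hom_props[OF f'(1) g'(1)] mult_hom_props[OF f'(2) g'(2)]
  note t = tensor_hom_simps[OF bimod_hom_linear_ext[OF f] bimod_hom_linear_ext[OF g]]
  note s = transfer_homD[OF transfer_hom_tensor_transfer_hom[OF f g]]
  note [simp] = f'(1-5,7-9) g'(1-5,7-9) M(1-3,6-8) t(1-3)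
  have [simp]: "linear_ext (fst P' \<otimes> fst Q') (transfer_hom_tensor P' Q' f g) \<in> Arr C"
    "Dom C (linear_ext (fst P' \<otimes> fst Q') (transfer_hom_tensor P' Q' f g)) =
      A \<otimes> fst P \<otimes> fst Q"
    using s(7,8) by simp_all
  note E = t(4) M(4,9)
  show ?thesis
    by (rule epiD[OF bimodule_quot_epi(1)[OF admissible_free[OF f'(1)] admissible_free[OF g'(1)]]])
      (simp_all add: E E[THEN Comp_tail] linear_ext_tensor_quot[OF f g])
qed

text \<open>The source associator is an identity and does not appear. Precomposed with the iterated
  quotient map, the claim is \<open>b\<close>, the right linearity of the multiplication tensored
  with the object of \<open>R\<close>.\<close>

lemma mult_hom_assoc:
  assumes P: "coflat_transfer P" and Q: "coflat_transfer Q" and R: "coflat_transfer R"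
  shows "mult_hom P (transfer_tensor Q R) \<cdot>
      tensor_hom (free_bimodule P) (free_bimodule P)
        (bimodule_tensor (free_bimodule Q) (free_bimodule R)) (free_bimodule (transfer_tensor Q R))
        (Ident C (A \<otimes> fst P)) (mult_hom Q R) =
    mult_hom (transfer_tensor P Q) R \<cdot>
      tensor_hom (bimodule_tensor (free_bimodule P) (free_bimodule Q))
        (free_bimodule (transfer_tensor P Q)) (free_bimodule R) (free_bimodule R)
        (mult_hom P Q) (Ident C (A \<otimes> fst R)) \<cdot>
      assoc_hom (free_bimodule P) (free_bimodule Q) (free_bimodule R)"
proof -
  note [simp] = P Q R
  let ?FP = "free_bimodule P" and ?FQ = "free_bimodule Q" and ?FR = "free_bimodule R"
  note F = admissible_free[OF P] admissible_free[OF Q] admissible_free[OF R]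
  have T: "coflat_transfer (transfer_tensor P Q)" "coflat_transfer (transfer_tensor Q R)"
    by simp_all
  note M = mult_hom_props[OF P Q] mult_hom_props[OF Q R] mult_hom_props[OF P T(2)]
    mult_hom_props[OF T(1) R]
  note t = tensor_hom_simps[OF bimod_hom_Ident[OF F(1)] bimod_hom_mult[OF Q R], simplified]
    tensor_hom_simps[OF bimod_hom_mult[OF P Q] bimod_hom_Ident[OF F(3)], simplified]
  note a = assoc_hom_props[OF F]
  note a4 = a(4)[unfolded free_bimodule_simps]
  note [simp] = M(1-3,6-8,11-13,16-18) t(1-3,5-7) a(1-3)
  note E = M(14,19) t(4,8)
  have w: "((A \<otimes> fst P) \<rhd> mult_hom Q R) \<cdot> ((A \<otimes> fst P) \<rhd> bimodule_quot ?FQ ?FR) =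
      (A \<otimes> fst P) \<rhd> (free_ract Q \<lhd> fst R)"
    "(mult_hom P Q \<lhd> (A \<otimes> fst R)) \<cdot> (bimodule_quot ?FP ?FQ \<lhd> (A \<otimes> fst R)) =
      free_ract P \<lhd> (fst Q \<otimes> A \<otimes> fst R)"
    using M(9)[THEN arg_cong, of "\<lambda>f. (A \<otimes> fst P) \<rhd> f"]
      M(4)[THEN arg_cong, of "\<lambda>f. f \<lhd> (A \<otimes> fst R)"] by simp_all
  have b: "(free_ract P \<lhd> (fst Q \<otimes> fst R)) \<cdot> ((A \<otimes> fst P) \<rhd> (free_ract Q \<lhd> fst R)) =
      (free_ract (transfer_tensor P Q) \<lhd> fst R) \<cdot> (free_ract P \<lhd> (fst Q \<otimes> A \<otimes> fst R))"
    using free_ract_tensor_balanced[OF P Q, THEN arg_cong, of "\<lambda>f. f \<lhd> fst R"] by simp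
  show ?thesis
    by (rule epiD[OF iterated_quot_epi[OF F]])
      (simp_all add: E E[THEN Comp_tail] a4 a4[THEN Comp_tail3] w b)
qed

text \<open>The free bimodule on the unit object is \<open>(A, m, m)\<close>, so both sides factor
  the same action through the same quotient.\<close>

lemma mult_hom_unit:
  assumes "coflat_transfer P"
  shows "mult_hom (\<one>, Ident C A) P = lunit_hom (free_bimodule P)"
    "mult_hom P (\<one>, Ident C A) = runit_hom (free_bimodule P)"
  using assms by (simp_all add: mult_hom_def lunit_hom_def runit_hom_def free_bimodule_unit)
    (simp add: free_ract_def)

text \<open>The unit constraint can be an identity because \<open>free_bimodule_unit\<close> is an
  equality of triples.\<close>

definition free_bimodule_functor ::
  "('a \<times> 'b, ('a \<times> 'b) \<times> 'b \<times> ('a \<times> 'b), 'a \<times> 'b \<times> 'b,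
    ('a \<times> 'b \<times> 'b) \<times> 'b \<times> ('a \<times> 'b \<times> 'b)) monoidal_functor_data"
  where "free_bimodule_functor = \<lparr>
    OnObj = free_bimodule,
    OnArr = (\<lambda>(P, f, Q). (free_bimodule P, linear_ext (fst Q) f, free_bimodule Q)),
    Mult = (\<lambda>P Q. (bimodule_tensor (free_bimodule P) (free_bimodule Q), mult_hom P Q,
      free_bimodule (transfer_tensor P Q))),
    Unit = ((A, m, m), Ident C A, (A, m, m))\<rparr>"

lemma free_bimodule_functor_simps:
  "OnObj free_bimodule_functor = free_bimodule"
  "OnArr free_bimodule_functor (P, f, Q) =
    (free_bimodule P, linear_ext (fst Q) f, free_bimodule Q)"
  "Mult free_bimodule_functor P Q = (bimodule_tensor (free_bimodule P) (free_bimodule Q),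
    mult_hom P Q, free_bimodule (transfer_tensor P Q))"
  "Unit free_bimodule_functor = ((A, m, m), Ident C A, (A, m, m))"
  by (simp_all add: free_bimodule_functor_def)

lemma free_bimodule_strong_monoidal:
  "strong_monoidal_functor coflat_transfer_cat coflat_robust_bimodule_cat free_bimodule_functor"
proof -
  let ?T = coflat_transfer_cat and ?D = coflat_robust_bimodule_cat and ?H = free_bimodule_functor
  interpret T: monoidal_category ?T
    by (rule coflat_transfer_monoidal_category)
  interpret D: monoidal_category ?D
    by (rule coflat_robust_bimodule_monoidal_category)
  note S = transfer_cat_simps transfer_cat_Hom transfer_cat_Comp transfer_cat_TensorA
    bimodule_cat_simps bimodule_cat_Hom free_bimodule_functor_simps
  have unit: "bimod_hom (A, m, m) (Ident C A) (A, m, m)"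
    using bimod_hom_Ident[OF admissible_regular] by simp
  show ?thesis
  proof
    fix P Q R P' Q' F G
    show "OnObj ?H P \<in> Obj ?D" if "P \<in> Obj ?T"
      using that by (simp add: S)
    show "OnArr ?H F \<in> Hom\<^bsub>?D\<^esub> (OnObj ?H P) (OnObj ?H Q)" if "F \<in> Hom\<^bsub>?T\<^esub> P Q"
      using that by (auto simp: S bimod_hom_linear_ext)
    show "OnArr ?H (Ident ?T P) = Ident ?D (OnObj ?H P)" if "P \<in> Obj ?T"
      using that by (simp add: S linear_ext_unit_eq)
    show "OnArr ?H (G \<cdot>\<^bsub>?T\<^esub> F) = OnArr ?H G \<cdot>\<^bsub>?D\<^esub> OnArr ?H F"
      if "F \<in> Hom\<^bsub>?T\<^esub> P Q" "G \<in> Hom\<^bsub>?T\<^esub> Q R"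
      using that by (auto simp: S transfer_hom_Comp(2))
    show "Mult ?H P Q \<in> Hom\<^bsub>?D\<^esub> (OnObj ?H P \<otimes>\<^bsub>?D\<^esub> OnObj ?H Q) (OnObj ?H (P \<otimes>\<^bsub>?T\<^esub> Q))"
      "is_iso ?D (Mult ?H P Q)"
      if "P \<in> Obj ?T" "Q \<in> Obj ?T"
      using that by (auto simp: S intro!: bimod_hom_mult bimodule_cat_iso mult_hom_props)
    show "Mult ?H P' Q' \<cdot>\<^bsub>?D\<^esub> (OnArr ?H F \<odot>\<^bsub>?D\<^esub> OnArr ?H G) =
        OnArr ?H (F \<odot>\<^bsub>?T\<^esub> G) \<cdot>\<^bsub>?D\<^esub> Mult ?H P Q"
      if "F \<in> Hom\<^bsub>?T\<^esub> P P'" "G \<in> Hom\<^bsub>?T\<^esub> Q Q'"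
      using that by (auto simp: S mult_hom_natural)
    show "Unit ?H \<in> Hom\<^bsub>?D\<^esub> \<one>\<^bsub>?D\<^esub> (OnObj ?H \<one>\<^bsub>?T\<^esub>)"
      using unit by (simp add: S free_bimodule_unit)
    show "is_iso ?D (Unit ?H)"
      using bimodule_cat_iso[OF unit Ident_iso] by (simp add: S)
    show "OnArr ?H (Assoc ?T P Q R) \<cdot>\<^bsub>?D\<^esub> Mult ?H P (Q \<otimes>\<^bsub>?T\<^esub> R) \<cdot>\<^bsub>?D\<^esub>
          (Ident ?D (OnObj ?H P) \<odot>\<^bsub>?D\<^esub> Mult ?H Q R) =
        Mult ?H (P \<otimes>\<^bsub>?T\<^esub> Q) R \<cdot>\<^bsub>?D\<^esub> (Mult ?H P Q \<odot>\<^bsub>?D\<^esub> Ident ?D (OnObj ?H R)) \<cdot>\<^bsub>?D\<^esub>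
          Assoc ?D (OnObj ?H P) (OnObj ?H Q) (OnObj ?H R)"
      if "P \<in> Obj ?T" "Q \<in> Obj ?T" "R \<in> Obj ?T"
    proof -
      have c [simp]: "coflat_transfer P" "coflat_transfer Q" "coflat_transfer R"
        using that by (simp_all add: S)
      have T: "coflat_transfer (transfer_tensor Q R)"
        by simp
      note F = admissible_free[OF c(1)]
      \<comment> \<open>The image of the source associator is an identity; \<open>h\<close> supplies
        the typing of the composite from which it is cancelled.\<close>
      note h = bimod_hom_Comp[OF bimod_hom_tensor[OF bimod_hom_Ident[OF F] bimod_hom_mult[OF c(2,3)]]
        bimod_hom_mult[OF c(1) T]]
      have "linear_ext (fst (transfer_tensor P (transfer_tensor Q R)))
          (\<eta> \<lhd> fst (transfer_tensor P (transfer_tensor Q R))) =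
        Ident C (A \<otimes> fst P \<otimes> fst Q \<otimes> fst R)"
        by (simp add: linear_ext_unit_eq)
      then show ?thesis
        using bimod_homD(3,5)[OF h] mult_hom_assoc[OF c]
        by (simp add: S transfer_tensor_assoc)
    qed
    show "OnArr ?H (LUnit ?T P) \<cdot>\<^bsub>?D\<^esub> Mult ?H \<one>\<^bsub>?T\<^esub> P \<cdot>\<^bsub>?D\<^esub>
          (Unit ?H \<odot>\<^bsub>?D\<^esub> Ident ?D (OnObj ?H P)) = LUnit ?D (OnObj ?H P)"
      "OnArr ?H (RUnit ?T P) \<cdot>\<^bsub>?D\<^esub> Mult ?H P \<one>\<^bsub>?T\<^esub> \<cdot>\<^bsub>?D\<^esub>
          (Ident ?D (OnObj ?H P) \<odot>\<^bsub>?D\<^esub> Unit ?H) = RUnit ?D (OnObj ?H P)"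
      if "P \<in> Obj ?T"
    proof -
      have c [simp]: "coflat_transfer P"
        using that by (simp add: S)
      note F = admissible_free[OF c]
      note u = lunit_hom_props[OF F] runit_hom_props[OF F]
      show "OnArr ?H (LUnit ?T P) \<cdot>\<^bsub>?D\<^esub> Mult ?H \<one>\<^bsub>?T\<^esub> P \<cdot>\<^bsub>?D\<^esub>
          (Unit ?H \<odot>\<^bsub>?D\<^esub> Ident ?D (OnObj ?H P)) = LUnit ?D (OnObj ?H P)"
        "OnArr ?H (RUnit ?T P) \<cdot>\<^bsub>?D\<^esub> Mult ?H P \<one>\<^bsub>?T\<^esub> \<cdot>\<^bsub>?D\<^esub>
          (Ident ?D (OnObj ?H P) \<odot>\<^bsub>?D\<^esub> Unit ?H) = RUnit ?D (OnObj ?H P)"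
        using u(1-3,6-8) tensor_hom_Ident[OF admissible_regular F] tensor_hom_Ident[OF F admissible_regular]
        by (simp_all add: S mult_hom_unit transfer_tensor_unit free_bimodule_unit linear_ext_unit_eq)
    qed
  qed
qed

lemma free_bimodule_fully_faithful:
  "fully_faithful coflat_transfer_cat coflat_robust_bimodule_cat free_bimodule_functor"
  unfolding fully_faithful_def
proof (intro ballI)
  let ?T = coflat_transfer_cat and ?D = coflat_robust_bimodule_cat and ?H = free_bimodule_functor
  note S = transfer_cat_simps transfer_cat_Hom bimodule_cat_simps bimodule_cat_Hom
    free_bimodule_functor_simps
  fix P Q assume "P \<in> Obj ?T" "Q \<in> Obj ?T"
  then have [simp]: "coflat_transfer P" "coflat_transfer Q"
    by (simp_all add: S)
  show "bij_betw (OnArr ?H) (Hom\<^bsub>?T\<^esub> P Q) (Hom\<^bsub>?D\<^esub> (OnObj ?H P) (OnObj ?H Q))"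
  \<comment> \<open>The inverse restricts a bimodule map along \<open>\<eta> \<lhd> fst P\<close>,
    which determines a left linear map on a free module.\<close>
  proof (rule bij_betw_byWitness[where f' = "\<lambda>(_, h, _). (P, h \<cdot> (\<eta> \<lhd> fst P), Q)"])
    have ext: "linear_ext (fst Q) (h \<cdot> (\<eta> \<lhd> fst P)) = h"
      "transfer_hom P (h \<cdot> (\<eta> \<lhd> fst P)) Q"
      if h: "bimod_hom (free_bimodule P) h (free_bimodule Q)" for h
    proof -
      note [simp] = bimod_homD(3-5)[OF h, simplified]
      show *: "linear_ext (fst Q) (h \<cdot> (\<eta> \<lhd> fst P)) = h"
        using bimod_homD(6)[OF h] by (intro linear_ext_of_left_linear) simp_all
      show "transfer_hom P (h \<cdot> (\<eta> \<lhd> fst P)) Q"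
        using h by (simp add: transfer_hom_iff_bimod_hom *)
    qed
    show "\<forall>F \<in> Hom\<^bsub>?T\<^esub> P Q. (\<lambda>(_, h, _). (P, h \<cdot> (\<eta> \<lhd> fst P), Q)) (OnArr ?H F) = F"
      by (auto simp: S transfer_hom_Comp_Ident)
    show "\<forall>F \<in> Hom\<^bsub>?D\<^esub> (OnObj ?H P) (OnObj ?H Q).
        OnArr ?H ((\<lambda>(_, h, _). (P, h \<cdot> (\<eta> \<lhd> fst P), Q)) F) = F"
      by (auto simp: S ext)
    show "OnArr ?H ` Hom\<^bsub>?T\<^esub> P Q \<subseteq> Hom\<^bsub>?D\<^esub> (OnObj ?H P) (OnObj ?H Q)"
    proof (rule image_subsetI)
      fix F assume "F \<in> Hom\<^bsub>?T\<^esub> P Q"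
      then obtain f where "F = (P, f, Q)" "transfer_hom P f Q"
        by (auto simp: S)
      then show "OnArr ?H F \<in> Hom\<^bsub>?D\<^esub> (OnObj ?H P) (OnObj ?H Q)"
        by (simp add: S bimod_hom_linear_ext)
    qed
    show "(\<lambda>(_, h, _). (P, h \<cdot> (\<eta> \<lhd> fst P), Q)) ` Hom\<^bsub>?D\<^esub> (OnObj ?H P) (OnObj ?H Q) \<subseteq>
        Hom\<^bsub>?T\<^esub> P Q"
    proof (rule image_subsetI)
      fix F assume "F \<in> Hom\<^bsub>?D\<^esub> (OnObj ?H P) (OnObj ?H Q)"
      then obtain h where "F = (free_bimodule P, h, free_bimodule Q)"
        "bimod_hom (free_bimodule P) h (free_bimodule Q)"
        by (auto simp: S)
      then show "(case F of (_, h, _) \<Rightarrow> (P, h \<cdot> (\<eta> \<lhd> fst P), Q)) \<in> Hom\<^bsub>?T\<^esub> P Q"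
        by (simp add: S ext)
    qed
  qed
qed

end

theorem lemma5p1:
  fixes C :: "('o, 'a, 'z) moncat_scheme" and A :: 'o and m \<eta> :: 'a
  assumes "strict_monoidal_category C"
    and "has_coequalizers C"
    and "monoidal_algebra C A m \<eta>"
    and "left_coflat C A"
  shows "\<exists>H :: ('o \<times> 'a, ('o \<times> 'a) \<times> 'a \<times> ('o \<times> 'a),
                 'o \<times> 'a \<times> 'a, ('o \<times> 'a \<times> 'a) \<times> 'a \<times> ('o \<times> 'a \<times> 'a)) monoidal_functor_data.
    strong_monoidal_functor
      (monoidal_algebra.coflat_transfer_cat C A m \<eta>)
      (monoidal_algebra.coflat_robust_bimodule_cat C A m \<eta>) H \<and>
    fully_faithful
      (monoidal_algebra.coflat_transfer_cat C A m \<eta>)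
      (monoidal_algebra.coflat_robust_bimodule_cat C A m \<eta>) H"
proof -
  interpret coflat_algebra C A m \<eta>
    using assms by (intro coflat_algebra.intro coflat_algebra_axioms.intro)
  show ?thesis
    using free_bimodule_strong_monoidal free_bimodule_fully_faithful by blast
qed

end
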